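(* There are constants $c_0,r_0>0$ such that the following holds for every origin-symmetric convex body $K\subset\mathbb R^2$. Let $\mathcal P$ be a finite family of planar planks and let \[ H := K\setminus\bigcup_{P\in\mathcal P}P . \] If $H\subset rK$ for some $0<r<r_0$, then \[ \sum_{P\in\mathcal P}|P\cap K|\ \ge\ |K|+\frac{c_0}{r}|H| . \]
   Context: A convex body is a compact convex set with nonempty interior; it is origin-symmetric if $K=-K$. $rK=\{rx:x\in K\}$, and $|\cdot|$ denotes area (planar Lebesgue measure). A plank in $\mathbb R^2$ is the closed region between two parallel lines. *)

theory Defs
  imports "HOL-Analysis.Analysis"
begin

definition convex_body :: "(real ^ 2) set \<Rightarrow> bool" where
  "convex_body K \<longleftrightarrow> compact K \<and> convex K \<and> interior K \<noteq> {}"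

definition origin_symmetric :: "(real ^ 2) set \<Rightarrow> bool" where
  "origin_symmetric K \<longleftrightarrow> K = uminus ` K"

text \<open>The bounding lines u . x = a and u . x = b are required to be distinct, so a single
  line is not a plank.\<close>

definition plank :: "(real ^ 2) set \<Rightarrow> bool" where
  "plank P \<longleftrightarrow> (\<exists>u a b. u \<noteq> 0 \<and> a < b \<and> P = {x. a \<le> u \<bullet> x \<and> u \<bullet> x \<le> b})"

abbreviation area :: "(real ^ 2) set \<Rightarrow> real" where
  "area \<equiv> measure lebesgue"

end

theory Submission
  imports Defs
begin

text \<open>
  Let \<open>m\<close> be the number of planks through a point.  Integrating \<open>m\<close> over \<open>K\<close> gives
  \<open>sum |P \<inter> K| = |K| - |H| + X\<close>, where \<open>X\<close> is the excess, the integral of \<open>max 0 (m - 1)\<close>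
  over \<open>K\<close>.  So the theorem says that overlapping is unavoidable around a small hole:
  \<open>X\<close> is at least a constant times \<open>|H| / r\<close> (the loss of \<open>|H|\<close> itself is absorbed for small \<open>r\<close>).
  An affine map, which changes all areas by the same factor, puts \<open>K\<close> between two fixed discs
  (\<open>maximal_basis\<close>); the hole then has height \<open>O(r)\<close>, and it is enough to bound the length of
  each of its horizontal slices by a constant times \<open>X\<close> (\<open>slice_bound\<close>).

  The mechanism is rigidity.  If a finite family of strips nearly tiles the unit disc, that is, if
  the integral of \<open>|m - 1|\<close> is small, then up to a small total area all strips near the centre have
  one common direction (\<open>rigidity_constant\<close>).  This statement is affinely invariant, so it also
  applies to a tube of length about 1 and of an arbitrarily small width \<open>R\<close>, with the smallness of
  the deviation measured relative to \<open>R\<close>.  Take a point of the hole.  If \<open>X\<close> is not already large,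
  the strips nearly tile the disc, and after a rotation their common direction is vertical.  Around
  the point consider tubes of width \<open>1/2\<close>, \<open>1/4\<close>, and so on.  As long as the excess in the tube of
  width \<open>R\<close> is below a small multiple of \<open>R\<close>, rigidity yields a direction at width \<open>R\<close>, which
  differs from the one at width \<open>2R\<close> by \<open>O(R)\<close> (\<open>aligned_step\<close>); the hole has height
  \<open>O(r)\<close> and therefore occupies only a small part of every such tube.  This cannot go on for
  ever, because strips following the direction within \<open>O(R)\<close> would come arbitrarily close to the
  point (\<open>chain_stops\<close>).  Hence every point of the hole has a tube of some width \<open>R\<close> with excess at
  least \<open>cR\<close>.  The tubes of points on one horizontal line are disjoint as soon as the
  points are far apart compared with the widths (\<open>tubes_disjoint\<close>), since at coarser scales the
  directions found at two nearby points are almost equal.  A Vitali covering of the slice then gives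
  slice length at most \<open>O(X)\<close>.

  For rigidity, weigh each pair of strips by the squared sine of its angle and call the weighted area
  of the pairwise intersections the crossing of the family.  The crossing is at most a constant times
  the deviation (\<open>crossing_energy\<close>); the problem is that many strips may pass through a common
  small disc, where the crossing is quadratic in the multiplicity but the deviation only linear,
  and the remedy is to stop at the radius at which the mean multiplicity has
  dropped to 2.  When the crossing is small, some strip is hardly crossed; make it vertical, read the
  second coordinate as time, and regard the other strips as moving intervals.  The mass of the
  intervals to the left of a hardly crossed line is almost constant in time, and in a near-tiling
  this mass measures horizontal distance.  So hardly crossed lines keep their distance, that is, they
  have equal speeds (\<open>speed_bound\<close>), and the strips of any other direction are crossed along their
  whole length, so their total area is bounded by the crossing (\<open>tilted_area\<close>).
\<close>

section \<open>Integration in the plane\<close>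

lemma nn_integral_lborel_plane:
  fixes f :: "real \<times> real \<Rightarrow> ennreal"
  assumes [measurable]: "f \<in> borel_measurable borel"
  shows "(\<integral>\<^sup>+y. f y \<partial>lborel) = (\<integral>\<^sup>+x. (\<integral>\<^sup>+t. f (x, t) \<partial>lborel) \<partial>lborel)"
    and "(\<integral>\<^sup>+y. f y \<partial>lborel) = (\<integral>\<^sup>+t. (\<integral>\<^sup>+x. f (x, t) \<partial>lborel) \<partial>lborel)"
proof -
  have m: "f \<in> borel_measurable (lborel \<Otimes>\<^sub>M lborel)"
    by (simp add: lborel_prod)
  show "(\<integral>\<^sup>+y. f y \<partial>lborel) = (\<integral>\<^sup>+x. (\<integral>\<^sup>+t. f (x, t) \<partial>lborel) \<partial>lborel)"
    using lborel.nn_integral_fst[OF m] by (simp add: lborel_prod)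
  show "(\<integral>\<^sup>+y. f y \<partial>lborel) = (\<integral>\<^sup>+t. (\<integral>\<^sup>+x. f (x, t) \<partial>lborel) \<partial>lborel)"
    using lborel_pair.nn_integral_snd[OF m] by (simp add: lborel_prod)
qed

lemma nn_integral_plane_linear_aux:
  fixes f :: "real \<times> real \<Rightarrow> ennreal" and p q p' q' :: real
  assumes [measurable]: "f \<in> borel_measurable borel" and e: "p * q' - p' * q \<noteq> 0" and p: "p \<noteq> 0"
  shows "(\<integral>\<^sup>+y. f y \<partial>lborel) =
    ennreal \<bar>p * q' - p' * q\<bar> * (\<integral>\<^sup>+y. f (p * fst y + q * snd y, p' * fst y + q' * snd y) \<partial>lborel)"
proof -
  define e where "e = p * q' - p' * q"
  have e0: "e / p \<noteq> 0" using e p by (simp add: e_def)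
  have "(\<integral>\<^sup>+y. f y \<partial>lborel) = (\<integral>\<^sup>+u. (\<integral>\<^sup>+w. f (u, w) \<partial>lborel) \<partial>lborel)"
    by (rule nn_integral_lborel_plane) simp
  also have "\<dots> = (\<integral>\<^sup>+u. ennreal \<bar>e/p\<bar> * (\<integral>\<^sup>+t. f (u, p' * u / p + (e/p) * t) \<partial>lborel) \<partial>lborel)"
    by (intro nn_integral_cong nn_integral_real_affine[OF _ e0]) simp
  also have "\<dots> = ennreal \<bar>e/p\<bar> * (\<integral>\<^sup>+u. (\<integral>\<^sup>+t. f (u, p' * u / p + (e/p) * t) \<partial>lborel) \<partial>lborel)"
    by (rule nn_integral_cmult) simp
  also have "(\<integral>\<^sup>+u. (\<integral>\<^sup>+t. f (u, p' * u / p + (e/p) * t) \<partial>lborel) \<partial>lborel) =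
      (\<integral>\<^sup>+t. (\<integral>\<^sup>+u. f (u, p' * u / p + (e/p) * t) \<partial>lborel) \<partial>lborel)"
  proof -
    have "(\<lambda>z. f (fst z, p' * fst z / p + (e/p) * snd z)) \<in> borel_measurable borel"
      by (rule measurable_compose[OF borel_measurable_continuous_onI assms(1)]) (use p in \<open>intro continuous_intros; simp\<close>)
    from nn_integral_lborel_plane[OF this] show ?thesis by simp
  qed
  also have "\<dots> = (\<integral>\<^sup>+t. ennreal \<bar>p\<bar> * (\<integral>\<^sup>+x. f (q * t + p * x, p' * (q * t + p * x) / p + (e/p) * t) \<partial>lborel) \<partial>lborel)"
    by (intro nn_integral_cong nn_integral_real_affine[OF _ p]) simp
  also have "\<dots> = ennreal \<bar>p\<bar> * (\<integral>\<^sup>+t. (\<integral>\<^sup>+x. f (q * t + p * x, p' * (q * t + p * x) / p + (e/p) * t) \<partial>lborel) \<partial>lborel)"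
    by (rule nn_integral_cmult) simp
  also have "\<And>x t. p' * (q * t + p * x) / p + (e/p) * t = p' * x + q' * t"
    using p by (simp add: e_def field_simps)
  then have "(\<integral>\<^sup>+t. (\<integral>\<^sup>+x. f (q * t + p * x, p' * (q * t + p * x) / p + (e/p) * t) \<partial>lborel) \<partial>lborel) =
    (\<integral>\<^sup>+t. (\<integral>\<^sup>+x. f (p * x + q * t, p' * x + q' * t) \<partial>lborel) \<partial>lborel)"
    by (simp add: add.commute)
  also have "\<dots> = (\<integral>\<^sup>+y. f (p * fst y + q * snd y, p' * fst y + q' * snd y) \<partial>lborel)"
  proof -
    have "(\<lambda>y. f (p * fst y + q * snd y, p' * fst y + q' * snd y)) \<in> borel_measurable borel"
      by (rule measurable_compose[OF borel_measurable_continuous_onI assms(1)]) (intro continuous_intros)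
    from nn_integral_lborel_plane(2)[OF this] show ?thesis by simp
  qed
  finally have "(\<integral>\<^sup>+y. f y \<partial>lborel) = ennreal \<bar>e/p\<bar> * (ennreal \<bar>p\<bar> * (\<integral>\<^sup>+y. f (p * fst y + q * snd y, p' * fst y + q' * snd y) \<partial>lborel))" .
  also have "\<dots> = ennreal (\<bar>e/p\<bar> * \<bar>p\<bar>) * (\<integral>\<^sup>+y. f (p * fst y + q * snd y, p' * fst y + q' * snd y) \<partial>lborel)"
    by (simp only: ennreal_mult[OF abs_ge_zero abs_ge_zero] mult.assoc)
  also have "\<bar>e/p\<bar> * \<bar>p\<bar> = \<bar>e\<bar>" using p by simp
  finally show ?thesis unfolding e_def .
qed

lemma nn_integral_plane_linear:
  fixes f :: "real \<times> real \<Rightarrow> ennreal" and p q p' q' :: real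
  assumes [measurable]: "f \<in> borel_measurable borel" and e: "p * q' - p' * q \<noteq> 0"
  shows "(\<integral>\<^sup>+y. f y \<partial>lborel) =
    ennreal \<bar>p * q' - p' * q\<bar> * (\<integral>\<^sup>+y. f (p * fst y + q * snd y, p' * fst y + q' * snd y) \<partial>lborel)"
proof (cases "p = 0")
  case False
  then show ?thesis using nn_integral_plane_linear_aux[OF assms] by simp
next
  case True
  \<comment> \<open>Then the second row has a nonzero first entry; swap the two target coordinates.\<close>
  have p': "p' \<noteq> 0" using e True by auto
  have e': "p' * q - p * q' \<noteq> 0" using e by simp
  have m: "(\<lambda>y. f (snd y, fst y)) \<in> borel_measurable borel"
    by (rule measurable_compose[OF borel_measurable_continuous_onI assms(1)]) (intro continuous_intros)
  have "(\<integral>\<^sup>+y. f y \<partial>lborel) = (\<integral>\<^sup>+y. f (snd y, fst y) \<partial>lborel)"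
    using nn_integral_lborel_plane(1)[of f] nn_integral_lborel_plane(2)[OF m] by simp
  also have "\<dots> = ennreal \<bar>p' * q - p * q'\<bar> * (\<integral>\<^sup>+y. f (p * fst y + q * snd y, p' * fst y + q' * snd y) \<partial>lborel)"
    using nn_integral_plane_linear_aux[OF m e' p'] by simp
  finally show ?thesis by (simp add: abs_minus_commute)
qed

lemma nn_integral_lborel_translate:
  fixes f :: "'a::euclidean_space \<Rightarrow> ennreal"
  assumes [measurable]: "f \<in> borel_measurable borel"
  shows "(\<integral>\<^sup>+y. f (c + y) \<partial>lborel) = (\<integral>\<^sup>+y. f y \<partial>lborel)"
proof -
  have "(\<integral>\<^sup>+y. f y \<partial>lborel) = (\<integral>\<^sup>+y. f y \<partial>distr lborel borel ((+) c))"
    by (simp add: lborel_distr_plus)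
  also have "\<dots> = (\<integral>\<^sup>+y. f (c + y) \<partial>lborel)"
    by (subst nn_integral_distr) auto
  finally show ?thesis by simp
qed

text \<open>Used for the multiplicity \<open>f\<close> both in the plane and on horizontal lines.\<close>

lemma nn_integral_near_one:
  fixes f :: "'a \<Rightarrow> real"
  assumes [measurable]: "f \<in> borel_measurable M" "B \<in> sets M" and f: "\<And>y. f y \<ge> 0"
  shows "(\<integral>\<^sup>+y. ennreal (f y) * indicator B y \<partial>M) \<le> emeasure M B + (\<integral>\<^sup>+y. ennreal \<bar>f y - 1\<bar> * indicator B y \<partial>M)" (is "?f \<le> _ + ?d")
    and "emeasure M B \<le> (\<integral>\<^sup>+y. ennreal (f y) * indicator B y \<partial>M) + (\<integral>\<^sup>+y. ennreal \<bar>f y - 1\<bar> * indicator B y \<partial>M)"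
proof -
  have "?f \<le> (\<integral>\<^sup>+y. indicator B y + ennreal \<bar>f y - 1\<bar> * indicator B y \<partial>M)"
  proof (intro nn_integral_mono)
    fix y
    have "ennreal (f y) \<le> ennreal (1 + \<bar>f y - 1\<bar>)" by (intro ennreal_leI) simp
    also have "\<dots> = 1 + ennreal \<bar>f y - 1\<bar>" by (subst ennreal_plus) auto
    finally show "ennreal (f y) * indicator B y \<le> indicator B y + ennreal \<bar>f y - 1\<bar> * indicator B y"
      by (auto simp: indicator_def)
  qed
  also have "\<dots> = emeasure M B + ?d" by (subst nn_integral_add) auto
  finally show "?f \<le> emeasure M B + ?d" .
  have "emeasure M B = (\<integral>\<^sup>+y. indicator B y \<partial>M)" by simp
  also have "\<dots> \<le> (\<integral>\<^sup>+y. ennreal (f y) * indicator B y + ennreal \<bar>f y - 1\<bar> * indicator B y \<partial>M)"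
  proof (intro nn_integral_mono)
    fix y
    have "ennreal 1 \<le> ennreal (f y + \<bar>f y - 1\<bar>)" by (intro ennreal_leI) simp
    also have "\<dots> = ennreal (f y) + ennreal \<bar>f y - 1\<bar>" by (subst ennreal_plus) (auto simp: f)
    finally show "indicator B y \<le> ennreal (f y) * indicator B y + ennreal \<bar>f y - 1\<bar> * indicator B y"
      by (auto simp: indicator_def)
  qed
  also have "\<dots> = ?f + ?d" by (rule nn_integral_add) measurable
  finally show "emeasure M B \<le> ?f + ?d" .
qed

definition strip :: "real \<Rightarrow> real \<Rightarrow> real \<Rightarrow> real \<Rightarrow> (real \<times> real) set" where
  "strip p q a b = {y. a \<le> p * fst y + q * snd y \<and> p * fst y + q * snd y \<le> b}"

lemma functional_measurable [measurable]:
  "(\<lambda>y::real \<times> real. p * fst y + q * snd y) \<in> borel_measurable borel"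
  by (intro borel_measurable_continuous_onI continuous_intros)

lemma strip_closed: "closed (strip p q a b)"
  unfolding strip_def by (intro closed_Collect_conj closed_Collect_le continuous_intros)

lemma strip_borel [measurable, simp]: "strip p q a b \<in> sets borel"
  using strip_closed by (rule borel_closed)

text \<open>The linear map given by the two functionals multiplies area by the absolute value of its determinant.\<close>

lemma emeasure_parallelogram:
  fixes A B :: "real set"
  assumes [measurable]: "A \<in> sets borel" "B \<in> sets borel" and e: "p * q' - p' * q \<noteq> 0"
  shows "ennreal \<bar>p * q' - p' * q\<bar> *
     emeasure lborel {y. p * fst y + q * snd y \<in> A \<and> p' * fst y + q' * snd y \<in> B}
     = emeasure lborel A * emeasure lborel B"
proof -
  have "emeasure lborel A * emeasure lborel B = (\<integral>\<^sup>+y. indicator (A \<times> B) y \<partial>lborel)"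
    by (simp add: lborel.emeasure_pair_measure_Times lborel_prod[symmetric])
  also have "\<dots> = ennreal \<bar>p * q' - p' * q\<bar> * (\<integral>\<^sup>+y. indicator (A \<times> B) (p * fst y + q * snd y, p' * fst y + q' * snd y) \<partial>lborel)"
    by (rule nn_integral_plane_linear[OF _ e]) (intro borel_measurable_indicator borel_Times assms)
  also have "(\<integral>\<^sup>+y. indicator (A \<times> B) (p * fst y + q * snd y, p' * fst y + q' * snd y) \<partial>lborel)
    = (\<integral>\<^sup>+y. indicator {y. p * fst y + q * snd y \<in> A \<and> p' * fst y + q' * snd y \<in> B} y \<partial>lborel)"
    by (intro nn_integral_cong) (auto simp: indicator_def)
  also have "\<dots> = emeasure lborel {y. p * fst y + q * snd y \<in> A \<and> p' * fst y + q' * snd y \<in> B}"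
  proof (rule nn_integral_indicator)
    show "{y. p * fst y + q * snd y \<in> A \<and> p' * fst y + q' * snd y \<in> B} \<in> sets lborel"
      by measurable
  qed
  finally show ?thesis by simp
qed

lemma emeasure_UN_le_countable:
  assumes [measurable]: "\<And>i. i \<in> C \<Longrightarrow> X i \<in> sets M" and C: "countable C"
  shows "emeasure M (\<Union>i\<in>C. X i) \<le> (\<integral>\<^sup>+i. emeasure M (X i) \<partial>count_space C)"
proof -
  have [measurable]: "(\<Union>i\<in>C. X i) \<in> sets M" using C assms by auto
  have "emeasure M (\<Union>i\<in>C. X i) = (\<integral>\<^sup>+x. indicator (\<Union>i\<in>C. X i) x \<partial>M)" by simp
  also have "\<dots> \<le> (\<integral>\<^sup>+x. (\<integral>\<^sup>+i. indicator (X i) x \<partial>count_space C) \<partial>M)"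
  proof (rule nn_integral_mono)
    fix x
    show "indicator (\<Union>i\<in>C. X i) x \<le> (\<integral>\<^sup>+i. indicator (X i) x \<partial>count_space C)"
    proof (cases "x \<in> (\<Union>i\<in>C. X i)")
      case True
      then obtain j where j: "j \<in> C" "x \<in> X j" by auto
      have "(1::ennreal) = (\<integral>\<^sup>+i. indicator {j} i \<partial>count_space C)"
        using j by (simp add: nn_integral_indicator)
      also have "\<dots> \<le> (\<integral>\<^sup>+i. indicator (X i) x \<partial>count_space C)"
        using j by (intro nn_integral_mono) (auto simp: indicator_def)
      finally show ?thesis using True by simp
    qed simp
  qed
  also have "\<dots> = (\<integral>\<^sup>+i. (\<integral>\<^sup>+x. indicator (X i) x \<partial>M) \<partial>count_space C)"
    using C by (intro nn_integral_count_space_nn_integral) auto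
  also have "\<dots> = (\<integral>\<^sup>+i. emeasure M (X i) \<partial>count_space C)"
    by (intro nn_integral_cong) simp
  finally show ?thesis .
qed

text \<open>The counting principle behind both Vitali arguments below: the dilated sets \<open>E i\<close> cover \<open>G\<close>, and each is charged to its own \<open>T i\<close>.\<close>

lemma emeasure_le_by_disjoint:
  fixes c :: ennreal
  assumes C: "countable C"
    and E: "\<And>i. i \<in> C \<Longrightarrow> E i \<in> sets M" and T: "\<And>i. i \<in> C \<Longrightarrow> T i \<in> sets N"
    and U: "U \<in> sets N" "\<And>i. i \<in> C \<Longrightarrow> T i \<subseteq> U"
    and disj: "disjoint_family_on T C"
    and G: "G \<subseteq> (\<Union>i\<in>C. E i)"
    and le: "\<And>i. i \<in> C \<Longrightarrow> emeasure M (E i) \<le> c * emeasure N (T i)"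
  shows "emeasure M G \<le> c * emeasure N U"
proof -
  have "emeasure M G \<le> emeasure M (\<Union>i\<in>C. E i)"
    using G C E by (intro emeasure_mono) auto
  also have "\<dots> \<le> (\<integral>\<^sup>+i. emeasure M (E i) \<partial>count_space C)"
    by (rule emeasure_UN_le_countable) (use E C in auto)
  also have "\<dots> \<le> (\<integral>\<^sup>+i. c * emeasure N (T i) \<partial>count_space C)"
    using le by (intro nn_integral_mono) simp
  also have "\<dots> = c * (\<integral>\<^sup>+i. emeasure N (T i) \<partial>count_space C)"
    by (rule nn_integral_cmult) simp
  also have "(\<integral>\<^sup>+i. emeasure N (T i) \<partial>count_space C) = emeasure N (\<Union>i\<in>C. T i)"
    by (rule emeasure_UN_countable[symmetric]) (use T C disj in auto)
  also have "c * \<dots> \<le> c * emeasure N U"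
    using U T C by (intro mult_left_mono emeasure_mono) auto
  finally show ?thesis .
qed

section \<open>Families of strips: multiplicity, deviation and crossing\<close>

lemma measure_cball_plane: "r \<ge> 0 \<Longrightarrow> measure lborel (cball (c::real\<times>real) r) = pi * r\<^sup>2"
  by (simp add: content_cball unit_ball_vol_2 mult.commute power2_eq_square)

lemma emeasure_cball_plane: "emeasure lborel (cball (c::real\<times>real) r) = ennreal (if r \<ge> 0 then pi * r\<^sup>2 else 0)"
  by (cases "r \<ge> 0") (simp_all add: emeasure_cball unit_ball_vol_2 mult.commute power2_eq_square)

lemma unit_functional_le_norm:
  assumes "(p::real)\<^sup>2 + q\<^sup>2 = 1" shows "\<bar>p * x + q * y\<bar> \<le> norm (x, y)"
proof -
  have "(p * x + q * y)\<^sup>2 + (p * y - q * x)\<^sup>2 = (p\<^sup>2 + q\<^sup>2) * (x\<^sup>2 + y\<^sup>2)"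
    by (simp add: power2_eq_square algebra_simps)
  then have "(p * x + q * y)\<^sup>2 \<le> x\<^sup>2 + y\<^sup>2"
    using assms zero_le_power2[of "p * y - q * x"] by (metis le_add_same_cancel1 mult_1)
  then have "sqrt ((p * x + q * y)\<^sup>2) \<le> sqrt (x\<^sup>2 + y\<^sup>2)"
    by (rule real_sqrt_le_mono)
  then show ?thesis by (simp add: norm_Pair)
qed

text \<open>All estimates for such a family have to be independent of the number of strips.\<close>

locale strips =
  fixes I :: "nat set" and p q a b :: "nat \<Rightarrow> real"
  assumes fin: "finite I" and unit: "\<And>i. i \<in> I \<Longrightarrow> (p i)\<^sup>2 + (q i)\<^sup>2 = 1"
begin

definition P :: "nat \<Rightarrow> (real \<times> real) set" where "P i = strip (p i) (q i) (a i) (b i)"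

definition m :: "real \<times> real \<Rightarrow> real" where "m y = (\<Sum>i\<in>I. indicator (P i) y)"

text \<open>The squared sine of the angle between the strips \<open>i\<close> and \<open>j\<close>.\<close>

definition sinsq :: "nat \<Rightarrow> nat \<Rightarrow> real" where "sinsq i j = (p i * q j - p j * q i)\<^sup>2"

definition crossing_weight :: "real \<times> real \<Rightarrow> real" where
  "crossing_weight y = (\<Sum>i\<in>I. \<Sum>j\<in>I. sinsq i j * indicator (P i \<inter> P j) y)"

definition deviation :: "(real \<times> real) measure" where "deviation = density lborel (\<lambda>y. ennreal \<bar>m y - 1\<bar>)"

definition crossing :: "(real \<times> real) measure" where "crossing = density lborel (\<lambda>y. ennreal (crossing_weight y))"

lemma P_borel [measurable, simp]: "P i \<in> sets borel" by (simp add: P_def)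

lemma m_measurable [measurable]: "m \<in> borel_measurable borel"
  unfolding m_def[abs_def] by measurable

lemma crossing_weight_measurable [measurable]: "crossing_weight \<in> borel_measurable borel"
  unfolding crossing_weight_def[abs_def] by measurable

lemma sets_deviation [simp]: "sets deviation = sets borel" by (simp add: deviation_def)
lemma sets_crossing [simp]: "sets crossing = sets borel" by (simp add: crossing_def)

lemma emeasure_deviation: "B \<in> sets borel \<Longrightarrow> emeasure deviation B = (\<integral>\<^sup>+y. ennreal \<bar>m y - 1\<bar> * indicator B y \<partial>lborel)"
  unfolding deviation_def by (subst emeasure_density) auto

lemma emeasure_crossing: "B \<in> sets borel \<Longrightarrow> emeasure crossing B = (\<integral>\<^sup>+y. ennreal (crossing_weight y) * indicator B y \<partial>lborel)"
  unfolding crossing_def by (subst emeasure_density) auto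

lemma m_nonneg: "m y \<ge> 0" unfolding m_def by (intro sum_nonneg) auto

lemma sinsq_nonneg: "sinsq i j \<ge> 0" by (simp add: sinsq_def)

lemma det_le_1:
  assumes "i \<in> I" "j \<in> I" shows "\<bar>p i * q j - p j * q i\<bar> \<le> 1"
proof -
  have "\<bar>p i * q j + q i * (- p j)\<bar> \<le> norm (q j, - p j)"
    using unit_functional_le_norm[OF unit[OF assms(1)]] .
  also have "\<dots> = 1" using unit[OF assms(2)] by (simp add: norm_Pair add.commute)
  finally show ?thesis by (simp add: algebra_simps)
qed

lemma sinsq_le_det: "i \<in> I \<Longrightarrow> j \<in> I \<Longrightarrow> sinsq i j \<le> \<bar>p i * q j - p j * q i\<bar>"
  using det_le_1[of i j] unfolding sinsq_def
  by (metis abs_ge_zero mult_left_le power2_abs power2_eq_square)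

lemma sinsq_le_1: "i \<in> I \<Longrightarrow> j \<in> I \<Longrightarrow> sinsq i j \<le> 1"
  using sinsq_le_det det_le_1 by (meson order_trans)

text \<open>Parallel strips, in particular \<open>i = j\<close>, have weight 0, so at most \<open>m y * (m y - 1)\<close> ordered
pairs of strips through \<open>y\<close> contribute.  The factor \<open>m y - 1\<close> is what makes the crossing vanish
where the strips tile.\<close>

lemma crossing_weight_le: "crossing_weight y \<le> m y * (m y - 1)"
proof -
  let ?f = "\<lambda>i. indicator (P i) y :: real"
  have "crossing_weight y \<le> (\<Sum>i\<in>I. \<Sum>j\<in>I. (if i = j then 0 else ?f i * ?f j))"
    unfolding crossing_weight_def
  proof (intro sum_mono)
    fix i j assume ij: "i \<in> I" "j \<in> I"
    show "sinsq i j * indicator (P i \<inter> P j) y \<le> (if i = j then 0 else ?f i * ?f j)"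
      using sinsq_le_1[OF ij] by (auto simp: sinsq_def indicator_def)
  qed
  also have "\<dots> = (\<Sum>i\<in>I. (\<Sum>j\<in>I. ?f i * ?f j) - ?f i)"
  proof (rule sum.cong[OF refl])
    fix i assume i: "i \<in> I"
    have "(\<Sum>j\<in>I. (if i = j then 0 else ?f i * ?f j)) = (\<Sum>j\<in>I. ?f i * ?f j - (if j = i then ?f i else 0))"
      by (rule sum.cong) (auto simp: indicator_def)
    also have "\<dots> = (\<Sum>j\<in>I. ?f i * ?f j) - ?f i"
      using i fin by (simp add: sum_subtractf)
    finally show "(\<Sum>j\<in>I. (if i = j then 0 else ?f i * ?f j)) = (\<Sum>j\<in>I. ?f i * ?f j) - ?f i" .
  qed
  also have "\<dots> = m y * (m y - 1)"
    by (simp add: m_def sum_subtractf sum_product right_diff_distrib)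
  finally show ?thesis .
qed

definition ball_mass :: "real \<times> real \<Rightarrow> real \<Rightarrow> real" where
  "ball_mass c r = (\<Sum>i\<in>I. measure lborel (P i \<inter> cball c r))"

lemma emeasure_P_Int:
  assumes "bounded B" "B \<in> sets borel"
  shows "emeasure lborel (P i \<inter> B) = ennreal (measure lborel (P i \<inter> B))"
proof (rule emeasure_eq_ennreal_measure)
  have "emeasure lborel (P i \<inter> B) \<le> emeasure lborel B"
    using assms by (intro emeasure_mono) auto
  also have "\<dots> < \<infinity>" by (rule emeasure_bounded_finite[OF assms(1)])
  finally show "emeasure lborel (P i \<inter> B) \<noteq> top" by simp
qed

lemma nn_integral_m:
  assumes "B \<in> sets borel"
  shows "(\<integral>\<^sup>+y. ennreal (m y) * indicator B y \<partial>lborel) = (\<Sum>i\<in>I. emeasure lborel (P i \<inter> B))"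
proof -
  have "(\<integral>\<^sup>+y. ennreal (m y) * indicator B y \<partial>lborel) = (\<integral>\<^sup>+y. (\<Sum>i\<in>I. indicator (P i \<inter> B) y) \<partial>lborel)"
  proof (intro nn_integral_cong)
    fix y
    have "ennreal (m y) = (\<Sum>i\<in>I. ennreal (indicator (P i) y))"
      unfolding m_def by (rule sum_ennreal[symmetric]) auto
    then show "ennreal (m y) * indicator B y = (\<Sum>i\<in>I. indicator (P i \<inter> B) y)"
      by (simp add: sum_distrib_right indicator_inter_arith ennreal_indicator)
  qed
  also have "\<dots> = (\<Sum>i\<in>I. emeasure lborel (P i \<inter> B))"
    using assms by (subst nn_integral_sum) auto
  finally show ?thesis .
qed

lemma mass_near_area:
  assumes B: "bounded B" "B \<in> sets borel"
  shows "ennreal (\<Sum>i\<in>I. measure lborel (P i \<inter> B)) \<le> emeasure lborel B + emeasure deviation B"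
    and "emeasure lborel B \<le> ennreal (\<Sum>i\<in>I. measure lborel (P i \<inter> B)) + emeasure deviation B"
proof -
  have eq: "ennreal (\<Sum>i\<in>I. measure lborel (P i \<inter> B)) = (\<integral>\<^sup>+y. ennreal (m y) * indicator B y \<partial>lborel)"
    using nn_integral_m B by (simp add: emeasure_P_Int sum_ennreal)
  show "ennreal (\<Sum>i\<in>I. measure lborel (P i \<inter> B)) \<le> emeasure lborel B + emeasure deviation B"
    and "emeasure lborel B \<le> ennreal (\<Sum>i\<in>I. measure lborel (P i \<inter> B)) + emeasure deviation B"
    unfolding eq emeasure_deviation[OF B(2)] by (rule nn_integral_near_one; use B m_nonneg in simp)+
qed

lemma crossing_eq_sum:
  assumes B: "bounded B" "B \<in> sets borel"
  shows "emeasure crossing B = ennreal (\<Sum>i\<in>I. \<Sum>j\<in>I. sinsq i j * measure lborel (P i \<inter> P j \<inter> B))"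
proof -
  have fm: "emeasure lborel (P i \<inter> P j \<inter> B) = ennreal (measure lborel (P i \<inter> P j \<inter> B))" for i j
    using emeasure_P_Int[of "P j \<inter> B" i] B by (simp add: Int_assoc bounded_Int)
  have "emeasure crossing B = (\<integral>\<^sup>+y. (\<Sum>i\<in>I. \<Sum>j\<in>I. ennreal (sinsq i j) * indicator (P i \<inter> P j \<inter> B) y) \<partial>lborel)"
    unfolding emeasure_crossing[OF B(2)]
  proof (intro nn_integral_cong)
    fix y
    have "ennreal (crossing_weight y) = (\<Sum>i\<in>I. \<Sum>j\<in>I. ennreal (sinsq i j * indicator (P i \<inter> P j) y))"
      unfolding crossing_weight_def by (simp add: sum_nonneg sinsq_nonneg)
    also have "\<dots> = (\<Sum>i\<in>I. \<Sum>j\<in>I. ennreal (sinsq i j) * indicator (P i \<inter> P j) y)"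
      by (intro sum.cong refl) (auto simp: indicator_def)
    finally show "ennreal (crossing_weight y) * indicator B y = (\<Sum>i\<in>I. \<Sum>j\<in>I. ennreal (sinsq i j) * indicator (P i \<inter> P j \<inter> B) y)"
      by (simp add: sum_distrib_right indicator_inter_arith mult.assoc)
  qed
  also have "\<dots> = (\<Sum>i\<in>I. \<Sum>j\<in>I. ennreal (sinsq i j) * emeasure lborel (P i \<inter> P j \<inter> B))"
    using B by (simp add: nn_integral_sum nn_integral_cmult)
  also have "\<dots> = ennreal (\<Sum>i\<in>I. \<Sum>j\<in>I. sinsq i j * measure lborel (P i \<inter> P j \<inter> B))"
    by (simp add: fm ennreal_mult[symmetric] sinsq_nonneg sum_nonneg)
  finally show ?thesis .
qed

text \<open>The width of the part of strip \<open>i\<close> that the ball of radius \<open>5 * r\<close> about \<open>c\<close> can meet.\<close>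

definition shadow :: "nat \<Rightarrow> real \<times> real \<Rightarrow> real \<Rightarrow> real" where
  "shadow i c r = measure lborel ({a i..b i} \<inter> {p i * fst c + q i * snd c - 5 * r .. p i * fst c + q i * snd c + 5 * r})"

lemma shadow_emeasure: "emeasure lborel ({a i..b i} \<inter> {p i * fst c + q i * snd c - 5 * r .. p i * fst c + q i * snd c + 5 * r}) = ennreal (shadow i c r)"
  unfolding shadow_def by (rule emeasure_eq_ennreal_measure) (simp add: emeasure_lborel_Icc_eq)

lemma shadow_nonneg: "shadow i c r \<ge> 0" by (simp add: shadow_def)

lemma functional_bound:
  assumes "i \<in> I" "y \<in> cball c r"
  shows "\<bar>p i * fst y + q i * snd y - (p i * fst c + q i * snd c)\<bar> \<le> r"
proof -
  have "p i * fst y + q i * snd y - (p i * fst c + q i * snd c) = p i * fst (y - c) + q i * snd (y - c)"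
    by (simp add: algebra_simps)
  then have "\<bar>p i * fst y + q i * snd y - (p i * fst c + q i * snd c)\<bar> \<le> norm (fst (y - c), snd (y - c))"
    using unit_functional_le_norm[OF unit[OF assms(1)], of "fst (y - c)" "snd (y - c)"] by simp
  also have "\<dots> \<le> r" using assms(2) by (simp add: dist_norm norm_minus_commute flip: fst_diff snd_diff)
  finally show ?thesis .
qed

text \<open>Two strips of widths \<open>d\<close> and \<open>d'\<close> meet in a parallelogram of area \<open>d * d'\<close> divided by the sine of
their angle, so the weight, the squared sine, more than makes up for small angles.\<close>

lemma pair_le_shadow:
  assumes ij: "i \<in> I" "j \<in> I"
  shows "sinsq i j * measure lborel (P i \<inter> P j \<inter> cball c (5 * r)) \<le> shadow i c r * shadow j c r"
proof (cases "p i * q j - p j * q i = 0")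
  case True
  then show ?thesis by (simp add: sinsq_def shadow_nonneg)
next
  case False
  let ?J = "\<lambda>i. {a i..b i} \<inter> {p i * fst c + q i * snd c - 5 * r .. p i * fst c + q i * snd c + 5 * r}"
  let ?S = "{y. p i * fst y + q i * snd y \<in> ?J i \<and> p j * fst y + q j * snd y \<in> ?J j}"
  let ?d = "\<bar>p i * q j - p j * q i\<bar>"
  have S: "?S \<in> sets borel" by measurable
  have sub: "P i \<inter> P j \<inter> cball c (5 * r) \<subseteq> ?S"
  proof
    fix y assume y: "y \<in> P i \<inter> P j \<inter> cball c (5 * r)"
    then have "y \<in> cball c (5 * r)" by simp
    from functional_bound[OF ij(1) this] functional_bound[OF ij(2) this] y
    show "y \<in> ?S" by (simp add: P_def strip_def abs_le_iff algebra_simps)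
  qed
  have "ennreal (sinsq i j * measure lborel (P i \<inter> P j \<inter> cball c (5 * r)))
      = ennreal (sinsq i j) * emeasure lborel (P i \<inter> P j \<inter> cball c (5 * r))"
    using emeasure_P_Int[of "P j \<inter> cball c (5 * r)" i]
    by (simp add: ennreal_mult sinsq_nonneg Int_assoc bounded_Int)
  also have "\<dots> \<le> ennreal ?d * emeasure lborel ?S"
    using S sub by (intro mult_mono ennreal_leI sinsq_le_det ij emeasure_mono) auto
  also have "\<dots> = emeasure lborel (?J i) * emeasure lborel (?J j)"
    by (rule emeasure_parallelogram[OF _ _ False]) auto
  also have "\<dots> = ennreal (shadow i c r * shadow j c r)"
    by (simp only: shadow_emeasure ennreal_mult[OF shadow_nonneg shadow_nonneg])
  finally show ?thesis by (simp add: shadow_nonneg)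
qed

text \<open>In the ball of twice the radius the strip contains a rectangle of this width and of length \<open>10 * r\<close>.\<close>

lemma shadow_le_area:
  assumes i: "i \<in> I" and r: "r > 0"
  shows "r * shadow i c r \<le> measure lborel (P i \<inter> cball c (10 * r))"
proof -
  let ?J = "{a i..b i} \<inter> {p i * fst c + q i * snd c - 5 * r .. p i * fst c + q i * snd c + 5 * r}"
  let ?K = "{p i * snd c - q i * fst c - 5 * r .. p i * snd c - q i * fst c + 5 * r}"
  let ?S = "{y. p i * fst y + q i * snd y \<in> ?J \<and> (- q i) * fst y + p i * snd y \<in> ?K}"
  have det: "p i * p i - (- q i) * q i = 1" using unit[OF i] by (simp add: power2_eq_square)
  have sub: "?S \<subseteq> P i \<inter> cball c (10 * r)"
  proof
    fix y assume y: "y \<in> ?S"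
    obtain u v where uv: "y - c = (u, v)" by (cases "y - c")
    then have fs: "fst y = fst c + u" "snd y = snd c + v" by (auto simp: prod_eq_iff)
    have 1: "\<bar>p i * u + q i * v\<bar> \<le> 5 * r" and 2: "\<bar>p i * v - q i * u\<bar> \<le> 5 * r"
      using y by (auto simp: fs algebra_simps)
    have "u\<^sup>2 + v\<^sup>2 = (p i * u + q i * v)\<^sup>2 + (p i * v - q i * u)\<^sup>2"
    proof -
      have "(p i * u + q i * v)\<^sup>2 + (p i * v - q i * u)\<^sup>2 = ((p i)\<^sup>2 + (q i)\<^sup>2) * (u\<^sup>2 + v\<^sup>2)"
        by (simp add: power2_eq_square algebra_simps)
      then show ?thesis using unit[OF i] by simp
    qed
    also have "\<dots> \<le> (5 * r)\<^sup>2 + (5 * r)\<^sup>2"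
      using power_mono[OF 1, of 2] power_mono[OF 2, of 2] by (intro add_mono) auto
    also have "\<dots> \<le> (10 * r)\<^sup>2" by (simp add: power_mult_distrib)
    finally have "norm (y - c) \<le> 10 * r"
      using r unfolding uv norm_Pair by (intro real_le_lsqrt) auto
    then have "y \<in> cball c (10 * r)" by (simp add: dist_norm norm_minus_commute)
    moreover have "y \<in> P i" using y by (auto simp: P_def strip_def)
    ultimately show "y \<in> P i \<inter> cball c (10 * r)" by simp
  qed
  have "emeasure lborel ?J * emeasure lborel ?K = ennreal \<bar>p i * p i - (- q i) * q i\<bar> * emeasure lborel ?S"
    by (rule emeasure_parallelogram[symmetric]) (use det in auto)
  also have "\<dots> \<le> emeasure lborel (P i \<inter> cball c (10 * r))"
    using emeasure_mono[OF sub, of lborel] by (simp only: det) simp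
  also have "\<dots> = ennreal (measure lborel (P i \<inter> cball c (10 * r)))" by (rule emeasure_P_Int) auto
  also have "emeasure lborel ?J * emeasure lborel ?K = ennreal (shadow i c r * (10 * r))"
    using r by (simp only: shadow_emeasure) (simp add: ennreal_mult shadow_nonneg)
  finally have "shadow i c r * (10 * r) \<le> measure lborel (P i \<inter> cball c (10 * r))" by simp
  moreover have "0 \<le> r * shadow i c r" using shadow_nonneg[of i c r] r by simp
  ultimately show ?thesis by (simp add: mult.commute mult.left_commute)
qed

text \<open>Summing over all pairs, the product bound of \<open>pair_le_shadow\<close> becomes a square.  Only the total area of the
strips enters, not their number.\<close>

lemma crossing_ball_le:
  assumes r: "r > 0"
  shows "emeasure crossing (cball c (5 * r)) \<le> ennreal ((ball_mass c (10 * r) / r)\<^sup>2)"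
proof -
  have "(\<Sum>i\<in>I. \<Sum>j\<in>I. sinsq i j * measure lborel (P i \<inter> P j \<inter> cball c (5 * r))) \<le> (\<Sum>i\<in>I. \<Sum>j\<in>I. shadow i c r * shadow j c r)"
    by (intro sum_mono pair_le_shadow)
  also have "\<dots> = (\<Sum>i\<in>I. shadow i c r)\<^sup>2" by (simp add: power2_eq_square sum_product)
  also have "\<dots> \<le> (ball_mass c (10 * r) / r)\<^sup>2"
  proof (rule power_mono)
    have "(\<Sum>i\<in>I. shadow i c r) \<le> (\<Sum>i\<in>I. measure lborel (P i \<inter> cball c (10 * r)) / r)"
      using shadow_le_area[OF _ r] r by (intro sum_mono) (simp add: field_simps)
    then show "(\<Sum>i\<in>I. shadow i c r) \<le> ball_mass c (10 * r) / r" by (simp add: ball_mass_def sum_divide_distrib)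
  qed (auto intro: sum_nonneg shadow_nonneg)
  finally show ?thesis by (simp add: crossing_eq_sum ennreal_leI)
qed

section \<open>Deviation controls crossing\<close>


lemma area_upper:
  assumes "cball c r \<subseteq> cball 0 1" "r \<ge> 0" "emeasure deviation (cball 0 1) \<le> ennreal d" "d \<ge> 0"
  shows "ball_mass c r \<le> pi * r\<^sup>2 + d"
proof -
  have "ennreal (ball_mass c r) \<le> emeasure lborel (cball c r) + emeasure deviation (cball c r)"
    unfolding ball_mass_def by (rule mass_near_area) auto
  also have "\<dots> \<le> ennreal (pi * r\<^sup>2) + ennreal d"
    using assms by (intro add_mono order_trans[OF emeasure_mono assms(3)]) (auto simp: emeasure_cball_plane)
  also have "\<dots> = ennreal (pi * r\<^sup>2 + d)" using assms by (subst ennreal_plus) auto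
  finally show ?thesis using assms by (subst (asm) ennreal_le_iff) auto
qed

text \<open>A ball with mean multiplicity at least 2 carries a deviation of at least its own area.\<close>

lemma dense_ball_charge:
  assumes "2 * (pi * r\<^sup>2) \<le> ball_mass c r" "r \<ge> 0"
  shows "ennreal (pi * r\<^sup>2) \<le> emeasure deviation (cball c r)"
proof -
  have "ennreal (pi * r\<^sup>2) + ennreal (pi * r\<^sup>2) = ennreal (2 * (pi * r\<^sup>2))"
    by (subst ennreal_plus[symmetric]) auto
  also have "\<dots> \<le> ennreal (ball_mass c r)" using assms by (intro ennreal_leI)
  also have "\<dots> \<le> emeasure lborel (cball c r) + emeasure deviation (cball c r)"
    unfolding ball_mass_def by (rule mass_near_area) auto
  also have "emeasure lborel (cball c r) = ennreal (pi * r\<^sup>2)" using assms by (simp add: emeasure_cball_plane)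
  finally show ?thesis by (simp add: ennreal_add_left_cancel_le)
qed

definition boundary :: "(real \<times> real) set" where
  "boundary = (\<Union>i\<in>I. {y. p i * fst y + q i * snd y = a i} \<union> {y. p i * fst y + q i * snd y = b i})"

lemma line_null: 
  assumes "i \<in> I" shows "emeasure lborel {y. p i * fst y + q i * snd y = e} = 0"
proof -
  let ?S = "{y. p i * fst y + q i * snd y \<in> {e} \<and> (- q i) * fst y + p i * snd y \<in> UNIV}"
  have det: "p i * p i - (- q i) * q i = 1" using unit[OF assms] by (simp add: power2_eq_square)
  have "ennreal \<bar>p i * p i - (- q i) * q i\<bar> * emeasure lborel ?S = emeasure lborel {e} * emeasure lborel (UNIV :: real set)"
    by (rule emeasure_parallelogram) (use det in auto)
  then show ?thesis by (simp only: det) simp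
qed

lemma line_borel [measurable, simp]: "{y::real \<times> real. u * fst y + v * snd y = e} \<in> sets borel"
proof (rule borel_closed)
  show "closed {y::real \<times> real. u * fst y + v * snd y = e}"
    by (intro closed_Collect_eq continuous_intros)
qed

lemma boundary_borel [measurable, simp]: "boundary \<in> sets borel"
  unfolding boundary_def using fin by (intro sets.finite_UN) auto

lemma boundary_null: "emeasure lborel boundary = 0"
proof -
  have "boundary \<in> null_sets lborel"
    unfolding boundary_def using fin line_null by (intro null_sets.finite_UN null_sets.Un) (auto simp: null_sets_def)
  then show ?thesis by auto
qed

lemma crossing_boundary: "emeasure crossing boundary = 0"
proof -
  have "boundary \<in> null_sets lborel" using boundary_null by (simp add: null_sets_def)
  then have "AE y in lborel. y \<notin> boundary" by (rule AE_not_in)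
  then have "emeasure crossing boundary = (\<integral>\<^sup>+y. 0 \<partial>(lborel :: (real\<times>real) measure))"
    unfolding emeasure_crossing[OF boundary_borel]
    by (intro nn_integral_cong_AE) (auto elim!: eventually_mono simp: indicator_def)
  then show ?thesis by simp
qed

text \<open>Off the boundary lines, \<open>y\<close> is interior to every strip that contains it.\<close>

lemma dense_small_ball:
  assumes y: "y \<notin> boundary" and m2: "m y \<ge> 2" and \<epsilon>: "\<epsilon> > 0"
  shows "\<exists>r. 0 < r \<and> r < \<epsilon> \<and> 2 * (pi * r\<^sup>2) \<le> ball_mass y r"
proof -
  have "\<forall>i\<in>I. \<exists>d>0. y \<in> P i \<longrightarrow> cball y d \<subseteq> P i"
  proof
    fix i assume i: "i \<in> I"
    show "\<exists>d>0. y \<in> P i \<longrightarrow> cball y d \<subseteq> P i"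
    proof (cases "y \<in> P i")
      case True
      let ?O = "{y. a i < p i * fst y + q i * snd y} \<inter> {y. p i * fst y + q i * snd y < b i}"
      have "open ?O" by (intro open_Int open_Collect_less continuous_intros)
      moreover have "y \<in> ?O" using True y i by (auto simp: P_def strip_def boundary_def less_le)
      ultimately obtain d where "d > 0" "cball y d \<subseteq> ?O" by (meson open_contains_cball)
      moreover have "?O \<subseteq> P i" by (auto simp: P_def strip_def)
      ultimately show ?thesis by blast
    qed (auto intro: exI[of _ 1])
  qed
  then obtain d where d: "\<And>i. i \<in> I \<Longrightarrow> d i > 0" "\<And>i. i \<in> I \<Longrightarrow> y \<in> P i \<Longrightarrow> cball y (d i) \<subseteq> P i"
    by metis
  define r where "r = Min (insert (\<epsilon>/2) (d ` I))"
  have r: "r > 0" "r < \<epsilon>" "\<And>i. i \<in> I \<Longrightarrow> r \<le> d i"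
  proof -
    show "r > 0" using fin d(1) \<epsilon> by (auto simp: r_def)
    have "r \<le> \<epsilon> / 2" unfolding r_def using fin by (intro Min_le) auto
    then show "r < \<epsilon>" using \<epsilon> by simp
    show "r \<le> d i" if "i \<in> I" for i unfolding r_def using fin that by (intro Min_le) auto
  qed
  have "2 * (pi * r\<^sup>2) \<le> m y * (pi * r\<^sup>2)" using m2 by (intro mult_right_mono) auto
  also have "\<dots> = (\<Sum>i\<in>I. indicator (P i) y * (pi * r\<^sup>2))" by (simp add: m_def sum_distrib_right)
  also have "\<dots> \<le> ball_mass y r"
    unfolding ball_mass_def
  proof (rule sum_mono)
    fix i assume i: "i \<in> I"
    show "indicator (P i) y * (pi * r\<^sup>2) \<le> measure lborel (P i \<inter> cball y r)"
    proof (cases "y \<in> P i")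
      case True
      have "cball y r \<subseteq> P i" using d(2)[OF i True] r(3)[OF i] by (meson dual_order.trans subset_cball)
      then have "P i \<inter> cball y r = cball y r" by auto
      then show ?thesis using r True by (simp add: measure_cball_plane)
    qed simp
  qed
  finally show ?thesis using r by blast
qed

text \<open>The largest radius, up to a factor 2, at which the mean multiplicity around \<open>y\<close> is still 2.  At ten
times this radius the mean is at most 2: either by maximality, or, for radii that are not small,
because the total deviation is small.\<close>

lemma critical_radius:
  assumes y: "y \<in> cball 0 (1/4)" "y \<notin> boundary" "m y \<ge> 2"
    and deviation: "emeasure deviation (cball 0 1) \<le> ennreal (pi / 2500)"
  shows "\<exists>r. 0 < r \<and> r \<le> 1/50 \<and> 2 * (pi * r\<^sup>2) \<le> ball_mass y r \<and> ball_mass y (10 * r) \<le> 2 * (pi * (10 * r)\<^sup>2)"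
proof -
  let ?S = "{r. 0 < r \<and> r < 1/50 \<and> 2 * (pi * r\<^sup>2) \<le> ball_mass y r}"
  have ne: "?S \<noteq> {}" using dense_small_ball[OF y(2,3), of "1/50"] by auto
  have bdd: "bdd_above ?S" by (rule bdd_aboveI[of _ "1/50"]) auto
  have Spos: "Sup ?S > 0"
    using ne bdd by (metis (mono_tags, lifting) cSup_upper ex_in_conv less_le_trans mem_Collect_eq)
  have "Sup ?S / 2 < Sup ?S" using Spos by simp
  then obtain r where r: "r \<in> ?S" "Sup ?S / 2 < r"
    using less_cSupE[of "Sup ?S / 2" ?S] ne by blast
  have big: "\<rho> \<notin> ?S" if "\<rho> \<ge> 2 * r" for \<rho>
  proof
    assume "\<rho> \<in> ?S"
    then have "\<rho> \<le> Sup ?S" using bdd by (rule cSup_upper)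
    with that r show False by linarith
  qed
  have "ball_mass y (10 * r) \<le> 2 * (pi * (10 * r)\<^sup>2)"
  proof (cases "10 * r < 1/50")
    case True
    then show ?thesis using big[of "10 * r"] r by auto
  next
    case False
    have "cball y (10 * r) \<subseteq> cball 0 1"
    proof
      fix x assume "x \<in> cball y (10 * r)"
      then have "dist y x \<le> 10 * r" by simp
      moreover have "dist 0 y \<le> 1/4" using y by simp
      ultimately show "x \<in> cball 0 1" using dist_triangle[of 0 x y] r by simp
    qed
    then have "ball_mass y (10 * r) \<le> pi * (10 * r)\<^sup>2 + pi / 2500"
      using r by (intro area_upper deviation) auto
    moreover have "pi / 2500 \<le> pi * (10 * r)\<^sup>2"
    proof -
      have "(1/50)\<^sup>2 \<le> (10 * r)\<^sup>2" using False by (intro power_mono) auto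
      then have "pi * (1/50)\<^sup>2 \<le> pi * (10 * r)\<^sup>2" by (intro mult_left_mono) auto
      then show ?thesis by (simp add: power2_eq_square)
    qed
    ultimately show ?thesis by linarith
  qed
  then show ?thesis using r by (intro exI[of _ r]) auto
qed

text \<open>Where \<open>m \<le> 2\<close>, the crossing density is at most twice the deviation density.  The points with
\<open>m > 2\<close> are covered by balls of five times the critical radius \<open>r\<close>, with disjoint balls of
radius \<open>r\<close>.  In the larger ball the crossing is \<open>O(r\<^sup>2)\<close>, because the mean multiplicity is
at most 2 at radius \<open>10 * r\<close>; in the smaller one the deviation is at least \<open>pi * r\<^sup>2\<close>, because
it is at least 2 there.\<close>

theorem crossing_energy:
  assumes deviation: "emeasure deviation (cball 0 1) \<le> ennreal (pi / 2500)"
  shows "emeasure crossing (cball 0 (1/4)) \<le> ennreal (40000 * pi + 2) * emeasure deviation (cball 0 1)"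
proof -
  let ?G = "{y \<in> cball 0 (1/4). y \<notin> boundary \<and> m y > 2}"
  let ?L = "{y \<in> cball 0 1. m y \<le> 2}"
  define G where "G = ?G"
  have ex: "\<forall>y\<in>G. \<exists>r. 0 < r \<and> r \<le> 1/50 \<and> 2 * (pi * r\<^sup>2) \<le> ball_mass y r \<and> ball_mass y (10 * r) \<le> 2 * (pi * (10 * r)\<^sup>2)"
    using critical_radius[OF _ _ _ deviation] by (auto simp: G_def)
  obtain r where r': "\<forall>y\<in>G. 0 < r y \<and> r y \<le> 1/50 \<and> 2 * (pi * (r y)\<^sup>2) \<le> ball_mass y (r y) \<and> ball_mass y (10 * r y) \<le> 2 * (pi * (10 * r y)\<^sup>2)"
    using bchoice[OF ex] by blast
  then have r: "\<And>y. y \<in> G \<Longrightarrow> 0 < r y" "\<And>y. y \<in> G \<Longrightarrow> r y \<le> 1/50"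
     "\<And>y. y \<in> G \<Longrightarrow> 2 * (pi * (r y)\<^sup>2) \<le> ball_mass y (r y)" "\<And>y. y \<in> G \<Longrightarrow> ball_mass y (10 * r y) \<le> 2 * (pi * (10 * r y)\<^sup>2)"
    by blast+
  have cov: "G \<subseteq> (\<Union>y\<in>G. cball y (r y))" using r(1) by force
  obtain C where C: "countable C" "C \<subseteq> G"
     "pairwise (\<lambda>i j. disjnt (cball i (r i)) (cball j (r j))) C"
     "G \<subseteq> (\<Union>i\<in>C. cball i (5 * r i))"
  proof (rule Vitali_covering_lemma_cballs[OF cov, where B="1/50"])
    show "0 < r i \<and> r i \<le> 1/50" if "i \<in> G" for i using r(1,2)[OF that] by simp
  qed (rule that)
  have "emeasure crossing G \<le> ennreal (40000 * pi) * emeasure deviation (cball 0 1)"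
  proof (rule emeasure_le_by_disjoint[OF C(1), where E="\<lambda>y. cball y (5 * r y)" and T="\<lambda>y. cball y (r y)"])
    show "disjoint_family_on (\<lambda>y. cball y (r y)) C"
      using C(3) by (auto simp: disjoint_family_on_def pairwise_def disjnt_def)
    show "G \<subseteq> (\<Union>i\<in>C. cball i (5 * r i))" by (rule C(4))
  next
    fix y assume "y \<in> C"
    then have y: "y \<in> G" using C(2) by auto
    then have y4: "dist 0 y \<le> 1/4" by (simp add: G_def)
    show "cball y (r y) \<subseteq> cball 0 1"
    proof
      fix x assume "x \<in> cball y (r y)"
      then have "dist y x \<le> 1/50" using r(2)[OF y] by simp
      moreover note y4
      ultimately show "x \<in> cball 0 1" using dist_triangle[of 0 x y] by simp
    qed
    have "emeasure crossing (cball y (5 * r y)) \<le> ennreal ((ball_mass y (10 * r y) / r y)\<^sup>2)"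
      using r(1)[OF y] by (rule crossing_ball_le)
    also have "\<dots> \<le> ennreal ((200 * pi * r y)\<^sup>2)"
    proof (intro ennreal_leI power_mono)
      show "ball_mass y (10 * r y) / r y \<le> 200 * pi * r y"
        using r(4)[OF y] r(1)[OF y] by (simp add: power2_eq_square field_simps)
      show "0 \<le> ball_mass y (10 * r y) / r y" using r(1)[OF y] by (auto simp: ball_mass_def intro!: divide_nonneg_pos sum_nonneg)
    qed
    also have "(200 * pi * r y)\<^sup>2 = (40000 * pi) * (pi * (r y)\<^sup>2)" by (simp add: power2_eq_square)
    also have "ennreal \<dots> = ennreal (40000 * pi) * ennreal (pi * (r y)\<^sup>2)" by (rule ennreal_mult) auto
    also have "\<dots> \<le> ennreal (40000 * pi) * emeasure deviation (cball y (r y))"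
      using dense_ball_charge[OF r(3)[OF y]] r(1)[OF y] by (intro mult_left_mono) auto
    finally show "emeasure crossing (cball y (5 * r y)) \<le> ennreal (40000 * pi) * emeasure deviation (cball y (r y))" .
  qed simp_all
  moreover have "emeasure crossing ?L \<le> 2 * emeasure deviation (cball 0 1)"
  proof -
    have Lb: "?L \<in> sets borel" by measurable
    have "emeasure crossing ?L \<le> (\<integral>\<^sup>+y. 2 * (ennreal \<bar>m y - 1\<bar> * indicator (cball 0 1) y) \<partial>lborel)"
      unfolding emeasure_crossing[OF Lb]
    proof (rule nn_integral_mono)
      fix y :: "real \<times> real"
      show "ennreal (crossing_weight y) * indicator ?L y \<le> 2 * (ennreal \<bar>m y - 1\<bar> * indicator (cball 0 1) y)"
      proof (cases "y \<in> ?L")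
        case True
        have "crossing_weight y \<le> m y * (m y - 1)" by (rule crossing_weight_le)
        also have "\<dots> \<le> m y * \<bar>m y - 1\<bar>" using m_nonneg by (intro mult_left_mono) auto
        also have "\<dots> \<le> 2 * \<bar>m y - 1\<bar>" using True by (intro mult_right_mono) auto
        finally have "ennreal (crossing_weight y) \<le> ennreal (2 * \<bar>m y - 1\<bar>)" by (rule ennreal_leI)
        also have "\<dots> = 2 * ennreal \<bar>m y - 1\<bar>" by (subst ennreal_mult) auto
        finally show ?thesis using True by simp
      qed simp
    qed
    also have "\<dots> = 2 * emeasure deviation (cball 0 1)"
    proof -
      have [measurable]: "cball (0 :: real \<times> real) 1 \<in> sets borel" by simp
      have "(\<lambda>y. ennreal \<bar>m y - 1\<bar> * indicator (cball 0 1) y) \<in> borel_measurable lborel" by measurable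
      then show ?thesis by (simp add: nn_integral_cmult emeasure_deviation)
    qed
    finally show ?thesis .
  qed
  moreover have "emeasure crossing (cball 0 (1/4)) \<le> emeasure crossing G + emeasure crossing ?L"
  proof -
    have Gb: "?G \<in> sets borel" by measurable
    have Lb: "?L \<in> sets borel" by measurable
    have "emeasure crossing (cball 0 (1/4)) \<le> emeasure crossing ((?G \<union> ?L) \<union> boundary)"
      using Gb Lb by (intro emeasure_mono) (auto simp: not_less)
    also have "\<dots> \<le> emeasure crossing (?G \<union> ?L) + emeasure crossing boundary"
      using Gb Lb by (intro emeasure_subadditive) auto
    also have "\<dots> \<le> emeasure crossing ?G + emeasure crossing ?L"
      using Gb Lb emeasure_subadditive[of ?G crossing ?L] by (simp add: crossing_boundary)
    finally show ?thesis unfolding G_def .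
  qed
  ultimately have "emeasure crossing (cball 0 (1/4)) \<le> ennreal (40000 * pi) * emeasure deviation (cball 0 1) + 2 * emeasure deviation (cball 0 1)"
    by (meson add_mono order_trans)
  also have "\<dots> = (ennreal (40000 * pi) + 2) * emeasure deviation (cball 0 1)" by (simp add: distrib_right)
  also have "ennreal (40000 * pi) + 2 = ennreal (40000 * pi + 2)" by (subst ennreal_plus) auto
  finally show ?thesis .
qed

end

section \<open>Affine images of a family of strips\<close>

definition aff :: "real \<times> real \<Rightarrow> real \<Rightarrow> real \<Rightarrow> real \<Rightarrow> real \<Rightarrow> real \<times> real \<Rightarrow> real \<times> real" where
  "aff z \<alpha> \<beta> \<gamma> \<delta> y = (fst z + \<alpha> * fst y + \<beta> * snd y, snd z + \<gamma> * fst y + \<delta> * snd y)"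

lemma aff_measurable [measurable]: "aff z \<alpha> \<beta> \<gamma> \<delta> \<in> borel_measurable borel"
  unfolding aff_def[abs_def] by (intro borel_measurable_continuous_onI continuous_intros)

lemma nn_integral_aff:
  assumes [measurable]: "f \<in> borel_measurable borel" and det: "\<alpha> * \<delta> - \<gamma> * \<beta> \<noteq> 0"
  shows "(\<integral>\<^sup>+y. f y \<partial>lborel) = ennreal \<bar>\<alpha> * \<delta> - \<gamma> * \<beta>\<bar> * (\<integral>\<^sup>+y. f (aff z \<alpha> \<beta> \<gamma> \<delta> y) \<partial>lborel)"
proof -
  have "(\<integral>\<^sup>+y. f y \<partial>lborel) = (\<integral>\<^sup>+y. f (z + y) \<partial>lborel)"
    by (rule nn_integral_lborel_translate[symmetric]) simp
  also have "\<dots> = ennreal \<bar>\<alpha> * \<delta> - \<gamma> * \<beta>\<bar> * (\<integral>\<^sup>+y. f (z + (\<alpha> * fst y + \<beta> * snd y, \<gamma> * fst y + \<delta> * snd y)) \<partial>lborel)"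
    by (rule nn_integral_plane_linear[OF _ det]) simp
  also have "(\<lambda>y. z + (\<alpha> * fst y + \<beta> * snd y, \<gamma> * fst y + \<delta> * snd y)) = aff z \<alpha> \<beta> \<gamma> \<delta>"
    by (auto simp: aff_def fun_eq_iff prod_eq_iff)
  then have "(\<integral>\<^sup>+y. f (z + (\<alpha> * fst y + \<beta> * snd y, \<gamma> * fst y + \<delta> * snd y)) \<partial>lborel) = (\<integral>\<^sup>+y. f (aff z \<alpha> \<beta> \<gamma> \<delta> y) \<partial>lborel)"
    by (metis (no_types))
  finally show ?thesis .
qed

lemma aff_vimage_borel [simp, measurable]: "B \<in> sets borel \<Longrightarrow> aff z \<alpha> \<beta> \<gamma> \<delta> -` B \<in> sets borel"
  using measurable_sets[OF aff_measurable, of B] by simp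

lemma emeasure_aff:
  assumes B [measurable]: "B \<in> sets borel" and det: "\<alpha> * \<delta> - \<gamma> * \<beta> \<noteq> 0"
  shows "emeasure lborel B = ennreal \<bar>\<alpha> * \<delta> - \<gamma> * \<beta>\<bar> * emeasure lborel (aff z \<alpha> \<beta> \<gamma> \<delta> -` B)"
proof -
  have "emeasure lborel B = (\<integral>\<^sup>+y. indicator B y \<partial>lborel)" by simp
  also have "\<dots> = ennreal \<bar>\<alpha> * \<delta> - \<gamma> * \<beta>\<bar> * (\<integral>\<^sup>+y. indicator B (aff z \<alpha> \<beta> \<gamma> \<delta> y) \<partial>lborel)"
    by (rule nn_integral_aff[OF _ det]) simp
  also have "(\<integral>\<^sup>+y. indicator B (aff z \<alpha> \<beta> \<gamma> \<delta> y) \<partial>lborel) = (\<integral>\<^sup>+y. indicator (aff z \<alpha> \<beta> \<gamma> \<delta> -` B) y \<partial>lborel)"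
    by (intro nn_integral_cong) (auto simp: indicator_def)
  also have "\<dots> = emeasure lborel (aff z \<alpha> \<beta> \<gamma> \<delta> -` B)"
    by (rule nn_integral_indicator) simp
  finally show ?thesis .
qed

context strips begin

text \<open>Preimages of strips are strips; only the normals have to be rescaled to unit length, by the factors
\<open>nrm j\<close>.  Multiplicity is transported pointwise, hence deviation is multiplied by the determinant.
This is what makes rigidity available in tubes of any width.\<close>

lemma pullback:
  assumes det: "\<alpha> * \<delta> - \<gamma> * \<beta> \<noteq> 0"
  obtains p' q' a' b' nrm where "strips I p' q'"
    "\<And>j. j \<in> I \<Longrightarrow> nrm j = sqrt ((p j * \<alpha> + q j * \<gamma>)\<^sup>2 + (p j * \<beta> + q j * \<delta>)\<^sup>2)"
    "\<And>j. j \<in> I \<Longrightarrow> nrm j > 0"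
    "\<And>j. j \<in> I \<Longrightarrow> p' j = (p j * \<alpha> + q j * \<gamma>) / nrm j"
    "\<And>j. j \<in> I \<Longrightarrow> q' j = (p j * \<beta> + q j * \<delta>) / nrm j"
    "\<And>j. j \<in> I \<Longrightarrow> strips.P p' q' a' b' j = aff z \<alpha> \<beta> \<gamma> \<delta> -` P j"
    "\<And>y. strips.m I p' q' a' b' y = m (aff z \<alpha> \<beta> \<gamma> \<delta> y)"
    "\<And>B. B \<in> sets borel \<Longrightarrow> ennreal \<bar>\<alpha> * \<delta> - \<gamma> * \<beta>\<bar> * emeasure (strips.deviation I p' q' a' b') (aff z \<alpha> \<beta> \<gamma> \<delta> -` B) = emeasure deviation B"
proof -
  define nrm where "nrm j = sqrt ((p j * \<alpha> + q j * \<gamma>)\<^sup>2 + (p j * \<beta> + q j * \<delta>)\<^sup>2)" for j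
  define p' where "p' j = (p j * \<alpha> + q j * \<gamma>) / nrm j" for j
  define q' where "q' j = (p j * \<beta> + q j * \<delta>) / nrm j" for j
  define e where "e j = p j * fst z + q j * snd z" for j
  define a' where "a' j = (a j - e j) / nrm j" for j
  define b' where "b' j = (b j - e j) / nrm j" for j
  have pos: "nrm j > 0" if "j \<in> I" for j
  proof (rule ccontr)
    assume "\<not> nrm j > 0"
    then have "(p j * \<alpha> + q j * \<gamma>)\<^sup>2 + (p j * \<beta> + q j * \<delta>)\<^sup>2 = 0"
      by (smt (verit, best) nrm_def real_sqrt_gt_zero zero_le_power2)
    then have z: "p j * \<alpha> + q j * \<gamma> = 0" "p j * \<beta> + q j * \<delta> = 0" by (simp_all add: sum_power2_eq_zero_iff)
    have "p j * (\<alpha> * \<delta> - \<gamma> * \<beta>) = (p j * \<alpha> + q j * \<gamma>) * \<delta> - (p j * \<beta> + q j * \<delta>) * \<gamma>"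
      by (simp add: algebra_simps)
    then have "p j = 0" using z det by simp
    moreover have "q j * (\<alpha> * \<delta> - \<gamma> * \<beta>) = (p j * \<beta> + q j * \<delta>) * \<alpha> - (p j * \<alpha> + q j * \<gamma>) * \<beta>"
      by (simp add: algebra_simps)
    then have "q j = 0" using z det by simp
    ultimately show False using unit[OF that] by simp
  qed
  have un: "strips I p' q'"
  proof
    show "finite I" by (rule fin)
    fix j assume j: "j \<in> I"
    have sq: "(nrm j)\<^sup>2 = (p j * \<alpha> + q j * \<gamma>)\<^sup>2 + (p j * \<beta> + q j * \<delta>)\<^sup>2" by (simp add: nrm_def)
    have "(p' j)\<^sup>2 + (q' j)\<^sup>2 = ((p j * \<alpha> + q j * \<gamma>)\<^sup>2 + (p j * \<beta> + q j * \<delta>)\<^sup>2) / (nrm j)\<^sup>2"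
      by (simp only: p'_def q'_def power_divide add_divide_distrib[symmetric])
    also have "\<dots> = 1" unfolding sq[symmetric] using pos[OF j] by simp
    finally show "(p' j)\<^sup>2 + (q' j)\<^sup>2 = 1" .
  qed
  then interpret S': strips I p' q' a' b' .
  have P': "S'.P j = aff z \<alpha> \<beta> \<gamma> \<delta> -` P j" if j: "j \<in> I" for j
  proof (rule set_eqI)
    fix y
    have *: "p j * fst (aff z \<alpha> \<beta> \<gamma> \<delta> y) + q j * snd (aff z \<alpha> \<beta> \<gamma> \<delta> y)
       = nrm j * (p' j * fst y + q' j * snd y) + e j"
    proof -
      have "nrm j * p' j = p j * \<alpha> + q j * \<gamma>" "nrm j * q' j = p j * \<beta> + q j * \<delta>"
        using pos[OF j] by (simp_all add: p'_def q'_def)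
      then have "nrm j * (p' j * fst y + q' j * snd y) = (p j * \<alpha> + q j * \<gamma>) * fst y + (p j * \<beta> + q j * \<delta>) * snd y"
        by (simp only: distrib_left mult.assoc[symmetric])
      then show ?thesis by (simp add: e_def aff_def algebra_simps)
    qed
    show "y \<in> S'.P j \<longleftrightarrow> y \<in> aff z \<alpha> \<beta> \<gamma> \<delta> -` P j"
      using pos[OF j] by (simp add: S'.P_def P_def strip_def * a'_def b'_def pos_divide_le_eq pos_le_divide_eq le_diff_eq diff_le_eq mult.commute)
  qed
  have m': "S'.m y = m (aff z \<alpha> \<beta> \<gamma> \<delta> y)" for y
    unfolding S'.m_def m_def by (intro sum.cong refl) (simp add: P' indicator_def)
  have nu: "ennreal \<bar>\<alpha> * \<delta> - \<gamma> * \<beta>\<bar> * emeasure S'.deviation (aff z \<alpha> \<beta> \<gamma> \<delta> -` B) = emeasure deviation B"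
    if B [measurable]: "B \<in> sets borel" for B
  proof -
    have "emeasure deviation B = ennreal \<bar>\<alpha> * \<delta> - \<gamma> * \<beta>\<bar> *
       (\<integral>\<^sup>+y. ennreal \<bar>m (aff z \<alpha> \<beta> \<gamma> \<delta> y) - 1\<bar> * indicator B (aff z \<alpha> \<beta> \<gamma> \<delta> y) \<partial>lborel)"
      unfolding emeasure_deviation[OF B] by (rule nn_integral_aff[OF _ det]) measurable
    also have "(\<integral>\<^sup>+y. ennreal \<bar>m (aff z \<alpha> \<beta> \<gamma> \<delta> y) - 1\<bar> * indicator B (aff z \<alpha> \<beta> \<gamma> \<delta> y) \<partial>lborel)
       = emeasure S'.deviation (aff z \<alpha> \<beta> \<gamma> \<delta> -` B)"
      by (subst S'.emeasure_deviation) (auto simp: m' intro!: nn_integral_cong split: split_indicator)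
    finally show ?thesis by simp
  qed
  show thesis
    by (rule that[OF un nrm_def pos p'_def q'_def P' m' nu])
qed

end

section \<open>Nearly vertical strips as moving intervals\<close>

text \<open>The length of the part of the interval from \<open>l\<close> to \<open>h\<close> to the left of \<open>u\<close>.\<close>

definition clamp :: "real \<Rightarrow> real \<Rightarrow> real \<Rightarrow> real" where "clamp l h u = max 0 (min u h - l)"

lemma clamp_mono: "u \<le> u' \<Longrightarrow> clamp l h u \<le> clamp l h u'"
  by (auto simp: clamp_def)

lemma measure_Icc_if: "measure lborel {x..y::real} = max 0 (y - x)"
  by (cases "x \<le> y") auto

lemma clamp_measure:
  "u \<le> u' \<Longrightarrow> clamp l h u' - clamp l h u = measure lborel ({l..h} \<inter> {u..u'})"
  by (auto simp: clamp_def measure_Icc_if Int_atLeastAtMost max_def min_def)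

lemma mult_max_min_diff:
  fixes c :: real
  assumes "c > 0"
  shows "c * max 0 (min t A - max s B) = max 0 (min (c * t) (c * A) - max (c * s) (c * B))"
  using assms by (simp add: max_mult_distrib_left min_mult_distrib_left right_diff_distrib)

text \<open>How much of an interval a point moving with relative speed \<open>c\<close> passes: at most speed times the
time spent inside.\<close>

lemma clamp_line:
  assumes "t1 \<le> t2"
  shows "\<bar>clamp l h (y + c * t2) - clamp l h (y + c * t1)\<bar> \<le>
    \<bar>c\<bar> * measure lborel {t \<in> {t1..t2}. l \<le> y + c * t \<and> y + c * t \<le> h}"
proof -
  consider "c = 0" | "c > 0" | "c < 0" by linarith
  then show ?thesis
  proof cases
    case 2
    have st: "{t \<in> {t1..t2}. l \<le> y + c * t \<and> y + c * t \<le> h} = {max t1 ((l - y)/c) .. min t2 ((h - y)/c)}"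
      using 2 by (auto simp: field_simps)
    have "\<bar>c\<bar> * measure lborel {t \<in> {t1..t2}. l \<le> y + c * t \<and> y + c * t \<le> h}
       = c * max 0 (min t2 ((h - y)/c) - max t1 ((l - y)/c))"
      unfolding st measure_Icc_if using 2 by simp
    also have "\<dots> = max 0 (min (c * t2) (h - y) - max (c * t1) (l - y))"
      using 2 by (simp add: mult_max_min_diff)
    finally have e: "\<bar>c\<bar> * measure lborel {t \<in> {t1..t2}. l \<le> y + c * t \<and> y + c * t \<le> h}
       = max 0 (min (c * t2) (h - y) - max (c * t1) (l - y))" .
    have "c * t1 \<le> c * t2" using 2 assms by simp
    then show ?thesis unfolding e clamp_def by (auto simp: max_def min_def)
  next
    case 3
    define k where "k = - c"
    have k: "k > 0" "c = - k" using 3 by (auto simp: k_def)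
    have st: "{t \<in> {t1..t2}. l \<le> y + c * t \<and> y + c * t \<le> h} = {max t1 ((y - h)/k) .. min t2 ((y - l)/k)}"
      using k by (auto simp: field_simps)
    have "\<bar>c\<bar> * measure lborel {t \<in> {t1..t2}. l \<le> y + c * t \<and> y + c * t \<le> h}
       = k * max 0 (min t2 ((y - l)/k) - max t1 ((y - h)/k))"
      unfolding st measure_Icc_if using k by simp
    also have "\<dots> = max 0 (min (k * t2) (y - l) - max (k * t1) (y - h))"
      using k by (simp add: mult_max_min_diff)
    finally have e: "\<bar>c\<bar> * measure lborel {t \<in> {t1..t2}. l \<le> y + c * t \<and> y + c * t \<le> h}
       = max 0 (min (k * t2) (y - l) - max (k * t1) (y - h))" .
    have "k * t1 \<le> k * t2" using k assms by simp
    then show ?thesis unfolding e unfolding clamp_def k(2) by (auto simp: max_def min_def)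
  qed auto
qed

lemma emeasure_bounded_real:
  "S \<subseteq> {-k..k} \<Longrightarrow> emeasure lborel S = ennreal (measure lborel (S :: real set))"
  by (rule emeasure_eq_ennreal_measure)
     (metis emeasure_bounded_finite bounded_closed_interval bounded_subset less_irrefl infinity_ennreal_def)

lemma nn_integral_shear:
  fixes f :: "real \<times> real \<Rightarrow> ennreal"
  assumes [measurable]: "f \<in> borel_measurable borel"
  shows "(\<integral>\<^sup>+y. f y \<partial>lborel) = (\<integral>\<^sup>+u. (\<integral>\<^sup>+t. f (u + c * t, t) \<partial>lborel) \<partial>lborel)"
    and "(\<integral>\<^sup>+y. f y \<partial>lborel) = (\<integral>\<^sup>+t. (\<integral>\<^sup>+u. f (u + c * t, t) \<partial>lborel) \<partial>lborel)"
proof -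
  have m: "(\<lambda>y. f (fst y + c * snd y, snd y)) \<in> borel_measurable borel"
    by (rule measurable_compose[OF borel_measurable_continuous_onI assms]) (intro continuous_intros)
  have "(\<integral>\<^sup>+y. f y \<partial>lborel) = (\<integral>\<^sup>+y. f (fst y + c * snd y, snd y) \<partial>lborel)"
    using nn_integral_plane_linear[of f 1 1 0 c] by simp
  then show "(\<integral>\<^sup>+y. f y \<partial>lborel) = (\<integral>\<^sup>+u. (\<integral>\<^sup>+t. f (u + c * t, t) \<partial>lborel) \<partial>lborel)"
    and "(\<integral>\<^sup>+y. f y \<partial>lborel) = (\<integral>\<^sup>+t. (\<integral>\<^sup>+u. f (u + c * t, t) \<partial>lborel) \<partial>lborel)"
    using nn_integral_lborel_plane[OF m] by simp_all
qed

text \<open>The rigidity argument takes place in the square of half-side \<open>win\<close>.  The value is such that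
\<open>2 * win = (1/10)\<^sup>2\<close>, where \<open>1/10\<close> is the bound that separates steep strips from flat ones; this is
used in \<open>rigid_vertical\<close>.\<close>

abbreviation win :: real where "win \<equiv> 1/200"

definition square :: "real \<Rightarrow> (real \<times> real) set" where "square s = {-s..s} \<times> {-s..s}"

lemma square_borel [simp, measurable]: "square s \<in> sets borel"
  unfolding square_def by (intro borel_closed closed_Times) auto

lemma square_bounded [simp]: "bounded (square s)"
  unfolding square_def by (intro bounded_Times) auto

lemma square_subset_cball: "sqrt 2 * s \<le> r \<Longrightarrow> square s \<subseteq> cball 0 r"
proof
  fix y assume r: "sqrt 2 * s \<le> r" and y: "y \<in> square s"
  then have s: "s \<ge> 0" by (auto simp: square_def)
  have "\<bar>fst y\<bar> \<le> s" "\<bar>snd y\<bar> \<le> s" using y by (auto simp: square_def)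
  then have "(fst y)\<^sup>2 + (snd y)\<^sup>2 \<le> s\<^sup>2 + s\<^sup>2" by (intro add_mono) (simp_all add: abs_le_square_iff[symmetric])
  then have "norm y \<le> sqrt (2 * s\<^sup>2)" by (cases y) (simp add: norm_Pair)
  also have "\<dots> = sqrt 2 * s" using s by (simp add: real_sqrt_mult)
  finally show "y \<in> cball 0 r" using r by simp
qed

context strips begin

text \<open>A steep strip is an interval from \<open>lo j\<close> to \<open>hi j\<close> at time 0 that moves with velocity \<open>slope j\<close>,
where the second coordinate is the time.\<close>

definition steep :: "nat set" where "steep = {j \<in> I. \<bar>q j\<bar> < 1/10}"
definition slope :: "nat \<Rightarrow> real" where "slope j = - q j / p j"
definition lo :: "nat \<Rightarrow> real" where "lo j = (if p j > 0 then a j / p j else b j / p j)"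
definition hi :: "nat \<Rightarrow> real" where "hi j = (if p j > 0 then b j / p j else a j / p j)"

lemma steep_I: "j \<in> steep \<Longrightarrow> j \<in> I" by (simp add: steep_def)
lemma steep_fin [simp]: "finite steep" using fin by (simp add: steep_def)

lemma steep_p: assumes "j \<in> steep" shows "(p j)\<^sup>2 > 99/100" "p j \<noteq> 0"
proof -
  have "(q j)\<^sup>2 < (1/10)\<^sup>2" using assms unfolding steep_def
    by (metis (no_types, lifting) abs_ge_zero mem_Collect_eq power2_abs power_strict_mono zero_less_numeral)
  then show "(p j)\<^sup>2 > 99/100" using unit[OF steep_I[OF assms]] by (simp add: power2_eq_square)
  then show "p j \<noteq> 0" by auto
qed

lemma steep_slope: assumes "j \<in> steep" shows "\<bar>slope j\<bar> \<le> 102/1000" "\<bar>q j\<bar> \<le> \<bar>slope j\<bar>" "(slope j)\<^sup>2 \<le> 2 * (q j)\<^sup>2"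
proof -
  have q: "\<bar>q j\<bar> < 1/10" using assms by (simp add: steep_def)
  have p: "(p j)\<^sup>2 > 99/100" "p j \<noteq> 0" using steep_p[OF assms] by auto
  have p1: "(p j)\<^sup>2 \<le> 1" using unit[OF steep_I[OF assms]] zero_le_power2[of "q j"] by linarith
  have ap1: "\<bar>p j\<bar> \<le> 1" using p1 by (simp add: abs_square_le_1)
  have "(p j)\<^sup>2 \<le> \<bar>p j\<bar>" using ap1
    by (metis abs_ge_zero mult_left_le power2_abs power2_eq_square)
  then have ap: "\<bar>p j\<bar> > 99/100" using p by linarith
  have "\<bar>slope j\<bar> = \<bar>q j\<bar> / \<bar>p j\<bar>" by (simp add: slope_def)
  also have "\<dots> \<le> (1/10) / (99/100)" using q ap by (intro frac_le) auto
  finally show "\<bar>slope j\<bar> \<le> 102/1000" by simp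
  show "\<bar>q j\<bar> \<le> \<bar>slope j\<bar>" using ap1 ap by (simp add: slope_def pos_le_divide_eq mult_left_le)
  have "(slope j)\<^sup>2 = (q j)\<^sup>2 / (p j)\<^sup>2" by (simp add: slope_def power_divide)
  also have "\<dots> \<le> (q j)\<^sup>2 / (1/2)" using p by (intro divide_left_mono) auto
  finally show "(slope j)\<^sup>2 \<le> 2 * (q j)\<^sup>2" by simp
qed

lemma slope_diff_le_sinsq: 
  assumes "i \<in> steep" "j \<in> steep" shows "(slope i - slope j)\<^sup>2 \<le> 2 * sinsq i j"
proof -
  have p: "(p i)\<^sup>2 > 99/100" "p i \<noteq> 0" "(p j)\<^sup>2 > 99/100" "p j \<noteq> 0" using steep_p assms by auto
  have "slope i - slope j = (p i * q j - p j * q i) / (p i * p j)" using p by (simp add: slope_def field_simps)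
  then have "(slope i - slope j)\<^sup>2 = sinsq i j / ((p i)\<^sup>2 * (p j)\<^sup>2)" by (simp add: sinsq_def power_divide power_mult_distrib)
  also have "\<dots> \<le> sinsq i j / (1/2)"
  proof (rule divide_left_mono)
    have "(99/100) * (99/100) \<le> (p i)\<^sup>2 * (p j)\<^sup>2" using p by (intro mult_mono) auto
    then show "1/2 \<le> (p i)\<^sup>2 * (p j)\<^sup>2" by simp
  qed (use p sinsq_nonneg in auto)
  finally show ?thesis by simp
qed

lemma P_steep: 
  assumes "j \<in> steep" shows "(x, t) \<in> P j \<longleftrightarrow> lo j + slope j * t \<le> x \<and> x \<le> hi j + slope j * t"
proof (cases "p j > 0")
  case True
  then show ?thesis by (auto simp: P_def strip_def lo_def hi_def slope_def field_simps)
next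
  case False
  then have "p j < 0" using steep_p[OF assms] by simp
  then show ?thesis by (auto simp: P_def strip_def lo_def hi_def slope_def field_simps)
qed

definition steep_mult :: "real \<times> real \<Rightarrow> real" where "steep_mult y = (\<Sum>j\<in>steep. indicator (P j) y)"

lemma steep_mult_measurable [measurable]: "steep_mult \<in> borel_measurable borel"
  unfolding steep_mult_def[abs_def] by measurable

lemma slice_measurable [measurable]: "(\<lambda>x. (x, t)) \<in> borel_measurable (borel :: real measure)"
  "(\<lambda>t. (y + c * t, t)) \<in> borel_measurable (borel :: real measure)" for t :: real and y :: real
  by (intro borel_measurable_continuous_onI continuous_intros)+

text \<open>The total length, at time \<open>t\<close>, of the parts of the intervals to the left of \<open>x\<close>.\<close>

definition left_mass :: "real \<Rightarrow> real \<Rightarrow> real" where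
  "left_mass t x = (\<Sum>j\<in>steep. clamp (lo j) (hi j) (x - slope j * t))"

definition slice_dev :: "real \<Rightarrow> ennreal" where
  "slice_dev t = (\<integral>\<^sup>+x. ennreal \<bar>steep_mult (x, t) - 1\<bar> * indicator {-win..win} x \<partial>lborel)"

lemma left_mass_diff:
  assumes "x \<le> x'"
  shows "ennreal (left_mass t x' - left_mass t x) = (\<integral>\<^sup>+u. ennreal (steep_mult (u, t)) * indicator {x..x'} u \<partial>lborel)" "left_mass t x' - left_mass t x \<ge> 0"
proof -
  have c: "clamp (lo j) (hi j) (x' - slope j * t) - clamp (lo j) (hi j) (x - slope j * t)
     = measure lborel ({u. (u, t) \<in> P j} \<inter> {x..x'})" if j: "j \<in> steep" for j
  proof -
    have "{u. (u, t) \<in> P j} = {lo j + slope j * t..hi j + slope j * t}" using P_steep[OF j] by auto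
    moreover have "clamp (lo j + slope j * t) (hi j + slope j * t) x' - clamp (lo j + slope j * t) (hi j + slope j * t) x
       = measure lborel ({lo j + slope j * t..hi j + slope j * t} \<inter> {x..x'})"
      by (rule clamp_measure[OF assms])
    moreover have "clamp (lo j + slope j * t) (hi j + slope j * t) z = clamp (lo j) (hi j) (z - slope j * t)" for z
      by (simp add: clamp_def min_def algebra_simps)
    ultimately show ?thesis by simp
  qed
  have eq: "left_mass t x' - left_mass t x = (\<Sum>j\<in>steep. measure lborel ({u. (u, t) \<in> P j} \<inter> {x..x'}))"
    unfolding left_mass_def by (simp add: sum_subtractf[symmetric] c)
  then show "left_mass t x' - left_mass t x \<ge> 0" by (simp add: sum_nonneg)
  have [measurable]: "{u. (u, t) \<in> P j} \<in> sets borel" for j by measurable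
  have "ennreal (left_mass t x' - left_mass t x) = (\<Sum>j\<in>steep. emeasure lborel ({u. (u, t) \<in> P j} \<inter> {x..x'}))"
  proof -
    have "emeasure lborel ({u. (u, t) \<in> P j} \<inter> {x..x'}) = ennreal (measure lborel ({u. (u, t) \<in> P j} \<inter> {x..x'}))" for j
      by (rule emeasure_bounded_real[of _ "\<bar>x\<bar> + \<bar>x'\<bar>"]) auto
    then show ?thesis unfolding eq by (simp add: sum_nonneg)
  qed
  also have "\<dots> = (\<Sum>j\<in>steep. \<integral>\<^sup>+u. indicator ({u. (u, t) \<in> P j} \<inter> {x..x'}) u \<partial>lborel)" by simp
  also have "\<dots> = (\<integral>\<^sup>+u. (\<Sum>j\<in>steep. indicator ({u. (u, t) \<in> P j} \<inter> {x..x'}) u) \<partial>lborel)"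
    by (rule nn_integral_sum[symmetric]) measurable
  also have "\<dots> = (\<integral>\<^sup>+u. ennreal (steep_mult (u, t)) * indicator {x..x'} u \<partial>lborel)"
  proof (intro nn_integral_cong)
    fix u
    have "(\<Sum>j\<in>steep. indicator ({u. (u, t) \<in> P j} \<inter> {x..x'}) u) = (\<Sum>j\<in>steep. ennreal (indicator (P j) (u, t)) * indicator {x..x'} u)"
      by (intro sum.cong refl) (simp split: split_indicator)
    also have "\<dots> = (\<Sum>j\<in>steep. ennreal (indicator (P j) (u, t))) * indicator {x..x'} u"
      by (rule sum_distrib_right[symmetric])
    also have "(\<Sum>j\<in>steep. ennreal (indicator (P j) (u, t))) = ennreal (steep_mult (u, t))"
      unfolding steep_mult_def by (rule sum_ennreal) auto
    finally show "(\<Sum>j\<in>steep. indicator ({u. (u, t) \<in> P j} \<inter> {x..x'}) u) = ennreal (steep_mult (u, t)) * indicator {x..x'} u" .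
  qed
  finally show "ennreal (left_mass t x' - left_mass t x) = (\<integral>\<^sup>+u. ennreal (steep_mult (u, t)) * indicator {x..x'} u \<partial>lborel)" .
qed

lemma steep_mult_nonneg: "steep_mult y \<ge> 0" unfolding steep_mult_def by (intro sum_nonneg) auto

text \<open>In a near-tiling the mass between two points is their distance.\<close>

lemma left_mass_spread:
  assumes x: "-win \<le> x" "x \<le> x'" "x' \<le> win" and o: "slice_dev t \<le> ennreal e" "e \<ge> 0"
  shows "\<bar>left_mass t x' - left_mass t x - (x' - x)\<bar> \<le> e"
proof -
  have oc: "(\<integral>\<^sup>+u. ennreal \<bar>steep_mult (u, t) - 1\<bar> * indicator {x..x'} u \<partial>lborel) \<le> ennreal e"
    using x by (intro order_trans[OF nn_integral_mono o(1)[unfolded slice_dev_def]]) (auto split: split_indicator)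
  have near: "ennreal (left_mass t x' - left_mass t x) \<le> ennreal (x' - x) + (\<integral>\<^sup>+u. ennreal \<bar>steep_mult (u, t) - 1\<bar> * indicator {x..x'} u \<partial>lborel)"
    "ennreal (x' - x) \<le> ennreal (left_mass t x' - left_mass t x) + (\<integral>\<^sup>+u. ennreal \<bar>steep_mult (u, t) - 1\<bar> * indicator {x..x'} u \<partial>lborel)"
    unfolding left_mass_diff[OF x(2)]
    using nn_integral_near_one[of "\<lambda>u. steep_mult (u, t)" lborel "{x..x'}"] steep_mult_nonneg x by simp_all
  have "ennreal (left_mass t x' - left_mass t x) \<le> ennreal (x' - x) + ennreal e"
    using near(1) add_left_mono[OF oc] by (rule order_trans)
  also have "\<dots> = ennreal (x' - x + e)" using x o by (subst ennreal_plus) auto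
  finally have 1: "left_mass t x' - left_mass t x \<le> x' - x + e" using x o by (subst (asm) ennreal_le_iff) auto
  have "ennreal (x' - x) \<le> ennreal (left_mass t x' - left_mass t x) + ennreal e"
    using near(2) add_left_mono[OF oc] by (rule order_trans)
  also have "\<dots> = ennreal (left_mass t x' - left_mass t x + e)" using left_mass_diff(2)[OF x(2)] o by (subst ennreal_plus) auto
  finally have 2: "x' - x \<le> left_mass t x' - left_mass t x + e" using left_mass_diff(2)[OF x(2), of t] o by (subst (asm) ennreal_le_iff) auto
  from 1 2 show ?thesis by linarith
qed

text \<open>Up to constant factors, what the line \<open>x = y + c * t\<close> contributes to the crossing when it belongs to a
steep strip of slope \<open>c\<close> (\<open>slope_diff_le_sinsq\<close>).\<close>

definition cross :: "real \<Rightarrow> real \<Rightarrow> real" where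
  "cross c y = (\<Sum>j\<in>steep. (c - slope j)\<^sup>2 * measure lborel {t \<in> {-win..win}. (y + c * t, t) \<in> P j})"

text \<open>Mass passes from one side of a moving point to the other only in intervals of different speed.
Where the relative speed is at least \<open>e\<close>, speed is at most squared speed divided by \<open>e\<close>, so the
passage is bounded by \<open>cross c y / e\<close>.  An interval with relative speed below \<open>e\<close> can pass only with
mass that lies within distance \<open>2 * win * e\<close> of the point at time \<open>t1\<close>, and there is little such
mass by near-tiling.\<close>

lemma left_mass_along_line:
  assumes t: "-win \<le> t1" "t1 \<le> t2" "t2 \<le> win" and e: "0 < e" "e \<le> 1/4" and y: "\<bar>y + c * t1\<bar> \<le> win/2"
    and o: "slice_dev t1 \<le> ennreal d" "d \<ge> 0"
  shows "\<bar>left_mass t2 (y + c * t2) - left_mass t1 (y + c * t1)\<bar> \<le> cross c y / e + 4 * win * e + d"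
proof -
  define h where "h = 2 * win * e"
  let ?K = "\<lambda>j u. clamp (lo j) (hi j) u"
  have each: "\<bar>?K j (y + c * t2 - slope j * t2) - ?K j (y + c * t1 - slope j * t1)\<bar> \<le>
     (c - slope j)\<^sup>2 * measure lborel {t \<in> {-win..win}. (y + c * t, t) \<in> P j} / e +
     (?K j (y + c * t1 + h - slope j * t1) - ?K j (y + c * t1 - h - slope j * t1))" (is "?l \<le> ?r1 + ?r2") if j: "j \<in> steep" for j
  proof (cases "\<bar>c - slope j\<bar> < e")
    case True
    have "\<bar>(c - slope j) * (t2 - t1)\<bar> \<le> e * (2 * win)"
      unfolding abs_mult using True t e by (intro mult_mono) auto
    then have "\<bar>(c - slope j) * t2 - (c - slope j) * t1\<bar> \<le> h" by (simp add: h_def right_diff_distrib)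
    then have b: "y + c * t1 - h - slope j * t1 \<le> y + c * t2 - slope j * t2" "y + c * t2 - slope j * t2 \<le> y + c * t1 + h - slope j * t1"
      by (simp_all add: algebra_simps abs_le_iff)
    have h0: "h \<ge> 0" using e by (simp add: h_def)
    have "?l \<le> ?r2"
      using clamp_mono[OF b(1), of "lo j" "hi j"] clamp_mono[OF b(2), of "lo j" "hi j"]
        clamp_mono[of "y + c * t1 - slope j * t1" "y + c * t1 + h - slope j * t1" "lo j" "hi j"]
        clamp_mono[of "y + c * t1 - h - slope j * t1" "y + c * t1 - slope j * t1" "lo j" "hi j"] h0 by linarith
    moreover have "?r1 \<ge> 0" using e by simp
    ultimately show ?thesis by linarith
  next
    case False
    have eq: "{t \<in> {t1..t2}. lo j \<le> y + (c - slope j) * t \<and> y + (c - slope j) * t \<le> hi j} = {t \<in> {t1..t2}. (y + c * t, t) \<in> P j}"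
      using P_steep[OF j] by (auto simp: algebra_simps)
    have sub: "measure lborel {t \<in> {t1..t2}. (y + c * t, t) \<in> P j} \<le> measure lborel {t \<in> {-win..win}. (y + c * t, t) \<in> P j}" (is "?M1 \<le> ?M2")
    proof (rule measure_mono_fmeasurable)
      show "{t \<in> {t1..t2}. (y + c * t, t) \<in> P j} \<in> sets lborel" by measurable
      have "{t \<in> {-win..win}. (y + c * t, t) \<in> P j} \<in> sets lborel" by measurable
      then show "{t \<in> {-win..win}. (y + c * t, t) \<in> P j} \<in> fmeasurable lborel"
      proof (rule fmeasurableI)
        have "emeasure lborel {t \<in> {-win..win}. (y + c * t, t) \<in> P j} = ennreal (measure lborel {t \<in> {-win..win}. (y + c * t, t) \<in> P j})"
          by (rule emeasure_bounded_real[of _ win]) auto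
        then show "emeasure lborel {t \<in> {-win..win}. (y + c * t, t) \<in> P j} < \<infinity>" by (metis ennreal_less_top infinity_ennreal_def)
      qed
    qed (use t in auto)
    have "?l = \<bar>?K j (y + (c - slope j) * t2) - ?K j (y + (c - slope j) * t1)\<bar>" by (simp add: algebra_simps)
    also have "\<dots> \<le> \<bar>c - slope j\<bar> * ?M1" using clamp_line[OF t(2), of "lo j" "hi j" y "c - slope j"] unfolding eq .
    also have "\<dots> \<le> \<bar>c - slope j\<bar> * ?M2" using sub by (intro mult_left_mono) auto
    also have "\<dots> \<le> (\<bar>c - slope j\<bar> * (\<bar>c - slope j\<bar> / e)) * ?M2"
    proof (rule mult_right_mono)
      have "1 \<le> \<bar>c - slope j\<bar> / e" using False e by (simp add: pos_le_divide_eq)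
      then show "\<bar>c - slope j\<bar> \<le> \<bar>c - slope j\<bar> * (\<bar>c - slope j\<bar> / e)"
        using mult_left_mono[of 1 "\<bar>c - slope j\<bar> / e" "\<bar>c - slope j\<bar>"] by simp
    qed simp
    also have "\<dots> = ?r1" by (simp add: power2_eq_square)
    finally have "?l \<le> ?r1" .
    moreover have "?r2 \<ge> 0" using clamp_mono[of "y + c * t1 - h - slope j * t1" "y + c * t1 + h - slope j * t1" "lo j" "hi j"] e by (simp add: h_def)
    ultimately show ?thesis by linarith
  qed
  have "\<bar>left_mass t2 (y + c * t2) - left_mass t1 (y + c * t1)\<bar> \<le> (\<Sum>j\<in>steep. \<bar>?K j (y + c * t2 - slope j * t2) - ?K j (y + c * t1 - slope j * t1)\<bar>)"
    unfolding left_mass_def sum_subtractf[symmetric] by (rule sum_abs)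
  also have "\<dots> \<le> (\<Sum>j\<in>steep. (c - slope j)\<^sup>2 * measure lborel {t \<in> {-win..win}. (y + c * t, t) \<in> P j} / e +
     (?K j (y + c * t1 + h - slope j * t1) - ?K j (y + c * t1 - h - slope j * t1)))"
    by (intro sum_mono each)
  also have "\<dots> = cross c y / e + (left_mass t1 (y + c * t1 + h) - left_mass t1 (y + c * t1 - h))"
    by (simp add: sum.distrib sum_subtractf cross_def left_mass_def sum_divide_distrib)
  also have "left_mass t1 (y + c * t1 + h) - left_mass t1 (y + c * t1 - h) \<le> 2 * h + d"
  proof -
    have "h \<le> win / 2" "h \<ge> 0" using e by (simp_all add: h_def)
    then have "\<bar>left_mass t1 (y + c * t1 + h) - left_mass t1 (y + c * t1 - h) - (y + c * t1 + h - (y + c * t1 - h))\<bar> \<le> d"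
      by (intro left_mass_spread o) (use y in linarith)+
    then show ?thesis by linarith
  qed
  finally show ?thesis by (simp add: h_def)
qed

section \<open>Little crossing forces a common speed\<close>


lemma slice_borel [measurable]: "{t. (y + c * t, t) \<in> P j} \<in> sets borel" "{t. (x, t) \<in> P j} \<in> sets borel"
  by measurable

text \<open>A flat strip that meets the small square continues through the nearby vertical line, in a chord as
long as any of its vertical chords in the square.\<close>

lemma flat_area:
  assumes j: "j \<in> I" and q: "\<bar>q j\<bar> \<ge> 1/10" and x0: "\<bar>x0\<bar> \<le> 1/800"
  shows "emeasure lborel (P j \<inter> square win) \<le> ennreal (2 * win) * emeasure lborel {t \<in> {-1/8..1/8}. (x0, t) \<in> P j}"
proof -
  let ?L = "{t \<in> {-1/8..1/8}. (x0, t) \<in> P j}"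
  have Lm [measurable]: "?L \<in> sets borel" by measurable
  have "(p j)\<^sup>2 \<le> 1" using unit[OF j] zero_le_power2[of "q j"] by linarith
  then have p1: "\<bar>p j\<bar> \<le> 1" by (simp add: abs_square_le_1)
  have "emeasure lborel (P j \<inter> square win) = (\<integral>\<^sup>+y. indicator (P j \<inter> square win) y \<partial>lborel)" by simp
  also have "\<dots> = (\<integral>\<^sup>+x. (\<integral>\<^sup>+t. indicator (P j \<inter> square win) (x, t) \<partial>lborel) \<partial>lborel)"
    by (rule nn_integral_lborel_plane(1)) simp
  also have "\<dots> \<le> (\<integral>\<^sup>+x. emeasure lborel ?L * indicator {-win..win} x \<partial>lborel)"
  proof (rule nn_integral_mono)
    fix x :: real
    show "(\<integral>\<^sup>+t. indicator (P j \<inter> square win) (x, t) \<partial>lborel) \<le> emeasure lborel ?L * indicator {-win..win} x"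
    proof (cases "x \<in> {-win..win}")
      case False
      then have "indicator (P j \<inter> square win) (x, t) = (0::ennreal)" for t by (auto simp: square_def)
      then show ?thesis by simp
    next
      case True
      define \<tau> where "\<tau> = p j * (x - x0) / q j"
      have q0: "q j \<noteq> 0" using q by auto
      have xx: "\<bar>x - x0\<bar> \<le> 1/160" using True x0 unfolding atLeastAtMost_iff by linarith
      have "\<bar>\<tau>\<bar> = \<bar>p j\<bar> * \<bar>x - x0\<bar> / \<bar>q j\<bar>" by (simp add: \<tau>_def abs_mult)
      also have "\<dots> \<le> (1 * (1/160)) / (1/10)"
        using xx q p1 by (intro frac_le mult_mono) auto
      finally have \<tau>: "\<bar>\<tau>\<bar> \<le> 1/16" by simp
      have "(\<integral>\<^sup>+t. indicator (P j \<inter> square win) (x, t) \<partial>lborel) \<le> (\<integral>\<^sup>+t. indicator ?L (\<tau> + t) \<partial>lborel)"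
      proof (rule nn_integral_mono)
        fix t
        show "indicator (P j \<inter> square win) (x, t) \<le> (indicator ?L (\<tau> + t) :: ennreal)"
        proof (cases "(x, t) \<in> P j \<inter> square win")
          case in1: True
          have "q j * \<tau> = p j * (x - x0)" using q0 by (simp add: \<tau>_def)
          then have "p j * x0 + q j * (\<tau> + t) = p j * x + q j * t" by (simp add: algebra_simps)
          then have "(x0, \<tau> + t) \<in> P j" using in1 by (simp add: P_def strip_def)
          moreover have "\<bar>t\<bar> \<le> 1/200" using in1 by (auto simp: square_def)
          then have "\<tau> + t \<in> {-1/8..1/8}" using \<tau> by (auto simp: abs_le_iff)
          ultimately show ?thesis using in1 by simp
        qed simp
      qed
      also have "\<dots> = (\<integral>\<^sup>+t. indicator ?L t \<partial>lborel)"
        by (rule nn_integral_lborel_translate) simp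
      also have "\<dots> = emeasure lborel ?L" by simp
      finally show ?thesis using True by simp
    qed
  qed
  also have "\<dots> = emeasure lborel ?L * ennreal (2 * win)"
    by (subst nn_integral_cmult_indicator) auto
  finally show ?thesis by (simp add: mult.commute)
qed

text \<open>Discarding the flat strips changes the multiplicity by at most their area.\<close>

lemma slice_dev_total:
  "(\<integral>\<^sup>+t. slice_dev t * indicator {-win..win} t \<partial>lborel) \<le> emeasure deviation (square win) + (\<Sum>j\<in>I - steep. emeasure lborel (P j \<inter> square win))"
proof -
  have "(\<integral>\<^sup>+t. slice_dev t * indicator {-win..win} t \<partial>lborel) =
     (\<integral>\<^sup>+t. (\<integral>\<^sup>+x. ennreal \<bar>steep_mult (x, t) - 1\<bar> * indicator (square win) (x, t) \<partial>lborel) \<partial>lborel)"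
    unfolding slice_dev_def
  proof (intro nn_integral_cong)
    fix t
    show "(\<integral>\<^sup>+x. ennreal \<bar>steep_mult (x, t) - 1\<bar> * indicator {-win..win} x \<partial>lborel) * indicator {-win..win} t =
        (\<integral>\<^sup>+x. ennreal \<bar>steep_mult (x, t) - 1\<bar> * indicator (square win) (x, t) \<partial>lborel)"
      by (subst nn_integral_multc[symmetric]) (auto intro!: nn_integral_cong simp: square_def split: split_indicator)
  qed
  also have "\<dots> = (\<integral>\<^sup>+y. ennreal \<bar>steep_mult y - 1\<bar> * indicator (square win) y \<partial>lborel)"
    by (rule nn_integral_lborel_plane(2)[symmetric]) measurable
  also have "\<dots> \<le> (\<integral>\<^sup>+y. ennreal \<bar>m y - 1\<bar> * indicator (square win) y + (\<Sum>j\<in>I - steep. indicator (P j \<inter> square win) y) \<partial>lborel)"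
  proof (rule nn_integral_mono)
    fix y
    have "m y = steep_mult y + (\<Sum>j\<in>I - steep. indicator (P j) y)"
      unfolding m_def steep_mult_def using fin by (subst sum.subset_diff[of steep I]) (auto simp: steep_def)
    then have "\<bar>steep_mult y - 1\<bar> \<le> \<bar>m y - 1\<bar> + (\<Sum>j\<in>I - steep. indicator (P j) y)"
      using sum_nonneg[of "I - steep" "\<lambda>j. indicator (P j) y :: real"] by simp
    then have "ennreal \<bar>steep_mult y - 1\<bar> \<le> ennreal (\<bar>m y - 1\<bar> + (\<Sum>j\<in>I - steep. indicator (P j) y))" by (rule ennreal_leI)
    also have "\<dots> = ennreal \<bar>m y - 1\<bar> + (\<Sum>j\<in>I - steep. ennreal (indicator (P j) y))"
      by (subst ennreal_plus) (auto simp: sum_nonneg)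
    finally show "ennreal \<bar>steep_mult y - 1\<bar> * indicator (square win) y \<le>
       ennreal \<bar>m y - 1\<bar> * indicator (square win) y + (\<Sum>j\<in>I - steep. indicator (P j \<inter> square win) y)"
      by (cases "y \<in> square win") (auto simp: indicator_inter_arith ennreal_indicator)
  qed
  also have "\<dots> = emeasure deviation (square win) + (\<Sum>j\<in>I - steep. emeasure lborel (P j \<inter> square win))"
    by (subst nn_integral_add) (auto simp: emeasure_deviation nn_integral_sum)
  finally show ?thesis .
qed

lemma slice_dev_measurable [measurable]: "slice_dev \<in> borel_measurable borel"
proof -
  have "(\<lambda>(t, x). ennreal \<bar>steep_mult (x, t) - 1\<bar> * indicator {-win..win} x) \<in> borel_measurable (borel \<Otimes>\<^sub>M lborel)"
    by measurable
  then show ?thesis unfolding slice_dev_def[abs_def]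
    by (rule lborel.borel_measurable_nn_integral)
qed

lemma good_time:
  assumes tot: "(\<integral>\<^sup>+t. slice_dev t * indicator {-win..win} t \<partial>lborel) \<le> ennreal d" and d: "d > 0"
    and sub: "{t1..t1 + win/2} \<subseteq> {-win..win}"
  shows "\<exists>t\<in>{t1..t1 + win/2}. slice_dev t \<le> ennreal (4 * d / win)"
proof (rule ccontr)
  assume *: "\<not> ?thesis"
  have big: "slice_dev t \<ge> ennreal (4 * d / win)" if "t \<in> {t1..t1 + win/2}" for t
    using * that by (meson linorder_le_cases)
  have "ennreal (4 * d / win) * ennreal (win / 2) = (\<integral>\<^sup>+t. ennreal (4 * d / win) * indicator {t1..t1 + win/2} t \<partial>lborel)"
    by (subst nn_integral_cmult_indicator) auto
  also have "\<dots> \<le> (\<integral>\<^sup>+t. slice_dev t * indicator {-win..win} t \<partial>lborel)"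
    using big sub by (intro nn_integral_mono) (auto split: split_indicator)
  also have "\<dots> \<le> ennreal d" by (rule tot)
  finally have "ennreal (4 * d / win * (win / 2)) \<le> ennreal d" by (subst ennreal_mult) (use d in auto)
  then show False using d by (subst (asm) ennreal_le_iff) auto
qed

text \<open>Compare the vertical line \<open>x = x0\<close> with the line of speed \<open>c\<close> at two times \<open>t1\<close> and \<open>t2\<close> at which the
strips nearly tile the slice and which are at least \<open>win\<close> apart.  Along both lines the left mass
is nearly constant, and the difference of the two left masses is nearly the distance of the lines.
So this distance hardly changes, although it changes by \<open>c * (t2 - t1)\<close>.\<close>

lemma speed_bound:
  assumes tot: "(\<integral>\<^sup>+t. slice_dev t * indicator {-win..win} t \<partial>lborel) \<le> ennreal d" and d: "d > 0"
    and e: "0 < e" "e \<le> 1/4" and x0: "\<bar>x0\<bar> \<le> win/2" "cross 0 x0 \<le> e\<^sup>2"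
    and y: "\<And>t. \<bar>t\<bar> \<le> win \<Longrightarrow> \<bar>y + c * t\<bar> \<le> win/2" "cross c y \<le> e\<^sup>2"
  shows "\<bar>c\<bar> * win \<le> 3 * e + 16 * d / win"
proof -
  obtain t1 where t1: "t1 \<in> {-win..-win + win/2}" "slice_dev t1 \<le> ennreal (4 * d / win)"
    using good_time[OF tot d, of "-win"] by auto
  obtain t2 where t2: "t2 \<in> {win/2..win/2 + win/2}" "slice_dev t2 \<le> ennreal (4 * d / win)"
    using good_time[OF tot d, of "win/2"] by auto
  define o' where "o' = 4 * d / win"
  have o0: "o' \<ge> 0" using d by (simp add: o'_def)
  have tt: "-win \<le> t1" "t1 \<le> t2" "t2 \<le> win" "t2 - t1 \<ge> win" "\<bar>t1\<bar> \<le> win" "\<bar>t2\<bar> \<le> win" using t1 t2 by auto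
  have dv: "a / e \<le> e" if "a \<le> e\<^sup>2" for a using that e by (simp add: pos_divide_le_eq power2_eq_square)
  have "\<bar>left_mass t2 (y + c * t2) - left_mass t1 (y + c * t1)\<bar> \<le> cross c y / e + 4 * win * e + o'"
    using t1(2) o0 unfolding o'_def[symmetric] by (intro left_mass_along_line tt e y) auto
  then have A: "\<bar>left_mass t2 (y + c * t2) - left_mass t1 (y + c * t1)\<bar> \<le> e + 4 * win * e + o'" using dv[OF y(2)] by linarith
  have "\<bar>left_mass t2 (x0 + 0 * t2) - left_mass t1 (x0 + 0 * t1)\<bar> \<le> cross 0 x0 / e + 4 * win * e + o'"
    using t1(2) o0 x0 unfolding o'_def[symmetric] by (intro left_mass_along_line tt e) auto
  then have B: "\<bar>left_mass t2 x0 - left_mass t1 x0\<bar> \<le> e + 4 * win * e + o'" using dv[OF x0(2)] by simp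
  have sp: "\<bar>left_mass t x' - left_mass t x - (x' - x)\<bar> \<le> o'" if "\<bar>x\<bar> \<le> win/2" "\<bar>x'\<bar> \<le> win/2" "slice_dev t \<le> ennreal o'" for x x' t
  proof (cases "x \<le> x'")
    case True
    show ?thesis by (rule left_mass_spread[OF _ True _ that(3) o0]) (use that in linarith)+
  next
    case False
    have "\<bar>left_mass t x - left_mass t x' - (x - x')\<bar> \<le> o'"
      by (rule left_mass_spread[OF _ _ _ that(3) o0]) (use that False in linarith)+
    then show ?thesis by linarith
  qed
  have C: "\<bar>left_mass t1 (y + c * t1) - left_mass t1 x0 - (y + c * t1 - x0)\<bar> \<le> o'"
    by (rule sp) (use y(1)[OF tt(5)] x0 t1 in \<open>auto simp: o'_def\<close>)
  have D: "\<bar>left_mass t2 (y + c * t2) - left_mass t2 x0 - (y + c * t2 - x0)\<bar> \<le> o'"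
    by (rule sp) (use y(1)[OF tt(6)] x0 t2 in \<open>auto simp: o'_def\<close>)
  have "\<bar>c * t2 - c * t1\<bar> \<le> 2 * e + 8 * win * e + 4 * o'"
    using A B C D unfolding abs_le_iff by linarith
  also have "\<dots> \<le> 3 * e + 4 * o'" using e by simp
  finally have "\<bar>c\<bar> * (t2 - t1) \<le> 3 * e + 4 * o'"
    using tt(2) by (simp add: right_diff_distrib[symmetric] abs_mult)
  moreover have "\<bar>c\<bar> * win \<le> \<bar>c\<bar> * (t2 - t1)" using tt by (intro mult_left_mono) auto
  ultimately show ?thesis by (simp add: o'_def)
qed

text \<open>The lines \<open>x = u + slope i * t\<close> with \<open>u\<close> in \<open>{lo i..hi i}\<close> foliate strip \<open>i\<close>.  If each of them that stays close to the centre is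
crossed by more than \<open>e\<^sup>2\<close>, integration over \<open>u\<close> bounds the area of the strip by its share of the crossing.\<close>

lemma tilted_area:
  assumes i: "i \<in> steep" and e: "e > 0"
    and big: "\<And>y. (\<And>t. \<bar>t\<bar> \<le> win \<Longrightarrow> \<bar>y + slope i * t\<bar> \<le> win/2) \<Longrightarrow> cross (slope i) y > e\<^sup>2"
  shows "e\<^sup>2 * measure lborel (P i \<inter> square (1/800)) \<le> (\<Sum>j\<in>I. sinsq i j * measure lborel (P i \<inter> P j \<inter> cball 0 (1/4)))"
proof -
  let ?s = "1/800 :: real"
  define U where "U = {lo i..hi i} \<inter> {-(3/2000)..3/2000}"
  have Um [measurable]: "U \<in> sets borel" by (simp add: U_def)
  have vi: "\<bar>slope i\<bar> \<le> 102/1000" using steep_slope[OF i] by simp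
  have "emeasure lborel (P i \<inter> square ?s) = (\<integral>\<^sup>+y. indicator (P i \<inter> square ?s) y \<partial>lborel)" by simp
  also have "\<dots> = (\<integral>\<^sup>+t. (\<integral>\<^sup>+u. indicator (P i \<inter> square ?s) (u + slope i * t, t) \<partial>lborel) \<partial>lborel)"
    by (rule nn_integral_shear(2)) simp
  also have "\<dots> \<le> (\<integral>\<^sup>+t. emeasure lborel U * indicator {-?s..?s} t \<partial>lborel)"
  proof (rule nn_integral_mono)
    fix t :: real
    have "(\<integral>\<^sup>+u. indicator (P i \<inter> square ?s) (u + slope i * t, t) \<partial>lborel) \<le> (\<integral>\<^sup>+u. indicator U u * indicator {-?s..?s} t \<partial>lborel)"
    proof (rule nn_integral_mono)
      fix u
      show "indicator (P i \<inter> square ?s) (u + slope i * t, t) \<le> (indicator U u * indicator {-?s..?s} t :: ennreal)"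
      proof (cases "(u + slope i * t, t) \<in> P i \<inter> square ?s")
        case True
        then have tm: "t \<in> {-?s..?s}" "u + slope i * t \<in> {-?s..?s}" by (simp_all add: square_def)
        have t: "\<bar>t\<bar> \<le> ?s" "\<bar>u + slope i * t\<bar> \<le> ?s" using tm unfolding atLeastAtMost_iff by linarith+
        have "\<bar>slope i * t\<bar> \<le> (102/1000) * (1/800)" unfolding abs_mult using vi t by (intro mult_mono) auto
        then have "\<bar>u\<bar> \<le> 3/2000" using t by linarith
        moreover have "lo i \<le> u" "u \<le> hi i" using True P_steep[OF i] by auto
        ultimately have "u \<in> U" by (auto simp: U_def)
        then show ?thesis using tm(1) True by simp
      qed simp
    qed
    also have "\<dots> = emeasure lborel U * indicator {-?s..?s} t" by (subst nn_integral_multc) auto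
    finally show "(\<integral>\<^sup>+u. indicator (P i \<inter> square ?s) (u + slope i * t, t) \<partial>lborel) \<le> emeasure lborel U * indicator {-?s..?s} t" .
  qed
  also have "\<dots> = emeasure lborel U * ennreal (1/400)"
    by (subst nn_integral_cmult_indicator) auto
  finally have 1: "emeasure lborel (P i \<inter> square ?s) \<le> emeasure lborel U * ennreal (1/400)" .
  have inB: "(u + slope i * t, t) \<in> P i \<inter> cball 0 (1/4) \<and> \<bar>u + slope i * t\<bar> \<le> win / 2" if "u \<in> U" "t \<in> {-win..win}" for u t
  proof -
    have t: "\<bar>t\<bar> \<le> win" using that(2) unfolding atLeastAtMost_iff by linarith
    have "u \<in> {-(3/2000)..3/2000}" using that by (simp add: U_def)
    then have u: "\<bar>u\<bar> \<le> 3/2000" unfolding atLeastAtMost_iff by linarith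
    have "\<bar>slope i * t\<bar> \<le> (102/1000) * win" unfolding abs_mult using vi t by (intro mult_mono) auto
    then have b: "\<bar>u + slope i * t\<bar> \<le> win / 2" using u by linarith
    then have "u + slope i * t \<in> {-win..win}" unfolding atLeastAtMost_iff by linarith
    then have "(u + slope i * t, t) \<in> square win" using that(2) by (simp add: square_def)
    moreover have "sqrt 2 * win \<le> 1/4" using real_sqrt_le_mono[of 2 4] by simp
    ultimately have "(u + slope i * t, t) \<in> cball 0 (1/4)" using square_subset_cball by blast
    then show ?thesis using that P_steep[OF i] b by (auto simp: U_def)
  qed
  let ?T = "\<lambda>j u. {t \<in> {-win..win}. (u + slope i * t, t) \<in> P j}"
  have "ennreal (e\<^sup>2) * emeasure lborel U = (\<integral>\<^sup>+u. ennreal (e\<^sup>2) * indicator U u \<partial>lborel)"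
    by (subst nn_integral_cmult_indicator) auto
  also have "\<dots> \<le> (\<integral>\<^sup>+u. (\<Sum>j\<in>steep. ennreal ((slope i - slope j)\<^sup>2) * (\<integral>\<^sup>+t. indicator U u * indicator (?T j u) t \<partial>lborel)) \<partial>lborel)"
  proof (rule nn_integral_mono)
    fix u
    show "ennreal (e\<^sup>2) * indicator U u \<le> (\<Sum>j\<in>steep. ennreal ((slope i - slope j)\<^sup>2) * (\<integral>\<^sup>+t. indicator U u * indicator (?T j u) t \<partial>lborel))"
    proof (cases "u \<in> U")
      case True
      have "e\<^sup>2 < cross (slope i) u"
      proof (rule big)
        fix t assume "\<bar>t\<bar> \<le> win"
        then have "t \<in> {-win..win}" unfolding atLeastAtMost_iff by linarith
        then show "\<bar>u + slope i * t\<bar> \<le> win/2" using inB True by blast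
      qed
      then have "ennreal (e\<^sup>2) \<le> ennreal (cross (slope i) u)" by (intro ennreal_leI) simp
      also have "\<dots> = (\<Sum>j\<in>steep. ennreal ((slope i - slope j)\<^sup>2) * ennreal (measure lborel (?T j u)))"
        unfolding cross_def by (simp add: ennreal_mult[symmetric])
      also have "\<dots> = (\<Sum>j\<in>steep. ennreal ((slope i - slope j)\<^sup>2) * emeasure lborel (?T j u))"
        using emeasure_bounded_real[of "?T _ u" win] by (intro sum.cong refl) (subst emeasure_bounded_real[of _ win], auto)
      also have "\<dots> = (\<Sum>j\<in>steep. ennreal ((slope i - slope j)\<^sup>2) * (\<integral>\<^sup>+t. indicator U u * indicator (?T j u) t \<partial>lborel))"
        using True by (intro sum.cong refl arg_cong2[where f="(*)"]) simp
      finally show ?thesis using True by simp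
    qed simp
  qed
  also have "\<dots> = (\<Sum>j\<in>steep. ennreal ((slope i - slope j)\<^sup>2) * (\<integral>\<^sup>+u. (\<integral>\<^sup>+t. indicator U u * indicator (?T j u) t \<partial>lborel) \<partial>lborel))"
  proof -
    have [measurable]: "(\<lambda>u. \<integral>\<^sup>+t. indicator U u * indicator (?T j u) t \<partial>lborel) \<in> borel_measurable lborel" for j
    proof -
      have "(\<lambda>(u, t). (u + slope i * t, t)) \<in> borel_measurable (borel :: (real \<times> real) measure)"
        unfolding split_beta by (intro borel_measurable_continuous_onI continuous_intros)
      then have [measurable]: "(\<lambda>(u, t). (u + slope i * t, t)) \<in> (borel :: real measure) \<Otimes>\<^sub>M (borel :: real measure) \<rightarrow>\<^sub>M borel" 
        by (simp add: borel_prod)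
      have "(\<lambda>(u, t). indicator U u * (indicator {-win..win} t * indicator (P j) (case (u, t) of (u, t) \<Rightarrow> (u + slope i * t, t))) :: ennreal) \<in> borel_measurable (borel \<Otimes>\<^sub>M lborel)"
        by measurable
      from lborel.borel_measurable_nn_integral[OF this]
      have "(\<lambda>u. \<integral>\<^sup>+t. indicator U u * (indicator {-win..win} t * indicator (P j) (u + slope i * t, t)) \<partial>lborel) \<in> borel_measurable borel"
        by simp
      moreover have "indicator U u * (indicator {-win..win} t * indicator (P j) (u + slope i * t, t)) = (indicator U u * indicator (?T j u) t :: ennreal)" for u t
        by (auto split: split_indicator)
      ultimately show ?thesis by simp
    qed
    show ?thesis by (simp add: nn_integral_sum nn_integral_cmult)
  qed
  also have "\<dots> \<le> (\<Sum>j\<in>steep. ennreal (2 * sinsq i j) * emeasure lborel (P i \<inter> P j \<inter> cball 0 (1/4)))"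
  proof (intro sum_mono mult_mono)
    fix j assume j: "j \<in> steep"
    show "ennreal ((slope i - slope j)\<^sup>2) \<le> ennreal (2 * sinsq i j)" by (intro ennreal_leI slope_diff_le_sinsq i j)
    have "emeasure lborel (P i \<inter> P j \<inter> cball 0 (1/4)) = (\<integral>\<^sup>+y. indicator (P i \<inter> P j \<inter> cball 0 (1/4)) y \<partial>lborel)" by simp
    also have "\<dots> = (\<integral>\<^sup>+u. (\<integral>\<^sup>+t. indicator (P i \<inter> P j \<inter> cball 0 (1/4)) (u + slope i * t, t) \<partial>lborel) \<partial>lborel)"
    proof (rule nn_integral_shear(1))
      have "P i \<inter> P j \<inter> cball 0 (1/4) \<in> sets borel" by (intro sets.Int) auto
      then show "indicator (P i \<inter> P j \<inter> cball 0 (1/4)) \<in> borel_measurable borel" by (rule borel_measurable_indicator)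
    qed
    finally have eq: "emeasure lborel (P i \<inter> P j \<inter> cball 0 (1/4)) = (\<integral>\<^sup>+u. (\<integral>\<^sup>+t. indicator (P i \<inter> P j \<inter> cball 0 (1/4)) (u + slope i * t, t) \<partial>lborel) \<partial>lborel)" .
    show "(\<integral>\<^sup>+u. (\<integral>\<^sup>+t. indicator U u * indicator (?T j u) t \<partial>lborel) \<partial>lborel) \<le> emeasure lborel (P i \<inter> P j \<inter> cball 0 (1/4))"
      unfolding eq using inB by (intro nn_integral_mono) (simp split: split_indicator)
  qed auto
  also have "\<dots> = ennreal (\<Sum>j\<in>steep. 2 * sinsq i j * measure lborel (P i \<inter> P j \<inter> cball 0 (1/4)))"
  proof -
    have "emeasure lborel (P i \<inter> P j \<inter> cball 0 (1/4)) = ennreal (measure lborel (P i \<inter> P j \<inter> cball 0 (1/4)))" for j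
      using emeasure_P_Int[of "P j \<inter> cball 0 (1/4)" i] by (simp add: Int_assoc bounded_Int)
    then show ?thesis by (simp add: ennreal_mult[symmetric] sinsq_nonneg sum_nonneg)
  qed
  finally have 2: "ennreal (e\<^sup>2) * emeasure lborel U \<le> ennreal (\<Sum>j\<in>steep. 2 * sinsq i j * measure lborel (P i \<inter> P j \<inter> cball 0 (1/4)))" .
  have "ennreal (e\<^sup>2 * measure lborel (P i \<inter> square ?s)) = ennreal (e\<^sup>2) * emeasure lborel (P i \<inter> square ?s)"
    by (simp add: ennreal_mult emeasure_P_Int)
  also have "\<dots> \<le> ennreal (e\<^sup>2) * (emeasure lborel U * ennreal (1/400))" using 1 by (rule mult_left_mono) simp
  also have "\<dots> = (ennreal (e\<^sup>2) * emeasure lborel U) * ennreal (1/400)" by (simp add: mult.assoc)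
  also have "\<dots> \<le> ennreal (\<Sum>j\<in>steep. 2 * sinsq i j * measure lborel (P i \<inter> P j \<inter> cball 0 (1/4))) * ennreal (1/400)"
    using 2 by (rule mult_right_mono) simp
  also have "\<dots> = ennreal ((\<Sum>j\<in>steep. 2 * sinsq i j * measure lborel (P i \<inter> P j \<inter> cball 0 (1/4))) * (1/400))"
    by (rule ennreal_mult[symmetric]) (auto intro!: sum_nonneg mult_nonneg_nonneg sinsq_nonneg)
  finally have "e\<^sup>2 * measure lborel (P i \<inter> square ?s) \<le> (\<Sum>j\<in>steep. 2 * sinsq i j * measure lborel (P i \<inter> P j \<inter> cball 0 (1/4))) * (1/400)"
    by (subst (asm) ennreal_le_iff) (auto intro!: sum_nonneg mult_nonneg_nonneg sinsq_nonneg)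
  also have "\<dots> \<le> (\<Sum>j\<in>steep. sinsq i j * measure lborel (P i \<inter> P j \<inter> cball 0 (1/4)))"
    by (simp add: sum_distrib_right) (intro sum_mono, simp add: sinsq_nonneg)
  also have "\<dots> \<le> (\<Sum>j\<in>I. sinsq i j * measure lborel (P i \<inter> P j \<inter> cball 0 (1/4)))"
    using fin by (intro sum_mono2) (auto simp: steep_def sinsq_nonneg)
  finally show ?thesis .
qed

section \<open>Near-tilings have a common direction\<close>


text \<open>Here the vertical line \<open>x = x0\<close> is hardly crossed, as assumption \<open>E\<close> says.  The flat strips have small area because
each of them crosses this line with a weight bounded below, and a steep strip with \<open>|q i| \<ge> \<kappa>\<close>
contains no hardly crossed line by \<open>speed_bound\<close>, so \<open>tilted_area\<close> applies to it.\<close>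

lemma rigid_vertical:
  assumes dev: "emeasure deviation (cball 0 1) \<le> ennreal \<delta>" "\<delta> > 0"
    and crs: "emeasure crossing (cball 0 (1/4)) \<le> ennreal n" "n \<ge> 0"
    and x0: "\<bar>x0\<bar> \<le> 1/800"
    and E: "(\<Sum>j\<in>I. (q j)\<^sup>2 * measure lborel {t \<in> {-1/8..1/8}. (x0, t) \<in> P j}) \<le> \<epsilon>"
    and e: "0 < e" "e \<le> 1/4" "2 * \<epsilon> \<le> e\<^sup>2" and \<kappa>: "3 * e + 16 * (\<delta> + \<epsilon>) / win < \<kappa> * win"
  shows "(\<Sum>i\<in>{i\<in>I. \<bar>q i\<bar> \<ge> \<kappa>}. measure lborel (P i \<inter> square (1/800))) \<le> \<epsilon> + n / e\<^sup>2"
proof -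
  let ?l = "\<lambda>j. measure lborel {t \<in> {-1/8..1/8}. (x0, t) \<in> P j}"
  have lE: "emeasure lborel {t \<in> {-1/8..1/8}. (x0, t) \<in> P j} = ennreal (?l j)" for j
    by (rule emeasure_bounded_real[of _ "1/8"]) auto
  have flat: "measure lborel (P j \<inter> square win) \<le> (q j)\<^sup>2 * ?l j" if "j \<in> I - steep" for j
  proof -
    have j: "j \<in> I" "\<bar>q j\<bar> \<ge> 1/10" using that by (auto simp: steep_def)
    have "ennreal (measure lborel (P j \<inter> square win)) \<le> ennreal (2 * win) * ennreal (?l j)"
      using flat_area[OF j x0] unfolding lE by (simp add: emeasure_P_Int)
    also have "\<dots> = ennreal (2 * win * ?l j)" by (rule ennreal_mult[symmetric]) auto
    finally have "measure lborel (P j \<inter> square win) \<le> 2 * win * ?l j" by (subst (asm) ennreal_le_iff) auto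
    also have "\<dots> \<le> (q j)\<^sup>2 * ?l j"
    proof (rule mult_right_mono)
      have "(1/10)\<^sup>2 \<le> \<bar>q j\<bar>\<^sup>2" using j by (intro power_mono) auto
      then show "2 * win \<le> (q j)\<^sup>2" by (simp add: power2_eq_square)
    qed simp
    finally show ?thesis .
  qed
  have flat_sum: "(\<Sum>j\<in>I - steep. measure lborel (P j \<inter> square win)) \<le> \<epsilon>"
  proof -
    have "(\<Sum>j\<in>I - steep. measure lborel (P j \<inter> square win)) \<le> (\<Sum>j\<in>I - steep. (q j)\<^sup>2 * ?l j)"
      by (intro sum_mono flat)
    also have "\<dots> \<le> (\<Sum>j\<in>I. (q j)\<^sup>2 * ?l j)" using fin by (intro sum_mono2) auto
    finally show ?thesis using E by linarith
  qed
  have \<epsilon>0: "\<epsilon> \<ge> 0" using flat_sum sum_nonneg[of "I - steep" "\<lambda>j. measure lborel (P j \<inter> square win)"] by simp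
  have box1: "square win \<subseteq> cball 0 1" by (rule square_subset_cball) (use real_sqrt_le_mono[of 2 4] in simp)
  have tot: "(\<integral>\<^sup>+t. slice_dev t * indicator {-win..win} t \<partial>lborel) \<le> ennreal (\<delta> + \<epsilon>)"
  proof -
    have "emeasure deviation (square win) \<le> ennreal \<delta>"
      using emeasure_mono[OF box1, of deviation] dev(1) by simp
    moreover have "(\<Sum>j\<in>I - steep. emeasure lborel (P j \<inter> square win)) \<le> ennreal \<epsilon>"
      using flat_sum by (simp add: emeasure_P_Int sum_ennreal ennreal_leI)
    ultimately have "emeasure deviation (square win) + (\<Sum>j\<in>I - steep. emeasure lborel (P j \<inter> square win)) \<le> ennreal \<delta> + ennreal \<epsilon>"
      by (rule add_mono)
    also have "\<dots> = ennreal (\<delta> + \<epsilon>)" using dev \<epsilon>0 by (subst ennreal_plus) auto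
    finally show ?thesis using slice_dev_total by (rule order_trans[rotated])
  qed
  have cross0: "cross 0 x0 \<le> e\<^sup>2"
  proof -
    have "cross 0 x0 \<le> (\<Sum>j\<in>steep. 2 * ((q j)\<^sup>2 * ?l j))"
      unfolding cross_def
    proof (rule sum_mono)
      fix j assume j: "j \<in> steep"
      have "ennreal (measure lborel {t \<in> {-win..win}. (x0 + 0 * t, t) \<in> P j}) = emeasure lborel {t \<in> {-win..win}. (x0 + 0 * t, t) \<in> P j}"
        by (rule emeasure_bounded_real[of _ win, symmetric]) auto
      also have "\<dots> \<le> emeasure lborel {t \<in> {-1/8..1/8}. (x0, t) \<in> P j}"
        by (intro emeasure_mono) auto
      also have "\<dots> = ennreal (?l j)" by (rule lE)
      finally have le: "measure lborel {t \<in> {-win..win}. (x0 + 0 * t, t) \<in> P j} \<le> ?l j" by simp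
      have "(0 - slope j)\<^sup>2 * measure lborel {t \<in> {-win..win}. (x0 + 0 * t, t) \<in> P j} \<le> (2 * (q j)\<^sup>2) * ?l j"
        by (intro mult_mono le) (use steep_slope[OF j] in auto)
      then show "(0 - slope j)\<^sup>2 * measure lborel {t \<in> {-win..win}. (x0 + 0 * t, t) \<in> P j} \<le> 2 * ((q j)\<^sup>2 * ?l j)" by simp
    qed
    also have "\<dots> \<le> (\<Sum>j\<in>I. 2 * ((q j)\<^sup>2 * ?l j))" using fin by (intro sum_mono2) (auto simp: steep_def)
    also have "\<dots> = 2 * (\<Sum>j\<in>I. (q j)\<^sup>2 * ?l j)" by (rule sum_distrib_left[symmetric])
    finally show ?thesis using E e by linarith
  qed
  let ?T = "{i \<in> steep. \<bar>q i\<bar> \<ge> \<kappa>}"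
  let ?c = "\<lambda>i j. sinsq i j * measure lborel (P i \<inter> P j \<inter> cball 0 (1/4))"
  have tilt: "e\<^sup>2 * measure lborel (P i \<inter> square (1/800)) \<le> (\<Sum>j\<in>I. ?c i j)" if i: "i \<in> ?T" for i
  proof (rule tilted_area)
    show "i \<in> steep" using i by simp
    show "0 < e" by (rule e)
    fix y assume y: "\<And>t. \<bar>t\<bar> \<le> win \<Longrightarrow> \<bar>y + slope i * t\<bar> \<le> win/2"
    show "e\<^sup>2 < cross (slope i) y"
    proof (rule ccontr)
      assume "\<not> e\<^sup>2 < cross (slope i) y"
      then have "\<bar>slope i\<bar> * win \<le> 3 * e + 16 * (\<delta> + \<epsilon>) / win"
        using x0 cross0 dev(2) \<epsilon>0 by (intro speed_bound[OF tot _ e(1,2) _ _ y]) auto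
      with \<kappa> have "\<bar>slope i\<bar> < \<kappa>" by simp
      moreover have "\<bar>q i\<bar> \<le> \<bar>slope i\<bar>" using i steep_slope by simp
      ultimately show False using i by simp
    qed
  qed
  have nQ: "(\<Sum>i\<in>I. \<Sum>j\<in>I. ?c i j) \<le> n"
    using crs by (simp add: crossing_eq_sum ennreal_le_iff)
  have "e\<^sup>2 * (\<Sum>i\<in>?T. measure lborel (P i \<inter> square (1/800))) \<le> (\<Sum>i\<in>?T. \<Sum>j\<in>I. ?c i j)"
    unfolding sum_distrib_left by (intro sum_mono tilt)
  also have "\<dots> \<le> (\<Sum>i\<in>I. \<Sum>j\<in>I. ?c i j)"
    using fin by (intro sum_mono2) (auto simp: steep_def intro!: sum_nonneg mult_nonneg_nonneg sinsq_nonneg)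
  finally have t2: "(\<Sum>i\<in>?T. measure lborel (P i \<inter> square (1/800))) \<le> n / e\<^sup>2"
    using nQ e by (simp add: pos_le_divide_eq mult.commute)
  have "(\<Sum>i\<in>{i\<in>I. \<bar>q i\<bar> \<ge> \<kappa>}. measure lborel (P i \<inter> square (1/800)))
     \<le> (\<Sum>i\<in>(I - steep) \<union> ?T. measure lborel (P i \<inter> square (1/800)))"
    using fin by (intro sum_mono2) (auto simp: steep_def)
  also have "\<dots> = (\<Sum>i\<in>I - steep. measure lborel (P i \<inter> square (1/800))) + (\<Sum>i\<in>?T. measure lborel (P i \<inter> square (1/800)))"
    using fin by (intro sum.union_disjoint) auto
  also have "(\<Sum>i\<in>I - steep. measure lborel (P i \<inter> square (1/800))) \<le> (\<Sum>i\<in>I - steep. measure lborel (P i \<inter> square win))"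
  proof (rule sum_mono)
    fix i
    have "ennreal (measure lborel (P i \<inter> square (1/800))) \<le> ennreal (measure lborel (P i \<inter> square win))"
      unfolding emeasure_P_Int[symmetric, OF square_bounded square_borel]
    proof (rule emeasure_mono)
      show "P i \<inter> square (1/800) \<subseteq> P i \<inter> square win" by (auto simp: square_def)
    qed simp
    then show "measure lborel (P i \<inter> square (1/800)) \<le> measure lborel (P i \<inter> square win)" by simp
  qed
  finally show ?thesis using flat_sum t2 by linarith
qed

lemma crossing_small:
  assumes "emeasure deviation (cball 0 1) \<le> ennreal \<delta>" "\<delta> > 0" "\<delta> \<le> pi / 2500"
  shows "emeasure crossing (cball 0 (1/4)) \<le> ennreal ((40000 * pi + 2) * \<delta>)"
proof -
  have "emeasure deviation (cball 0 1) \<le> ennreal (pi / 2500)" using assms by (meson ennreal_leI order_trans)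
  then have "emeasure crossing (cball 0 (1/4)) \<le> ennreal (40000 * pi + 2) * emeasure deviation (cball 0 1)" by (rule crossing_energy)
  also have "\<dots> \<le> ennreal (40000 * pi + 2) * ennreal \<delta>" by (intro mult_left_mono assms) simp
  also have "\<dots> = ennreal ((40000 * pi + 2) * \<delta>)" by (rule ennreal_mult[symmetric]) (use assms in \<open>auto simp: add_nonneg_nonneg\<close>)
  finally show ?thesis .
qed

text \<open>Strip \<open>i\<close> is vertical and has little crossing relative to its area.  By averaging over the vertical
lines inside it, one of these lines is hardly crossed by the other strips.\<close>

lemma vertical_line:
  assumes i: "i \<in> I" "q i = 0" and s: "0 < s" "s \<le> 1/8"
    and M: "measure lborel (P i \<inter> cball 0 s) > 0" and k: "k > 0"
    and le: "(\<Sum>j\<in>I. sinsq i j * measure lborel (P i \<inter> P j \<inter> cball 0 (1/4))) \<le> k * measure lborel (P i \<inter> cball 0 s)"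
  shows "\<exists>x0. \<bar>x0\<bar> \<le> s \<and> (\<Sum>j\<in>I. (q j)\<^sup>2 * measure lborel {t \<in> {-1/8..1/8}. (x0, t) \<in> P j}) \<le> 4 * s * k"
proof (rule ccontr)
  assume neg: "\<not> ?thesis"
  let ?l = "\<lambda>j x. measure lborel {t \<in> {-1/8..1/8}. (x, t) \<in> P j}"
  have lE: "emeasure lborel {t \<in> {-1/8..1/8}. (x, t) \<in> P j} = ennreal (?l j x)" for j x
    by (rule emeasure_bounded_real[of _ "1/8"]) auto
  define U where "U = {x. a i \<le> p i * x \<and> p i * x \<le> b i} \<inter> {-s..s}"
  have Um [measurable]: "U \<in> sets borel" unfolding U_def by measurable
  have Ufin: "emeasure lborel U = ennreal (measure lborel U)" by (rule emeasure_bounded_real[of _ s]) (auto simp: U_def)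
  have p1: "(p i)\<^sup>2 = 1" using unit[OF i(1)] i(2) by simp
  have PU: "(x, t) \<in> P i \<and> \<bar>x\<bar> \<le> s \<longleftrightarrow> x \<in> U" for x t
    using i(2) by (auto simp: P_def strip_def U_def abs_le_iff)
  have sub: "P i \<inter> cball 0 s \<subseteq> U \<times> {-s..s}"
  proof
    fix y assume y: "y \<in> P i \<inter> cball 0 s"
    obtain x t where yt: "y = (x, t)" by (cases y)
    have "\<bar>x\<bar> \<le> s" "\<bar>t\<bar> \<le> s"
      using y norm_fst_le[of x t] norm_snd_le[of t x] by (auto simp: yt)
    then show "y \<in> U \<times> {-s..s}" using y PU[of x t] by (auto simp: yt abs_le_iff)
  qed
  have "ennreal (measure lborel (P i \<inter> cball 0 s)) = emeasure lborel (P i \<inter> cball 0 s)"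
    by (rule emeasure_P_Int[symmetric]) auto
  also have "\<dots> \<le> emeasure lborel (U \<times> {-s..s})" by (intro emeasure_mono sub) (simp add: borel_Times)
  also have "\<dots> = emeasure lborel U * ennreal (2 * s)"
    using s by (simp add: lborel_prod[symmetric] lborel.emeasure_pair_measure_Times)
  also have "\<dots> = ennreal (measure lborel U * (2 * s))" using s by (simp add: Ufin ennreal_mult)
  finally have MU: "measure lborel (P i \<inter> cball 0 s) \<le> measure lborel U * (2 * s)"
    using s by (subst (asm) ennreal_le_iff) auto
  then have U0: "measure lborel U > 0" using M s by (smt (verit) measure_nonneg mult_le_0_iff)
  have big: "(\<Sum>j\<in>I. (q j)\<^sup>2 * ?l j x) \<ge> 4 * s * k" if "x \<in> U" for x
  proof -
    have "\<bar>x\<bar> \<le> s" using that by (auto simp: U_def abs_le_iff)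
    with neg have "\<not> (\<Sum>j\<in>I. (q j)\<^sup>2 * ?l j x) \<le> 4 * s * k" by blast
    then show ?thesis by simp
  qed
  have "ennreal (4 * s * k) * emeasure lborel U = (\<integral>\<^sup>+x. ennreal (4 * s * k) * indicator U x \<partial>lborel)"
    by (subst nn_integral_cmult_indicator) auto
  also have "\<dots> \<le> (\<integral>\<^sup>+x. (\<Sum>j\<in>I. ennreal ((q j)\<^sup>2) * (\<integral>\<^sup>+t. indicator (P i \<inter> P j \<inter> cball 0 (1/4)) (x, t) \<partial>lborel)) \<partial>lborel)"
  proof (rule nn_integral_mono)
    fix x
    show "ennreal (4 * s * k) * indicator U x \<le> (\<Sum>j\<in>I. ennreal ((q j)\<^sup>2) * (\<integral>\<^sup>+t. indicator (P i \<inter> P j \<inter> cball 0 (1/4)) (x, t) \<partial>lborel))"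
    proof (cases "x \<in> U")
      case True
      have "ennreal (4 * s * k) \<le> ennreal (\<Sum>j\<in>I. (q j)\<^sup>2 * ?l j x)" using big[OF True] by (rule ennreal_leI)
      also have "\<dots> = (\<Sum>j\<in>I. ennreal ((q j)\<^sup>2) * emeasure lborel {t \<in> {-1/8..1/8}. (x, t) \<in> P j})"
        unfolding lE by (simp add: ennreal_mult[symmetric])
      also have "\<dots> = (\<Sum>j\<in>I. ennreal ((q j)\<^sup>2) * (\<integral>\<^sup>+t. indicator {t \<in> {-1/8..1/8}. (x, t) \<in> P j} t \<partial>lborel))"
        by simp
      also have "\<dots> \<le> (\<Sum>j\<in>I. ennreal ((q j)\<^sup>2) * (\<integral>\<^sup>+t. indicator (P i \<inter> P j \<inter> cball 0 (1/4)) (x, t) \<partial>lborel))"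
      proof (intro sum_mono mult_left_mono nn_integral_mono)
        fix j t
        show "indicator {t \<in> {-1/8..1/8}. (x, t) \<in> P j} t \<le> (indicator (P i \<inter> P j \<inter> cball 0 (1/4)) (x, t) :: ennreal)"
        proof (cases "t \<in> {t \<in> {-1/8..1/8}. (x, t) \<in> P j}")
          case in1: True
          have "x \<in> {-(1/8)..1/8}" using True s by (auto simp: U_def)
          then have "(x, t) \<in> square (1/8)" using in1 by (auto simp: square_def)
          moreover have "sqrt 2 * (1/8) \<le> 1/4" using real_sqrt_le_mono[of 2 4] by simp
          ultimately have "(x, t) \<in> cball 0 (1/4)" using square_subset_cball by blast
          then show ?thesis using in1 True PU[of x t] by simp
        qed simp
      qed simp
      finally show ?thesis using True by simp
    qed simp
  qed
  also have "\<dots> = (\<Sum>j\<in>I. ennreal ((q j)\<^sup>2) * emeasure lborel (P i \<inter> P j \<inter> cball 0 (1/4)))"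
  proof -
    have B: "P i \<inter> P j \<inter> cball 0 (1/4) \<in> sets borel" for j by (intro sets.Int) auto
    have f: "(\<lambda>y. indicator (P i \<inter> P j \<inter> cball 0 (1/4)) y :: ennreal) \<in> borel_measurable borel" for j
      using B by (rule borel_measurable_indicator)
    have [measurable]: "(\<lambda>x. \<integral>\<^sup>+t. indicator (P i \<inter> P j \<inter> cball 0 (1/4)) (x, t) \<partial>lborel) \<in> borel_measurable lborel" for j
    proof -
      have "(\<lambda>(x, t). indicator (P i \<inter> P j \<inter> cball 0 (1/4)) (x, t) :: ennreal) \<in> borel_measurable (borel \<Otimes>\<^sub>M lborel)"
        using f[of j] by (simp add: borel_prod[symmetric] split_beta')
      from lborel.borel_measurable_nn_integral[OF this] show ?thesis by simp
    qed
    show ?thesis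
      using B by (simp add: nn_integral_sum nn_integral_cmult nn_integral_lborel_plane(1)[OF f, symmetric])
  qed
  also have "\<dots> = ennreal (\<Sum>j\<in>I. sinsq i j * measure lborel (P i \<inter> P j \<inter> cball 0 (1/4)))"
  proof -
    have "emeasure lborel (P i \<inter> P j \<inter> cball 0 (1/4)) = ennreal (measure lborel (P i \<inter> P j \<inter> cball 0 (1/4)))" for j
      using emeasure_P_Int[of "P j \<inter> cball 0 (1/4)" i] by (simp add: Int_assoc bounded_Int)
    moreover have "sinsq i j = (q j)\<^sup>2" for j using i(2) p1 by (simp add: sinsq_def power_mult_distrib)
    ultimately show ?thesis by (simp add: ennreal_mult[symmetric] sum_nonneg)
  qed
  also have "\<dots> \<le> ennreal (k * (measure lborel U * (2 * s)))"
    using le MU k by (intro ennreal_leI) (meson mult_left_mono less_imp_le order_trans)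
  finally have "ennreal (4 * s * k * measure lborel U) \<le> ennreal (k * (measure lborel U * (2 * s)))"
    using s k by (simp add: Ufin ennreal_mult)
  then have "4 * s * k * measure lborel U \<le> k * (measure lborel U * (2 * s))"
    using s k by (subst (asm) ennreal_le_iff) auto
  moreover have "s * k * measure lborel U > 0" using s k U0 by simp
  ultimately show False by (simp add: mult_ac)
qed

end

text \<open>The rotation that takes the second coordinate axis to the direction \<open>(\<alpha>, \<beta>)\<close>.\<close>

abbreviation rot :: "real \<Rightarrow> real \<Rightarrow> real \<times> real \<Rightarrow> real \<times> real" where
  "rot \<alpha> \<beta> \<equiv> aff 0 \<beta> \<alpha> (- \<alpha>) \<beta>"

lemma rot_vimage_cball:
  assumes "\<alpha>\<^sup>2 + \<beta>\<^sup>2 = 1"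
  shows "rot \<alpha> \<beta> -` cball 0 r = cball 0 r"
proof -
  have "norm (rot \<alpha> \<beta> y) = norm y" for y
  proof -
    obtain x t where y: "y = (x, t)" by (cases y)
    have "(\<beta> * x + \<alpha> * t)\<^sup>2 + (- \<alpha> * x + \<beta> * t)\<^sup>2 = (\<alpha>\<^sup>2 + \<beta>\<^sup>2) * (x\<^sup>2 + t\<^sup>2)"
      by (simp add: power2_eq_square algebra_simps)
    then show ?thesis using assms by (simp add: y aff_def norm_Pair)
  qed
  then show ?thesis by (intro set_eqI) simp
qed

lemma rot_det: "\<alpha>\<^sup>2 + \<beta>\<^sup>2 = 1 \<Longrightarrow> \<beta> * \<beta> - (- \<alpha>) * \<alpha> = (1::real)"
  by (simp add: power2_eq_square)

lemma emeasure_rot_vimage: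
  assumes "\<alpha>\<^sup>2 + \<beta>\<^sup>2 = 1" "B \<in> sets borel"
  shows "emeasure lborel (rot \<alpha> \<beta> -` B) = emeasure lborel B"
  using emeasure_aff[OF assms(2), of \<beta> \<beta> "- \<alpha>" \<alpha> 0] unfolding rot_det[OF assms(1)] by simp

lemma (in strips) rotate:
  assumes ab: "\<alpha>\<^sup>2 + \<beta>\<^sup>2 = 1"
  obtains p' q' a' b' where "strips I p' q'"
    "\<And>j. j \<in> I \<Longrightarrow> p' j = p j * \<beta> - q j * \<alpha>" "\<And>j. j \<in> I \<Longrightarrow> q' j = p j * \<alpha> + q j * \<beta>"
    "\<And>j. j \<in> I \<Longrightarrow> strips.P p' q' a' b' j = rot \<alpha> \<beta> -` P j"
    "\<And>y. strips.m I p' q' a' b' y = m (rot \<alpha> \<beta> y)"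
    "\<And>B. B \<in> sets borel \<Longrightarrow> emeasure (strips.deviation I p' q' a' b') (rot \<alpha> \<beta> -` B) = emeasure deviation B"
proof -
  have det0: "\<beta> * \<beta> - (- \<alpha>) * \<alpha> \<noteq> 0" using rot_det[OF ab] by simp
  obtain p' q' a' b' nrm where pb: "strips I p' q'"
    "\<And>j. j \<in> I \<Longrightarrow> nrm j = sqrt ((p j * \<beta> + q j * (- \<alpha>))\<^sup>2 + (p j * \<alpha> + q j * \<beta>)\<^sup>2)"
    "\<And>j. j \<in> I \<Longrightarrow> nrm j > 0"
    "\<And>j. j \<in> I \<Longrightarrow> p' j = (p j * \<beta> + q j * (- \<alpha>)) / nrm j"
    "\<And>j. j \<in> I \<Longrightarrow> q' j = (p j * \<alpha> + q j * \<beta>) / nrm j"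
    "\<And>j. j \<in> I \<Longrightarrow> strips.P p' q' a' b' j = rot \<alpha> \<beta> -` P j"
    "\<And>y. strips.m I p' q' a' b' y = m (rot \<alpha> \<beta> y)"
    "\<And>B. B \<in> sets borel \<Longrightarrow> ennreal \<bar>\<beta> * \<beta> - (- \<alpha>) * \<alpha>\<bar> * emeasure (strips.deviation I p' q' a' b') (rot \<alpha> \<beta> -` B) = emeasure deviation B"
    by (rule pullback[OF det0, of 0]) (rule that)
  have nrm: "nrm j = 1" if "j \<in> I" for j
  proof -
    have "(p j * \<beta> + q j * (- \<alpha>))\<^sup>2 + (p j * \<alpha> + q j * \<beta>)\<^sup>2 = ((p j)\<^sup>2 + (q j)\<^sup>2) * (\<alpha>\<^sup>2 + \<beta>\<^sup>2)"
      by (simp add: power2_eq_square algebra_simps)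
    then show ?thesis using pb(2)[OF that] unit[OF that] ab by simp
  qed
  show thesis
    by (rule that[OF pb(1) _ _ pb(6,7)]) (use pb(4,5) nrm pb(8)[unfolded rot_det[OF ab]] in simp_all)
qed

text \<open>Strips of total area at least \<open>\<mu>\<close> near the centre share a crossing of at most \<open>n\<close>, so some strip \<open>i0\<close> has
crossing at most \<open>n / \<mu>\<close> times its area.  Its direction is the common one.\<close>

theorem (in strips) rigid_direction:
  assumes dev: "emeasure deviation (cball 0 1) \<le> ennreal \<delta>" "\<delta> > 0" "\<delta> \<le> pi / 2500" "\<delta> \<le> pi / (2 * 800\<^sup>2)"
    and e: "0 < e" "e \<le> 1/4" and \<epsilon>: "\<epsilon> = 6400 * (40000 * pi + 2) * \<delta> / pi" "2 * \<epsilon> \<le> e\<^sup>2"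
    and \<kappa>: "3 * e + 16 * (\<delta> + \<epsilon>) / win < \<kappa> * win" "\<epsilon> + (40000 * pi + 2) * \<delta> / e\<^sup>2 \<le> \<kappa>"
  shows "\<exists>\<alpha> \<beta>. \<alpha>\<^sup>2 + \<beta>\<^sup>2 = 1 \<and>
     (\<Sum>i\<in>{i\<in>I. \<bar>p i * \<alpha> + q i * \<beta>\<bar> \<ge> \<kappa>}. measure lborel (P i \<inter> cball 0 (1/800))) \<le> \<kappa>"
proof -
  define n where "n = (40000 * pi + 2) * \<delta>"
  define s :: real where "s = 1/800"
  define \<mu> where "\<mu> = pi * s\<^sup>2 / 2"
  have n0: "n > 0" using dev(2) by (simp add: n_def add_pos_pos)
  have \<mu>0: "\<mu> > 0" by (simp add: \<mu>_def s_def)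
  have crs: "emeasure crossing (cball 0 (1/4)) \<le> ennreal n" unfolding n_def by (rule crossing_small) (use dev in auto)
  let ?M = "\<lambda>i. measure lborel (P i \<inter> cball 0 s)"
  let ?W = "\<lambda>i. \<Sum>j\<in>I. sinsq i j * measure lborel (P i \<inter> P j \<inter> cball 0 (1/4))"
  have Mtot: "\<mu> \<le> (\<Sum>i\<in>I. ?M i)"
  proof -
    have "ennreal (pi * s\<^sup>2) = emeasure lborel (cball (0::real\<times>real) s)" by (simp add: emeasure_cball_plane s_def)
    also have "\<dots> \<le> ennreal (\<Sum>i\<in>I. ?M i) + emeasure deviation (cball 0 s)" by (rule mass_near_area) auto
    also have "\<dots> \<le> ennreal (\<Sum>i\<in>I. ?M i) + ennreal \<delta>"
      by (intro add_left_mono order_trans[OF emeasure_mono dev(1)]) (auto simp: s_def)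
    also have "\<dots> = ennreal ((\<Sum>i\<in>I. ?M i) + \<delta>)" using dev by (subst ennreal_plus) (auto intro: sum_nonneg)
    finally have "pi * s\<^sup>2 \<le> (\<Sum>i\<in>I. ?M i) + \<delta>"
      using dev by (subst (asm) ennreal_le_iff) (auto intro!: add_nonneg_nonneg sum_nonneg)
    moreover have "\<delta> \<le> \<mu>" using dev(4) by (simp add: \<mu>_def s_def power2_eq_square)
    moreover have "pi * s\<^sup>2 = 2 * \<mu>" by (simp add: \<mu>_def)
    ultimately show ?thesis by simp
  qed
  have Wtot: "(\<Sum>i\<in>I. ?W i) \<le> n"
    using crs n0 by (simp add: crossing_eq_sum ennreal_le_iff)
  obtain i0 where i0: "i0 \<in> I" "?M i0 > 0" "?W i0 \<le> n / \<mu> * ?M i0"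
  proof (rule ccontr)
    assume "\<not> thesis"
    then have st: "?W i > n / \<mu> * ?M i" if "i \<in> I" "?M i > 0" for i
      using that(1,2) \<open>\<And>i0. \<lbrakk>i0 \<in> I; ?M i0 > 0; ?W i0 \<le> n / \<mu> * ?M i0\<rbrakk> \<Longrightarrow> thesis\<close> by (meson not_le)
    have "\<exists>i\<in>I. ?M i > 0"
    proof (rule ccontr)
      assume "\<not> ?thesis"
      then have "(\<Sum>i\<in>I. ?M i) \<le> 0" by (intro sum_nonpos) (auto simp: not_less)
      with Mtot \<mu>0 show False by simp
    qed
    then have "(\<Sum>i\<in>I. n / \<mu> * ?M i) < (\<Sum>i\<in>I. ?W i)"
    proof (intro sum_strict_mono_ex1 fin ballI)
      fix i assume i: "i \<in> I"
      show "n / \<mu> * ?M i \<le> ?W i"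
      proof (cases "?M i > 0")
        case True
        then show ?thesis using st[OF i] by simp
      next
        case False
        then have "?M i = 0" using measure_nonneg[of lborel "P i \<inter> cball 0 s"] by linarith
        then show ?thesis by (auto intro!: sum_nonneg mult_nonneg_nonneg sinsq_nonneg)
      qed
    qed (use st in auto)
    also have "\<dots> \<le> n" by (rule Wtot)
    finally have "n / \<mu> * (\<Sum>i\<in>I. ?M i) < n" by (simp add: sum_distrib_left)
    moreover have "n / \<mu> * \<mu> \<le> n / \<mu> * (\<Sum>i\<in>I. ?M i)" using Mtot n0 \<mu>0 by (intro mult_left_mono) auto
    ultimately show False using \<mu>0 by simp
  qed
  define \<alpha> where "\<alpha> = - q i0"
  define \<beta> where "\<beta> = p i0"
  have un: "\<alpha>\<^sup>2 + \<beta>\<^sup>2 = 1" using unit[OF i0(1)] by (simp add: \<alpha>_def \<beta>_def)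
  obtain p' q' a' b' where rt: "strips I p' q'"
    "\<And>j. j \<in> I \<Longrightarrow> p' j = p j * \<beta> - q j * \<alpha>" "\<And>j. j \<in> I \<Longrightarrow> q' j = p j * \<alpha> + q j * \<beta>"
    "\<And>j. j \<in> I \<Longrightarrow> strips.P p' q' a' b' j = rot \<alpha> \<beta> -` P j"
    "\<And>y. strips.m I p' q' a' b' y = m (rot \<alpha> \<beta> y)"
    "\<And>B. B \<in> sets borel \<Longrightarrow> emeasure (strips.deviation I p' q' a' b') (rot \<alpha> \<beta> -` B) = emeasure deviation B"
    using rotate[OF un] by blast
  interpret S': strips I p' q' a' b' by (rule rt(1))
  note p' = rt(2) and q' = rt(3) and vb = rot_vimage_cball[OF un]
  have meas: "measure lborel (rot \<alpha> \<beta> -` B) = measure lborel B" if "B \<in> sets borel" for B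
    using emeasure_rot_vimage[OF un that] by (simp add: measure_def)
  have deviation': "emeasure S'.deviation (cball 0 1) \<le> ennreal \<delta>"
    using rt(6)[of "cball 0 1"] dev(1) by (simp add: vb)
  have M': "measure lborel (S'.P i \<inter> cball 0 r) = measure lborel (P i \<inter> cball 0 r)" if i: "i \<in> I" for i r
  proof -
    have "S'.P i \<inter> cball 0 r = rot \<alpha> \<beta> -` (P i \<inter> cball 0 r)"
      using rt(4)[OF i] vb[of r] by auto
    moreover have "P i \<inter> cball 0 r \<in> sets borel" by (intro sets.Int) auto
    ultimately show ?thesis using meas by metis
  qed
  have W': "measure lborel (S'.P i \<inter> S'.P j \<inter> cball 0 r) = measure lborel (P i \<inter> P j \<inter> cball 0 r)" if ij: "i \<in> I" "j \<in> I" for i j r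
  proof -
    have "S'.P i \<inter> S'.P j \<inter> cball 0 r = rot \<alpha> \<beta> -` (P i \<inter> P j \<inter> cball 0 r)"
      using rt(4)[OF ij(1)] rt(4)[OF ij(2)] vb[of r] by auto
    moreover have "P i \<inter> P j \<inter> cball 0 r \<in> sets borel" by (intro sets.Int) auto
    ultimately show ?thesis using meas by metis
  qed
  have sinsq': "S'.sinsq i0 j = sinsq i0 j" if j: "j \<in> I" for j
  proof -
    have "p' i0 = 1" "q' i0 = 0" using p'[OF i0(1)] q'[OF i0(1)] un by (simp_all add: \<alpha>_def \<beta>_def power2_eq_square)
    moreover have "q' j = p i0 * q j - p j * q i0" using q'[OF j] by (simp add: \<alpha>_def \<beta>_def)
    ultimately show ?thesis by (simp add: S'.sinsq_def sinsq_def)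
  qed
  have "\<exists>x0. \<bar>x0\<bar> \<le> s \<and> (\<Sum>j\<in>I. (q' j)\<^sup>2 * measure lborel {t \<in> {-1/8..1/8}. (x0, t) \<in> S'.P j}) \<le> 4 * s * (n / \<mu>)"
  proof (rule S'.vertical_line[OF i0(1)])
    show "q' i0 = 0" using q'[OF i0(1)] by (simp add: \<alpha>_def \<beta>_def)
    show "0 < measure lborel (S'.P i0 \<inter> cball 0 s)" using i0 M' by simp
    show "(\<Sum>j\<in>I. S'.sinsq i0 j * measure lborel (S'.P i0 \<inter> S'.P j \<inter> cball 0 (1/4))) \<le> n / \<mu> * measure lborel (S'.P i0 \<inter> cball 0 s)"
      using i0 M' W' sinsq' by simp
  qed (use n0 \<mu>0 in \<open>auto simp: s_def\<close>)
  then obtain x0 where x0: "\<bar>x0\<bar> \<le> 1/800" "(\<Sum>j\<in>I. (q' j)\<^sup>2 * measure lborel {t \<in> {-1/8..1/8}. (x0, t) \<in> S'.P j}) \<le> 4 * s * (n / \<mu>)"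
    by (auto simp: s_def)
  have "4 * s * (n / \<mu>) = \<epsilon>" by (simp add: \<epsilon> n_def \<mu>_def s_def power2_eq_square)
  with x0 have x0': "(\<Sum>j\<in>I. (q' j)\<^sup>2 * measure lborel {t \<in> {-1/8..1/8}. (x0, t) \<in> S'.P j}) \<le> \<epsilon>" by simp
  have fin': "(\<Sum>i\<in>{i\<in>I. \<bar>q' i\<bar> \<ge> \<kappa>}. measure lborel (S'.P i \<inter> square (1/800))) \<le> \<epsilon> + n / e\<^sup>2"
    by (rule S'.rigid_vertical[OF deviation' dev(2) S'.crossing_small[OF deviation' dev(2,3), folded n_def] _ x0(1) x0' e \<epsilon>(2) \<kappa>(1)]) (use n0 in simp)
  have "(\<Sum>i\<in>{i\<in>I. \<bar>p i * \<alpha> + q i * \<beta>\<bar> \<ge> \<kappa>}. measure lborel (P i \<inter> cball 0 (1/800)))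
     = (\<Sum>i\<in>{i\<in>I. \<bar>q' i\<bar> \<ge> \<kappa>}. measure lborel (S'.P i \<inter> cball 0 (1/800)))"
    using q' M' by (intro sum.cong) auto
  also have "\<dots> \<le> (\<Sum>i\<in>{i\<in>I. \<bar>q' i\<bar> \<ge> \<kappa>}. measure lborel (S'.P i \<inter> square (1/800)))"
  proof (rule sum_mono)
    fix i
    have "cball (0::real\<times>real) (1/800) \<subseteq> square (1/800)"
    proof
      fix y :: "real \<times> real" assume "y \<in> cball 0 (1/800)"
      then have "norm (fst y, snd y) \<le> 1/800" by simp
      then have "\<bar>fst y\<bar> \<le> 1/800" "\<bar>snd y\<bar> \<le> 1/800"
        using norm_fst_le[of "fst y" "snd y"] norm_snd_le[of "snd y" "fst y"] by simp_all
      then have "fst y \<in> {-(1/800)..1/800}" "snd y \<in> {-(1/800)..1/800}" unfolding atLeastAtMost_iff by linarith+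
      then show "y \<in> square (1/800)" by (cases y) (simp add: square_def)
    qed
    then have "emeasure lborel (S'.P i \<inter> cball 0 (1/800)) \<le> emeasure lborel (S'.P i \<inter> square (1/800))"
      by (intro emeasure_mono sets.Int) auto
    then show "measure lborel (S'.P i \<inter> cball 0 (1/800)) \<le> measure lborel (S'.P i \<inter> square (1/800))"
      by (simp add: S'.emeasure_P_Int)
  qed
  also have "\<dots> \<le> \<kappa>" using fin' \<kappa>(2) by (simp add: n_def)
  finally show ?thesis using un by blast
qed

text \<open>The parameters are chosen in the order \<open>e\<close>, then \<open>\<delta>\<close>: the speed bound needs \<open>e\<close> small
compared with \<open>\<kappa>\<close>, and everything else is \<open>\<delta>\<close> times a constant depending on \<open>e\<close>.\<close>

lemma rigidity_constant:
  fixes \<kappa> :: real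
  assumes "\<kappa> > 0"
  obtains \<delta> where "\<delta> > 0"
    "\<And>I p q a b. strips I p q \<Longrightarrow> emeasure (strips.deviation I p q a b) (cball 0 1) \<le> ennreal \<delta> \<Longrightarrow>
      \<exists>\<alpha> \<beta>. \<alpha>\<^sup>2 + \<beta>\<^sup>2 = 1 \<and>
       (\<Sum>i\<in>{i\<in>I. \<bar>p i * \<alpha> + q i * \<beta>\<bar> \<ge> \<kappa>}. measure lborel (strips.P p q a b i \<inter> cball 0 (1/800))) \<le> \<kappa>"
proof -
  define C where "C = 6400 * (40000 * pi + 2) / pi"
  define C' where "C' = 40000 * pi + 2"
  define e where "e = min (1/4) (\<kappa> * win / 8)"
  have e: "0 < e" "e \<le> 1/4" "e \<le> \<kappa> * win / 8" using assms by (auto simp: e_def)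
  have C: "C > 0" "C' > 0" by (auto simp: C_def C'_def intro!: add_pos_pos divide_pos_pos)
  define \<delta> where "\<delta> = Min {pi / 2500, pi / (2 * 800\<^sup>2), e\<^sup>2 / (2 * C), \<kappa> * win\<^sup>2 / (32 * (1 + C)), \<kappa> / (C + C' / e\<^sup>2)}"
  have pos: "C + C' / e\<^sup>2 > 0" using C e by (intro add_pos_pos divide_pos_pos) auto
  have d0: "\<delta> > 0" using e C assms pos by (auto simp: \<delta>_def intro!: divide_pos_pos)
  have d: "\<delta> \<le> pi / 2500" "\<delta> \<le> pi / (2 * 800\<^sup>2)" "\<delta> \<le> e\<^sup>2 / (2 * C)" "\<delta> \<le> \<kappa> * win\<^sup>2 / (32 * (1 + C))" "\<delta> \<le> \<kappa> / (C + C' / e\<^sup>2)"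
    unfolding \<delta>_def by (rule Min_le; simp)+
  have 3: "2 * (C * \<delta>) \<le> e\<^sup>2" using d(3) C by (simp add: pos_le_divide_eq mult_ac)
  have 4: "3 * e + 16 * (\<delta> + C * \<delta>) / win < \<kappa> * win"
  proof -
    have "\<delta> * (32 * (1 + C)) \<le> \<kappa> * win\<^sup>2" using d(4) C by (simp add: pos_le_divide_eq)
    then have "16 * (\<delta> + C * \<delta>) \<le> \<kappa> * win\<^sup>2 / 2" by (simp add: algebra_simps)
    then have "16 * (\<delta> + C * \<delta>) / win \<le> \<kappa> * win / 2" by (simp add: power2_eq_square)
    moreover have "3 * e < \<kappa> * win / 2" using e assms by simp
    ultimately show ?thesis by linarith
  qed
  have 5: "C * \<delta> + C' * \<delta> / e\<^sup>2 \<le> \<kappa>"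
    using d(5) pos by (simp add: pos_le_divide_eq algebra_simps)
  show thesis
  proof (rule that[OF d0])
    fix I p q a b
    assume "strips I p q" and deviation: "emeasure (strips.deviation I p q a b) (cball 0 1) \<le> ennreal \<delta>"
    then interpret strips I p q a b by simp
    show "\<exists>\<alpha> \<beta>. \<alpha>\<^sup>2 + \<beta>\<^sup>2 = 1 \<and>
       (\<Sum>i\<in>{i\<in>I. \<bar>p i * \<alpha> + q i * \<beta>\<bar> \<ge> \<kappa>}. measure lborel (P i \<inter> cball 0 (1/800))) \<le> \<kappa>"
      by (rule rigid_direction[OF deviation d0 d(1,2) e(1,2), of "C * \<delta>"])
        (use 3 4 5 in \<open>simp_all add: C_def C'_def\<close>)
  qed
qed

section \<open>Tubes, and the direction of a family at a scale\<close>

definition slab :: "real \<Rightarrow> real \<Rightarrow> real \<Rightarrow> real \<Rightarrow> real \<Rightarrow> (real \<times> real) set" where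
  "slab t0 z v c d = {y. \<bar>fst y - z - v * (snd y - t0)\<bar> \<le> c \<and> \<bar>snd y - t0\<bar> \<le> d}"

lemma slab_closed: "closed (slab t0 z v c d)"
  unfolding slab_def by (intro closed_Collect_conj closed_Collect_le continuous_intros)

lemma slab_borel [simp, measurable]: "slab t0 z v c d \<in> sets borel"
  using slab_closed by (rule borel_closed)

lemma slab_bounded [simp]: "bounded (slab t0 z v c d)"
  unfolding bounded_iff
proof (intro exI ballI)
  fix y assume y: "y \<in> slab t0 z v c d"
  have "norm y \<le> \<bar>fst y\<bar> + \<bar>snd y\<bar>" using norm_Pair_le[of "fst y" "snd y"] by simp
  moreover have "\<bar>v * (snd y - t0)\<bar> \<le> \<bar>v\<bar> * \<bar>d\<bar>" unfolding abs_mult using y by (intro mult_left_mono) (auto simp: slab_def)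
  ultimately show "norm y \<le> \<bar>z\<bar> + \<bar>c\<bar> + \<bar>v\<bar> * \<bar>d\<bar> + \<bar>t0\<bar> + \<bar>d\<bar>"
    using y unfolding slab_def mem_Collect_eq by linarith
qed

lemma emeasure_slab:
  assumes "c \<ge> 0" "d \<ge> 0"
  shows "emeasure lborel (slab t0 z v c d) = ennreal (4 * c * d)"
proof -
  have "ennreal \<bar>1 * 1 - 0 * (- v)\<bar> * emeasure lborel {y. 1 * fst y + (- v) * snd y \<in> {z - v * t0 - c..z - v * t0 + c} \<and> 0 * fst y + 1 * snd y \<in> {t0 - d..t0 + d}}
      = emeasure lborel {z - v * t0 - c..z - v * t0 + c} * emeasure lborel {t0 - d..t0 + d}"
    by (rule emeasure_parallelogram) auto
  also have "\<dots> = ennreal (2 * c) * ennreal (2 * d)" using assms by simp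
  also have "\<dots> = ennreal (4 * c * d)" using assms by (subst ennreal_mult[symmetric]) auto
  also have "{y. 1 * fst y + (- v) * snd y \<in> {z - v * t0 - c..z - v * t0 + c} \<and> 0 * fst y + 1 * snd y \<in> {t0 - d..t0 + d}} = slab t0 z v c d"
    by (auto simp: slab_def abs_le_iff algebra_simps)
  finally show ?thesis by simp
qed

text \<open>The image of the unit disc under \<open>aff (z, t0) R v 0 1\<close>: a thin ellipse of width \<open>R\<close> and height 1
along the line of slope \<open>v\<close> through \<open>(z, t0)\<close>.\<close>

definition tube :: "real \<Rightarrow> real \<Rightarrow> real \<Rightarrow> real \<Rightarrow> (real \<times> real) set" where
  "tube t0 z v R = {y. ((fst y - z - v * (snd y - t0)) / R)\<^sup>2 + (snd y - t0)\<^sup>2 \<le> 1}"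

lemma tube_borel [simp, measurable]: "tube t0 z v R \<in> sets borel"
proof -
  have "(\<lambda>y::real\<times>real. ((fst y - z - v * (snd y - t0)) / R)\<^sup>2 + (snd y - t0)\<^sup>2) \<in> borel_measurable borel"
    by (cases "R = 0") (auto intro!: borel_measurable_continuous_onI continuous_intros)
  then show ?thesis unfolding tube_def by measurable
qed

lemma tube_subset_slab: "R > 0 \<Longrightarrow> tube t0 z v R \<subseteq> slab t0 z v R 1"
proof
  fix y assume R: "R > 0" and y: "y \<in> tube t0 z v R"
  then have *: "((fst y - z - v * (snd y - t0)) / R)\<^sup>2 + (snd y - t0)\<^sup>2 \<le> 1" by (simp add: tube_def)
  have "((fst y - z - v * (snd y - t0)) / R)\<^sup>2 \<le> 1" "(snd y - t0)\<^sup>2 \<le> 1"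
    using * zero_le_power2[of "(fst y - z - v * (snd y - t0)) / R"] zero_le_power2[of "snd y - t0"] by linarith+
  then have "\<bar>(fst y - z - v * (snd y - t0)) / R\<bar> \<le> 1" "\<bar>snd y - t0\<bar> \<le> 1"
    by (simp_all add: abs_square_le_1)
  then show "y \<in> slab t0 z v R 1" using R by (simp add: slab_def)
qed

lemma aff_vimage_tube: "R > 0 \<Longrightarrow> aff (z, t0) R v 0 1 -` tube t0 z v R = cball 0 1"
proof (rule set_eqI)
  fix y :: "real \<times> real" assume R: "R > 0"
  have "norm y = sqrt ((fst y)\<^sup>2 + (snd y)\<^sup>2)" by (cases y) (simp add: norm_Pair)
  then show "y \<in> aff (z, t0) R v 0 1 -` tube t0 z v R \<longleftrightarrow> y \<in> cball 0 1"
    using R by (simp add: tube_def aff_def)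
qed

lemma aff_vimage_slab:
  "R > 0 \<Longrightarrow> aff (z, t0) R v 0 1 -` slab t0 z v' (R * c) d = {y. \<bar>fst y - (v' - v) / R * snd y\<bar> \<le> c \<and> \<bar>snd y\<bar> \<le> d}"
proof (rule set_eqI)
  fix y :: "real \<times> real" assume R: "R > 0"
  have "z + R * fst y + v * snd y - z - v' * snd y = R * (fst y - (v' - v) / R * snd y)"
    using R by (simp add: field_simps)
  then have "\<bar>z + R * fst y + v * snd y - z - v' * snd y\<bar> = R * \<bar>fst y - (v' - v) / R * snd y\<bar>"
    using R by (simp add: abs_mult)
  then show "y \<in> aff (z, t0) R v 0 1 -` slab t0 z v' (R * c) d \<longleftrightarrow> y \<in> {y. \<bar>fst y - (v' - v) / R * snd y\<bar> \<le> c \<and> \<bar>snd y\<bar> \<le> d}"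
    using R by (simp add: slab_def aff_def)
qed

text \<open>Rigidity is used with the angle and area tolerance \<open>tol\<close>, and it speaks of the disc of radius
\<open>1/800\<close>; \<open>core\<close> is chosen such that slightly sheared squares of half-side \<open>core\<close> fit into this disc
(\<open>square_core\<close>).\<close>

abbreviation tol :: real where "tol \<equiv> 1 / 1000000000"
abbreviation core :: real where "core \<equiv> 1 / 1600"

lemma square_core: "square (11/16000) \<subseteq> cball 0 (1/800)"
proof (rule square_subset_cball)
  have "sqrt 2 \<le> sqrt ((3/2)\<^sup>2)" by (intro real_sqrt_le_mono) (simp add: power2_eq_square)
  then show "sqrt 2 * (11/16000) \<le> 1/800" by simp
qed

context strips begin

definition Z :: "(real \<times> real) set" where "Z = cball 0 2 - (\<Union>i\<in>I. P i)"

definition excess :: "(real \<times> real) measure" where "excess = density lborel (\<lambda>y. ennreal (max 0 (m y - 1)))"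

lemma sets_excess [simp]: "sets excess = sets borel" by (simp add: excess_def)

lemma emeasure_excess: "B \<in> sets borel \<Longrightarrow> emeasure excess B = (\<integral>\<^sup>+y. ennreal (max 0 (m y - 1)) * indicator B y \<partial>lborel)"
  unfolding excess_def by (subst emeasure_density) auto

lemma Z_borel [simp, measurable]: "Z \<in> sets borel"
  unfolding Z_def using fin by auto

lemma m_ge_1: "y \<in> (\<Union>i\<in>I. P i) \<Longrightarrow> m y \<ge> 1"
proof -
  assume "y \<in> (\<Union>i\<in>I. P i)"
  then obtain i where i: "i \<in> I" "y \<in> P i" by auto
  have "(1::real) = (\<Sum>j\<in>{i}. indicator (P j) y)" using i by simp
  also have "\<dots> \<le> m y" unfolding m_def using i fin by (intro sum_mono2) auto
  finally show ?thesis .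
qed

lemma m_Z: "y \<in> Z \<Longrightarrow> m y = 0"
  unfolding m_def Z_def by (intro sum.neutral) auto

lemma deviation_le_excess:
  assumes B: "B \<in> sets borel" "B \<subseteq> cball 0 2"
  shows "emeasure deviation B \<le> emeasure excess B + emeasure lborel (Z \<inter> B)"
proof -
  have "emeasure deviation B \<le> (\<integral>\<^sup>+y. ennreal (max 0 (m y - 1)) * indicator B y + indicator (Z \<inter> B) y \<partial>lborel)"
    unfolding emeasure_deviation[OF B(1)]
  proof (rule nn_integral_mono)
    fix y
    show "ennreal \<bar>m y - 1\<bar> * indicator B y \<le> ennreal (max 0 (m y - 1)) * indicator B y + indicator (Z \<inter> B) y"
    proof (cases "y \<in> B")
      case True
      show ?thesis
      proof (cases "y \<in> Z")
        case True
        then show ?thesis using \<open>y \<in> B\<close> m_Z by simp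
      next
        case False
        then have "m y \<ge> 1" using True B by (intro m_ge_1) (auto simp: Z_def)
        then show ?thesis using True by simp
      qed
    qed simp
  qed
  also have "\<dots> = emeasure excess B + emeasure lborel (Z \<inter> B)"
    using B by (subst nn_integral_add) (auto simp: emeasure_excess)
  finally show ?thesis .
qed

end

text \<open>The situation after the reductions: rigidity holds for all affine images of the family, the hole is
small compared with the rigidity threshold \<open>\<delta>\<close>, and (\<open>top\<close>) the common direction in the
unit disc is vertical.\<close>

locale holed = strips +
  fixes \<delta> \<rho> :: real
  assumes \<delta>: "\<delta> > 0"
    and rig: "\<And>p' q' a' b'. strips I p' q' \<Longrightarrow> emeasure (strips.deviation I p' q' a' b') (cball 0 1) \<le> ennreal \<delta> \<Longrightarrow>
      \<exists>\<alpha> \<beta>. \<alpha>\<^sup>2 + \<beta>\<^sup>2 = 1 \<and>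
       (\<Sum>i\<in>{i\<in>I. \<bar>p' i * \<alpha> + q' i * \<beta>\<bar> \<ge> tol}. measure lborel (strips.P p' q' a' b' i \<inter> cball 0 (1/800))) \<le> tol"
    and \<rho>: "0 < \<rho>" "\<rho> \<le> tol" "\<rho> \<le> \<delta> / 16"
    and hole: "cball 0 2 - (\<Union>i\<in>I. P i) \<subseteq> cball 0 \<rho>"
    and top: "(\<Sum>i\<in>{i\<in>I. \<bar>q i\<bar> \<ge> tol}. measure lborel (P i \<inter> cball 0 (1/800))) \<le> tol"
begin

lemma Z_snd: "y \<in> Z \<Longrightarrow> \<bar>snd y\<bar> \<le> \<rho>" "y \<in> Z \<Longrightarrow> \<bar>fst y\<bar> \<le> \<rho>"
  using hole norm_fst_le[of "fst y" "snd y"] norm_snd_le[of "snd y" "fst y"] unfolding Z_def by force+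

text \<open>The hole has height at most \<open>2 * \<rho>\<close>, so it fills only a fraction of order \<open>\<rho>\<close> of a slab of height
\<open>d\<close> of order 1, whatever the width \<open>c\<close> of the slab.  This is why the argument works at all scales.\<close>

lemma hole_slab:
  assumes "\<bar>t0\<bar> \<le> \<rho>" "c \<ge> 0"
  shows "measure lborel (Z \<inter> slab t0 z v c d) \<le> 8 * c * \<rho>" "emeasure lborel (Z \<inter> slab t0 z v c d) \<le> ennreal (8 * c * \<rho>)"
proof -
  have "Z \<inter> slab t0 z v c d \<subseteq> slab t0 z v c (2 * \<rho>)"
  proof
    fix y assume y: "y \<in> Z \<inter> slab t0 z v c d"
    then show "y \<in> slab t0 z v c (2 * \<rho>)" using Z_snd(1)[of y] assms by (auto simp: slab_def)
  qed
  then have "emeasure lborel (Z \<inter> slab t0 z v c d) \<le> emeasure lborel (slab t0 z v c (2 * \<rho>))"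
    by (intro emeasure_mono) auto
  also have "\<dots> = ennreal (8 * c * \<rho>)" using assms \<rho> by (simp add: emeasure_slab mult_ac)
  finally show 1: "emeasure lborel (Z \<inter> slab t0 z v c d) \<le> ennreal (8 * c * \<rho>)" .
  have "8 * c * \<rho> \<ge> 0" using assms \<rho> by simp
  with 1 show "measure lborel (Z \<inter> slab t0 z v c d) \<le> 8 * c * \<rho>"
    unfolding measure_def by (simp add: enn2real_leI)
qed

lemma measure_P_mono:
  assumes "S \<subseteq> T" "S \<in> sets borel" "T \<in> sets borel" "bounded T"
  shows "measure lborel (P i \<inter> S) \<le> measure lborel (P i \<inter> T)"
proof -
  have "emeasure lborel (P i \<inter> S) \<le> emeasure lborel (P i \<inter> T)" using assms by (intro emeasure_mono) auto
  then show ?thesis using assms bounded_subset[OF assms(4,1)] by (simp add: emeasure_P_Int)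
qed

text \<open>An area count in \<open>S\<close>, in which the hole takes up at most \<open>8 * c * \<rho>\<close> by \<open>hole_slab\<close>.\<close>

lemma untouched_strip:
  assumes S: "S = slab t0 z v c d" "S \<subseteq> cball 0 2" "c \<ge> 0" "d \<ge> 0" and t0: "\<bar>t0\<bar> \<le> \<rho>"
    and J: "J \<subseteq> I" and less: "(\<Sum>i\<in>J. measure lborel (P i \<inter> S)) + 8 * c * \<rho> < 4 * c * d"
  obtains y i where "y \<in> S" "i \<in> I - J" "y \<in> P i"
proof (rule ccontr)
  assume "\<not> thesis"
  then have "y \<notin> P i" if "y \<in> S" "i \<in> I - J" for y i using that \<open>\<And>y i. \<lbrakk>y \<in> S; i \<in> I - J; y \<in> P i\<rbrakk> \<Longrightarrow> thesis\<close> by blast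
  then have sub: "S \<subseteq> (\<Union>i\<in>J. P i \<inter> S) \<union> (Z \<inter> S)" using S(2) unfolding Z_def by blast
  have fJ: "finite J" using J fin finite_subset by auto
  have Sb: "S \<in> sets borel" "bounded S" using S by auto
  have "emeasure lborel S \<le> emeasure lborel ((\<Union>i\<in>J. P i \<inter> S) \<union> (Z \<inter> S))"
    using sub Sb fJ by (intro emeasure_mono sets.Un sets.finite_UN) auto
  also have "\<dots> \<le> emeasure lborel (\<Union>i\<in>J. P i \<inter> S) + emeasure lborel (Z \<inter> S)"
    using Sb fJ by (intro emeasure_subadditive sets.finite_UN) auto
  also have "\<dots> \<le> (\<Sum>i\<in>J. emeasure lborel (P i \<inter> S)) + ennreal (8 * c * \<rho>)"
    using Sb fJ hole_slab(2)[OF t0 S(3)] S(1) by (intro add_mono emeasure_subadditive_finite) auto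
  also have "(\<Sum>i\<in>J. emeasure lborel (P i \<inter> S)) = ennreal (\<Sum>i\<in>J. measure lborel (P i \<inter> S))"
    using Sb by (simp add: emeasure_P_Int)
  also have "\<dots> + ennreal (8 * c * \<rho>) = ennreal ((\<Sum>i\<in>J. measure lborel (P i \<inter> S)) + 8 * c * \<rho>)"
    using S \<rho> by (subst ennreal_plus) (auto intro: sum_nonneg)
  finally have "ennreal (4 * c * d) \<le> ennreal ((\<Sum>i\<in>J. measure lborel (P i \<inter> S)) + 8 * c * \<rho>)"
    using S by (simp add: emeasure_slab)
  then have "4 * c * d \<le> (\<Sum>i\<in>J. measure lborel (P i \<inter> S)) + 8 * c * \<rho>"
    using S \<rho> by (subst (asm) ennreal_le_iff) (auto intro!: add_nonneg_nonneg sum_nonneg)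
  with less show False by simp
qed

text \<open>The strips whose slope \<open>- q i / p i\<close> is more than \<open>4 * tol * R\<close> away from \<open>v\<close>; in coordinates in which a tube of
width \<open>R\<close> and slope \<open>v\<close> becomes a disc, these are the strips that are not nearly vertical.\<close>

definition transversal :: "real \<Rightarrow> real \<Rightarrow> nat set" where
  "transversal v R = {i \<in> I. \<bar>p i * v + q i\<bar> > 4 * tol * \<bar>p i\<bar> * R}"

text \<open>The direction of the family at width \<open>R\<close> around \<open>(z, t0)\<close> is \<open>v\<close>.  Only the core of the tube is inspected,
since rigidity gives no information elsewhere.\<close>

definition aligned :: "real \<Rightarrow> real \<Rightarrow> real \<Rightarrow> real \<Rightarrow> bool" where
  "aligned t0 z R v \<longleftrightarrow> (\<Sum>i\<in>transversal v R. measure lborel (P i \<inter> slab t0 z v (R * core) core)) \<le> tol * R"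

lemma aligned_strip_slope:
  assumes "i \<in> I" "i \<notin> transversal v R" "R \<ge> 0" shows "p i \<noteq> 0" "\<bar>p i * v + q i\<bar> \<le> 4 * tol * \<bar>p i\<bar> * R"
proof -
  show *: "\<bar>p i * v + q i\<bar> \<le> 4 * tol * \<bar>p i\<bar> * R" using assms by (simp add: transversal_def)
  show "p i \<noteq> 0"
  proof
    assume "p i = 0"
    with * have "q i = 0" by simp
    with \<open>p i = 0\<close> unit[OF assms(1)] show False by simp
  qed
qed

lemma slab_in_ball:
  assumes "\<bar>t0\<bar> \<le> \<rho>" "\<bar>z\<bar> \<le> \<rho>" "\<bar>v\<bar> \<le> 1/100" "c \<le> 1/2" "d \<le> 1"
  shows "slab t0 z v c d \<subseteq> cball 0 2"
proof
  fix y assume y: "y \<in> slab t0 z v c d"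
  have s: "\<bar>snd y - t0\<bar> \<le> 1" using y assms by (simp add: slab_def)
  have "\<bar>v * (snd y - t0)\<bar> \<le> (1/100) * 1" unfolding abs_mult using s assms by (intro mult_mono) auto
  moreover have "\<bar>fst y - z - v * (snd y - t0)\<bar> \<le> 1/2" using y assms by (simp add: slab_def)
  moreover have "\<rho> \<le> 1/100" using \<rho> by simp
  ultimately have "\<bar>fst y\<bar> + \<bar>snd y\<bar> \<le> 2" using s assms by linarith
  then show "y \<in> cball 0 2" using norm_Pair_le[of "fst y" "snd y"] by simp
qed

lemma aligned_base:
  assumes "\<bar>t0\<bar> \<le> \<rho>" "\<bar>z\<bar> \<le> \<rho>" shows "aligned t0 z 1 0"
proof -
  have sub: "slab t0 z 0 (1 * core) core \<subseteq> cball 0 (1/800)"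
  proof
    fix y assume y: "y \<in> slab t0 z 0 (1 * core) core"
    have \<rho>': "\<rho> \<le> 1/16000" using \<rho> by simp
    have "\<bar>fst y - z\<bar> \<le> core" "\<bar>snd y - t0\<bar> \<le> core" using y by (simp_all add: slab_def)
    then have "fst y \<in> {-(11/16000)..11/16000}" "snd y \<in> {-(11/16000)..11/16000}"
      using assms \<rho>' unfolding atLeastAtMost_iff by linarith+
    then have "y \<in> square (11/16000)" by (cases y) (simp add: square_def)
    then show "y \<in> cball 0 (1/800)" using square_core by blast
  qed
  have bsub: "transversal 0 1 \<subseteq> {i\<in>I. \<bar>q i\<bar> \<ge> tol}"
  proof
    fix i assume i: "i \<in> transversal 0 1"
    then have iI: "i \<in> I" and b: "\<bar>q i\<bar> > 4 * tol * \<bar>p i\<bar>" by (auto simp: transversal_def)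
    have "\<bar>q i\<bar> \<ge> tol"
    proof (rule ccontr)
      assume "\<not> \<bar>q i\<bar> \<ge> tol"
      then have "\<bar>q i\<bar> < tol" by simp
      then have "\<bar>p i\<bar> < 1/4" using b by linarith
      then have "\<bar>p i\<bar>\<^sup>2 \<le> (1/4)\<^sup>2" "\<bar>q i\<bar>\<^sup>2 \<le> (1/4)\<^sup>2" using \<open>\<bar>q i\<bar> < tol\<close> by (intro power_mono; simp)+
      then show False using unit[OF iI] by (simp add: power2_eq_square)
    qed
    then show "i \<in> {i\<in>I. \<bar>q i\<bar> \<ge> tol}" using iI by simp
  qed
  have "(\<Sum>i\<in>transversal 0 1. measure lborel (P i \<inter> slab t0 z 0 (1 * core) core)) \<le> (\<Sum>i\<in>transversal 0 1. measure lborel (P i \<inter> cball 0 (1/800)))"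
    by (intro sum_mono measure_P_mono sub) auto
  also have "\<dots> \<le> (\<Sum>i\<in>{i\<in>I. \<bar>q i\<bar> \<ge> tol}. measure lborel (P i \<inter> cball 0 (1/800)))"
    using fin bsub by (intro sum_mono2) auto
  also note top
  finally show ?thesis by (simp add: aligned_def)
qed

end

section \<open>Following the direction through the scales\<close>

lemma slab_mono: "c \<le> c' \<Longrightarrow> d \<le> d' \<Longrightarrow> slab t0 z v c d \<subseteq> slab t0 z v c' d'"
  by (auto simp: slab_def)

lemma sum_Un_le:
  fixes f :: "'a \<Rightarrow> real"
  assumes "finite S" "finite T" "\<And>x. f x \<ge> 0"
  shows "sum f (S \<union> T) \<le> sum f S + sum f T"
  using sum.union_inter[OF assms(1,2), of f] sum_nonneg[of "S \<inter> T" f] assms(3) by simp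

context holed begin

text \<open>The affine map that turns the tube into the unit disc carries the family to one with deviation at
most \<open>\<delta>\<close>: half of it comes from the excess, the other half from the hole.  Rigidity gives a common direction
\<open>(\<alpha>, \<beta>)\<close> there.  Some strip in the core is exceptional neither for this direction nor for the direction \<open>v\<close> at
width \<open>2 * R\<close>.  That strip is almost vertical in the new coordinates, hence so is \<open>(\<alpha>, \<beta>)\<close>.\<close>

lemma aligned_step:
  assumes t0: "\<bar>t0\<bar> \<le> \<rho>" and z: "\<bar>z\<bar> \<le> \<rho>" and v: "\<bar>v\<bar> \<le> 1/100" and R: "0 < R" "R \<le> 1/2"
    and al2: "aligned t0 z (2 * R) v" and ov: "emeasure excess (tube t0 z v R) \<le> ennreal (\<delta> * R / 2)"
  shows "\<exists>v'. aligned t0 z R v' \<and> \<bar>v' - v\<bar> \<le> 20 * tol * R"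
proof -
  have det: "R * 1 - 0 * v \<noteq> 0" using R by simp
  let ?\<phi> = "aff (z, t0) R v 0 1"
  obtain p' q' a' b' nrm where pb: "strips I p' q'"
    "\<And>j. j \<in> I \<Longrightarrow> nrm j = sqrt ((p j * R + q j * 0)\<^sup>2 + (p j * v + q j * 1)\<^sup>2)"
    "\<And>j. j \<in> I \<Longrightarrow> nrm j > 0"
    "\<And>j. j \<in> I \<Longrightarrow> p' j = (p j * R + q j * 0) / nrm j"
    "\<And>j. j \<in> I \<Longrightarrow> q' j = (p j * v + q j * 1) / nrm j"
    "\<And>j. j \<in> I \<Longrightarrow> strips.P p' q' a' b' j = ?\<phi> -` P j"
    "\<And>y. strips.m I p' q' a' b' y = m (?\<phi> y)"
    "\<And>B. B \<in> sets borel \<Longrightarrow> ennreal \<bar>R * 1 - 0 * v\<bar> * emeasure (strips.deviation I p' q' a' b') (?\<phi> -` B) = emeasure deviation B"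
    by (rule pullback[OF det, of "(z, t0)"]) (rule that)
  interpret S': strips I p' q' a' b' by (rule pb(1))
  have tube_sub: "tube t0 z v R \<subseteq> slab t0 z v R 1" by (rule tube_subset_slab) (rule R)
  also have "\<dots> \<subseteq> cball 0 2" by (rule slab_in_ball) (use t0 z v R in auto)
  finally have tb: "tube t0 z v R \<subseteq> cball 0 2" .
  have deviation': "emeasure S'.deviation (cball 0 1) \<le> ennreal \<delta>"
  proof -
    have "ennreal R * emeasure S'.deviation (cball 0 1) = emeasure deviation (tube t0 z v R)"
      using pb(8)[of "tube t0 z v R"] R by (simp add: aff_vimage_tube)
    also have "\<dots> \<le> emeasure excess (tube t0 z v R) + emeasure lborel (Z \<inter> tube t0 z v R)"
      by (rule deviation_le_excess) (use tb in auto)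
    also have "\<dots> \<le> ennreal (\<delta> * R / 2) + ennreal (8 * R * \<rho>)"
    proof (rule add_mono[OF ov])
      have "emeasure lborel (Z \<inter> tube t0 z v R) \<le> emeasure lborel (Z \<inter> slab t0 z v R 1)"
        using tube_sub by (intro emeasure_mono) auto
      also have "\<dots> \<le> ennreal (8 * R * \<rho>)" by (rule hole_slab) (use t0 R in auto)
      finally show "emeasure lborel (Z \<inter> tube t0 z v R) \<le> ennreal (8 * R * \<rho>)" .
    qed
    also have "\<dots> = ennreal (\<delta> * R / 2 + 8 * R * \<rho>)" using R \<rho> \<delta> by (subst ennreal_plus) auto
    also have "\<dots> \<le> ennreal (R * \<delta>)"
    proof (rule ennreal_leI)
      have "R * (16 * \<rho>) \<le> R * \<delta>" using R \<rho> by (intro mult_left_mono) auto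
      then show "\<delta> * R / 2 + 8 * R * \<rho> \<le> R * \<delta>" by (simp add: mult_ac)
    qed
    also have "\<dots> = ennreal R * ennreal \<delta>" using R \<delta> by (subst ennreal_mult) auto
    finally show ?thesis using R by (simp add: ennreal_mult_le_mult_iff)
  qed
  obtain \<alpha> \<beta> where ab: "\<alpha>\<^sup>2 + \<beta>\<^sup>2 = 1" and
    sm: "(\<Sum>i\<in>{i\<in>I. \<bar>p' i * \<alpha> + q' i * \<beta>\<bar> \<ge> tol}. measure lborel (S'.P i \<inter> cball 0 (1/800))) \<le> tol"
    using rig[OF pb(1) deviation'] by blast
  define J where "J = {i\<in>I. \<bar>p' i * \<alpha> + q' i * \<beta>\<bar> \<ge> tol}"
  have transfer: "measure lborel (P i \<inter> slab t0 z v' (R * core) core) \<le> R * measure lborel (S'.P i \<inter> cball 0 (1/800))"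
    if i: "i \<in> I" and v': "\<bar>v' - v\<bar> \<le> R / 10" for i v'
  proof -
    let ?S = "slab t0 z v' (R * core) core"
    have "?\<phi> -` ?S \<subseteq> cball 0 (1/800)"
    proof
      fix y assume "y \<in> ?\<phi> -` ?S"
      then have y: "\<bar>fst y - (v' - v) / R * snd y\<bar> \<le> core" "\<bar>snd y\<bar> \<le> core"
        unfolding aff_vimage_slab[OF R(1)] mem_Collect_eq by blast+
      have "\<bar>(v' - v) / R\<bar> \<le> 1/10" using v' R by (simp add: pos_divide_le_eq)
      then have "\<bar>(v' - v) / R * snd y\<bar> \<le> (1/10) * core" unfolding abs_mult[of "(v' - v) / R"] using y by (intro mult_mono) auto
      then have "fst y \<in> {-(11/16000)..11/16000}" "snd y \<in> {-(11/16000)..11/16000}"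
        using y unfolding atLeastAtMost_iff by linarith+
      then have "y \<in> square (11/16000)" by (cases y) (simp add: square_def)
      then show "y \<in> cball 0 (1/800)" using square_core by blast
    qed
    then have sub: "?\<phi> -` (P i \<inter> ?S) \<subseteq> S'.P i \<inter> cball 0 (1/800)" using pb(6)[OF i] by auto
    have "ennreal (measure lborel (P i \<inter> ?S)) = emeasure lborel (P i \<inter> ?S)" by (rule emeasure_P_Int[symmetric]) auto
    also have "\<dots> = ennreal \<bar>R * 1 - 0 * v\<bar> * emeasure lborel (?\<phi> -` (P i \<inter> ?S))"
      by (rule emeasure_aff[OF _ det]) auto
    also have "\<dots> \<le> ennreal R * emeasure lborel (S'.P i \<inter> cball 0 (1/800))"
      using sub R by (intro mult_mono emeasure_mono sets.Int) auto
    also have "\<dots> = ennreal (R * measure lborel (S'.P i \<inter> cball 0 (1/800)))"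
      using R by (simp add: S'.emeasure_P_Int ennreal_mult)
    finally show ?thesis using R by (subst (asm) ennreal_le_iff) auto
  qed
  have Jsum: "(\<Sum>i\<in>J. R * measure lborel (S'.P i \<inter> cball 0 (1/800))) \<le> tol * R"
    using sm R by (simp add: J_def sum_distrib_left[symmetric] mult.commute)
  obtain y i where i: "i \<in> I - (transversal v (2 * R) \<union> J)"
  proof (rule untouched_strip[OF refl])
    show "slab t0 z v (R * core) core \<subseteq> cball 0 2" by (rule slab_in_ball) (use t0 z v R in auto)
    show "0 \<le> R * core" "0 \<le> core" using R by auto
    show "transversal v (2 * R) \<union> J \<subseteq> I" by (auto simp: transversal_def J_def)
    have fb: "finite (transversal v (2 * R))" "finite J" using fin by (auto simp: transversal_def J_def)
    have "(\<Sum>i\<in>transversal v (2 * R) \<union> J. measure lborel (P i \<inter> slab t0 z v (R * core) core))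
       \<le> (\<Sum>i\<in>transversal v (2 * R). measure lborel (P i \<inter> slab t0 z v (R * core) core)) + (\<Sum>i\<in>J. measure lborel (P i \<inter> slab t0 z v (R * core) core))"
      using fb by (intro sum_Un_le) auto
    also have "\<dots> \<le> tol * (2 * R) + tol * R"
    proof (rule add_mono)
      have "(\<Sum>i\<in>transversal v (2 * R). measure lborel (P i \<inter> slab t0 z v (R * core) core)) \<le> (\<Sum>i\<in>transversal v (2 * R). measure lborel (P i \<inter> slab t0 z v (2 * R * core) core))"
        by (intro sum_mono measure_P_mono slab_mono slab_borel slab_bounded) (use R in simp_all)
      also have "\<dots> \<le> tol * (2 * R)" using al2 by (simp add: aligned_def)
      finally show "(\<Sum>i\<in>transversal v (2 * R). measure lborel (P i \<inter> slab t0 z v (R * core) core)) \<le> tol * (2 * R)" .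
      have "(\<Sum>i\<in>J. measure lborel (P i \<inter> slab t0 z v (R * core) core)) \<le> (\<Sum>i\<in>J. R * measure lborel (S'.P i \<inter> cball 0 (1/800)))"
        using R by (intro sum_mono transfer) (auto simp: J_def)
      with Jsum show "(\<Sum>i\<in>J. measure lborel (P i \<inter> slab t0 z v (R * core) core)) \<le> tol * R" by linarith
    qed
    also have "\<dots> = R * (3 * tol)" by simp
    finally have 1: "(\<Sum>i\<in>transversal v (2 * R) \<union> J. measure lborel (P i \<inter> slab t0 z v (R * core) core)) \<le> R * (3 * tol)" .
    have "8 * (R * core) * \<rho> \<le> 8 * (R * core) * tol" using R \<rho> by (intro mult_left_mono) auto
    then have "8 * (R * core) * \<rho> \<le> R * (8 * core * tol)" by simp
    moreover have "R * (3 * tol) + R * (8 * core * tol) < R * (4 * core * core)"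
      using R by (simp add: distrib_left[symmetric])
    ultimately show "(\<Sum>i\<in>transversal v (2 * R) \<union> J. measure lborel (P i \<inter> slab t0 z v (R * core) core)) + 8 * (R * core) * \<rho> < 4 * (R * core) * core"
      using 1 by linarith
  qed (use t0 that in auto)
  then have iI: "i \<in> I" "i \<notin> transversal v (2 * R)" "i \<notin> J" by auto
  have pi: "p i \<noteq> 0" "\<bar>p i * v + q i\<bar> \<le> 4 * tol * \<bar>p i\<bar> * (2 * R)" using aligned_strip_slope[OF iI(1,2)] R by auto
  have dir: "\<bar>p j * R * \<alpha> + (p j * v + q j) * \<beta>\<bar> < tol * nrm j" if "j \<in> I" "j \<notin> J" for j
  proof -
    have "\<bar>p' j * \<alpha> + q' j * \<beta>\<bar> < tol" using that by (auto simp: J_def)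
    moreover have "p' j * \<alpha> + q' j * \<beta> = (p j * R * \<alpha> + (p j * v + q j) * \<beta>) / nrm j"
      using pb(3)[OF that(1)] by (simp add: pb(4,5)[OF that(1)] field_simps)
    ultimately show ?thesis using pb(3)[OF that(1)] by (simp add: pos_divide_less_eq)
  qed
  have nle: "nrm j \<le> \<bar>p j\<bar> * R + \<bar>p j * v + q j\<bar>" if "j \<in> I" for j
    using norm_Pair_le[of "p j * R" "p j * v + q j"] R pb(2)[OF that] by (simp add: norm_Pair abs_mult power_mult_distrib)
  define g where "g = \<bar>p i\<bar> * R"
  have g: "g > 0" using pi R by (simp add: g_def)
  have "\<beta>\<^sup>2 \<le> 1" using ab zero_le_power2[of \<alpha>] by linarith
  then have b1: "\<bar>\<beta>\<bar> \<le> 1" by (simp add: abs_square_le_1)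
  have pv: "\<bar>p i * v + q i\<bar> \<le> 8 * tol * g" using pi by (simp add: g_def mult_ac)
  have "g * \<bar>\<alpha>\<bar> \<le> 10 * tol * g"
  proof -
    have "nrm i \<le> 2 * g" using nle[OF iI(1)] pv g by (simp add: g_def)
    then have "\<bar>p i * R * \<alpha> + (p i * v + q i) * \<beta>\<bar> \<le> tol * (2 * g)" using dir[OF iI(1,3)] by simp
    moreover have "\<bar>(p i * v + q i) * \<beta>\<bar> \<le> 8 * tol * g * 1" unfolding abs_mult using pv b1 g by (intro mult_mono) auto
    moreover have "\<bar>p i * R * \<alpha>\<bar> = g * \<bar>\<alpha>\<bar>" using R by (simp add: g_def abs_mult)
    ultimately show ?thesis by linarith
  qed
  then have a10: "\<bar>\<alpha>\<bar> \<le> 10 * tol" using g by (simp add: mult.commute)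
  have b9: "\<bar>\<beta>\<bar> \<ge> 9/10"
  proof (rule ccontr)
    assume "\<not> \<bar>\<beta>\<bar> \<ge> 9/10"
    then have "\<bar>\<beta>\<bar>\<^sup>2 \<le> (9/10)\<^sup>2" by (intro power_mono) auto
    moreover have "\<bar>\<alpha>\<bar>\<^sup>2 \<le> (1/10)\<^sup>2" using a10 by (intro power_mono) auto
    ultimately show False using ab by (simp add: power2_eq_square)
  qed
  \<comment> \<open>The slope, in the original coordinates, of the direction \<open>(\<alpha>, \<beta>)\<close>.\<close>
  define v' where "v' = v + R * \<alpha> / \<beta>"
  have vd: "\<bar>v' - v\<bar> \<le> 20 * tol * R"
  proof -
    have "\<bar>v' - v\<bar> = R * \<bar>\<alpha>\<bar> / \<bar>\<beta>\<bar>" using R by (simp add: v'_def abs_mult)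
    also have "\<dots> \<le> R * (10 * tol) / (1/2)" using R a10 b9 by (intro frac_le mult_left_mono) auto
    finally show ?thesis by simp
  qed
  have transJ: "transversal v' R \<subseteq> J"
  proof (rule ccontr)
    assume "\<not> transversal v' R \<subseteq> J"
    then obtain j where j: "j \<in> I" "\<bar>p j * v' + q j\<bar> > 4 * tol * \<bar>p j\<bar> * R" "j \<notin> J" by (auto simp: transversal_def)
    define X where "X = \<bar>p j * v' + q j\<bar>"
    define h where "h = \<bar>p j\<bar> * R"
    have h0: "h \<ge> 0" using R by (simp add: h_def)
    have "\<beta> \<noteq> 0" using b9 by auto
    then have "p j * R * \<alpha> + (p j * v + q j) * \<beta> = \<beta> * (p j * v' + q j)" by (simp add: v'_def field_simps)
    then have 1: "\<bar>\<beta>\<bar> * X < tol * nrm j" using dir[OF j(1,3)] by (simp add: X_def abs_mult)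
    have "\<bar>p j * v + q j\<bar> \<le> X + \<bar>p j\<bar> * \<bar>v' - v\<bar>"
    proof -
      have "p j * v + q j = (p j * v' + q j) - p j * (v' - v)" by (simp add: algebra_simps)
      then show ?thesis unfolding X_def abs_mult[symmetric] by linarith
    qed
    moreover have "\<bar>p j\<bar> * \<bar>v' - v\<bar> \<le> \<bar>p j\<bar> * (20 * tol * R)" using vd by (intro mult_left_mono) auto
    then have "\<bar>p j\<bar> * \<bar>v' - v\<bar> \<le> h / 10" using h0 by (simp add: h_def mult_ac)
    moreover have "nrm j \<le> h + \<bar>p j * v + q j\<bar>" using nle[OF j(1)] by (simp add: h_def)
    ultimately have le: "nrm j \<le> h + (X + h / 10)" by linarith
    have "9/10 * X \<le> \<bar>\<beta>\<bar> * X" using b9 by (intro mult_right_mono) (auto simp: X_def)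
    also note 1
    also have "tol * nrm j \<le> tol * (h + (X + h / 10))" by (rule mult_left_mono[OF le]) simp
    finally have "9/10 * X < tol * (h + (X + h / 10))" .
    moreover have "X > 4 * tol * h" using j(2) by (simp add: X_def h_def mult_ac)
    ultimately show False using h0 by simp
  qed
  have "aligned t0 z R v'"
    unfolding aligned_def
  proof -
    have "(\<Sum>i\<in>transversal v' R. measure lborel (P i \<inter> slab t0 z v' (R * core) core)) \<le> (\<Sum>i\<in>J. measure lborel (P i \<inter> slab t0 z v' (R * core) core))"
      using transJ fin by (intro sum_mono2) (auto simp: J_def)
    also have "\<dots> \<le> (\<Sum>i\<in>J. R * measure lborel (S'.P i \<inter> cball 0 (1/800)))"
      using vd R by (intro sum_mono transfer) (auto simp: J_def)
    also note Jsum
    finally show "(\<Sum>i\<in>transversal v' R. measure lborel (P i \<inter> slab t0 z v' (R * core) core)) \<le> tol * R" .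
  qed
  with vd show ?thesis by blast
qed

abbreviation (input) rad :: "nat \<Rightarrow> real" where "rad n \<equiv> (1/2) ^ n"

text \<open>The slopes reached from the vertical by repeated use of \<open>aligned_step\<close> at the fixed point \<open>(z, t0)\<close>,
with widths \<open>1, 1/2, \<dots>, rad n\<close>.\<close>

inductive chain :: "real \<Rightarrow> real \<Rightarrow> nat \<Rightarrow> real \<Rightarrow> bool" for t0 z where
  zero: "aligned t0 z (rad 0) 0 \<Longrightarrow> chain t0 z 0 0"
| Suc: "chain t0 z n v \<Longrightarrow> aligned t0 z (rad (Suc n)) v' \<Longrightarrow> \<bar>v' - v\<bar> \<le> 10 * tol * rad n \<Longrightarrow> chain t0 z (Suc n) v'"

lemma chain_aligned: "chain t0 z n v \<Longrightarrow> aligned t0 z (rad n) v"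
  by (induction rule: chain.induct)

lemma chain_drift:
  "chain t0 z n v \<Longrightarrow> k \<le> n \<Longrightarrow> \<exists>u. chain t0 z k u \<and> \<bar>v - u\<bar> \<le> 20 * tol * (rad k - rad n)"
proof (induction arbitrary: k rule: chain.induct)
  case zero
  then show ?case by (auto intro: chain.zero)
next
  case (Suc n v v')
  show ?case
  proof (cases "k = Suc n")
    case True
    then show ?thesis using chain.Suc[OF Suc(1-3)] by auto
  next
    case False
    then obtain u where u: "chain t0 z k u" "\<bar>v - u\<bar> \<le> 20 * tol * (rad k - rad n)" using Suc(4)[of k] Suc(5) by auto
    have "10 * tol * rad n = 20 * tol * (rad n - rad (Suc n))" by simp
    then have "\<bar>v' - u\<bar> \<le> 20 * tol * (rad k - rad n) + 20 * tol * (rad n - rad (Suc n))" using u(2) Suc(3) by linarith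
    also have "\<dots> = 20 * tol * (rad k - rad (Suc n))"
      by (simp only: distrib_left[symmetric] add_diff_eq diff_add_cancel)
    finally show ?thesis using u(1) by blast
  qed
qed

lemma chain_0: "chain t0 z 0 u \<Longrightarrow> u = 0"
  by (auto elim: chain.cases)

lemma chain_small: assumes "chain t0 z n v" shows "\<bar>v\<bar> \<le> 1/100"
proof -
  obtain u where "chain t0 z 0 u" "\<bar>v - u\<bar> \<le> 20 * tol * (rad 0 - rad n)" using chain_drift[OF assms, of 0] by auto
  moreover have "20 * tol * (rad 0 - rad n) \<le> 20 * tol * 1" by (intro mult_left_mono) auto
  ultimately have "u = 0" "\<bar>v - u\<bar> \<le> 20 * tol * 1" using chain_0[of t0 z u] by (blast, linarith)
  then show ?thesis by simp
qed

text \<open>Two slabs of the same width around nearby points overlap in a slab, and a strip that is exceptional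
for neither of them pins down both slopes.  The induction hypothesis, at twice the width, is needed to know
that the slopes are close enough for the overlap to have full height.\<close>

lemma chain_agree:
  assumes t0: "\<bar>t0\<bar> \<le> \<rho>" and z: "\<bar>z\<bar> \<le> \<rho>" "\<bar>z'\<bar> \<le> \<rho>"
  shows "chain t0 z n v \<Longrightarrow> chain t0 z' n v' \<Longrightarrow> \<bar>z - z'\<bar> \<le> core * rad n / 2 \<Longrightarrow> \<bar>v - v'\<bar> \<le> 8 * tol * rad n"
proof (induction n arbitrary: v v')
  case 0
  then show ?case using chain_0[of t0 z v] chain_0[of t0 z' v'] by simp
next
  case (Suc n)
  define R where "R = rad (Suc n)"
  have R: "R > 0" "R \<le> 1/2" "rad n = 2 * R" using power_le_one[of "1/2::real" n] by (simp_all add: R_def)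
  from Suc.prems(1) obtain u where u: "chain t0 z n u" "\<bar>v - u\<bar> \<le> 10 * tol * rad n" by (auto elim: chain.cases)
  from Suc.prems(2) obtain u' where u': "chain t0 z' n u'" "\<bar>v' - u'\<bar> \<le> 10 * tol * rad n" by (auto elim: chain.cases)
  have d: "\<bar>z - z'\<bar> \<le> core * R / 2" using Suc.prems(3) unfolding R_def[symmetric] .
  then have "\<bar>z - z'\<bar> \<le> core * rad n / 2" using R by simp
  then have "\<bar>u - u'\<bar> \<le> 8 * tol * rad n" by (rule Suc.IH[OF u(1) u'(1)])
  then have vR: "\<bar>v - v'\<bar> \<le> R" using u(2) u'(2) R unfolding R(3) by linarith
  let ?S = "slab t0 z v (core * R / 4) (core / 4)"
  have S1: "?S \<subseteq> slab t0 z v (R * core) core" using R by (auto simp: slab_def)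
  have S2: "?S \<subseteq> slab t0 z' v' (R * core) core"
  proof
    fix y assume y: "y \<in> ?S"
    then have 1: "\<bar>fst y - z - v * (snd y - t0)\<bar> \<le> core * R / 4" "\<bar>snd y - t0\<bar> \<le> core / 4" by (simp_all add: slab_def)
    have 2: "\<bar>(v - v') * (snd y - t0)\<bar> \<le> R * (core / 4)" unfolding abs_mult using vR 1 R by (intro mult_mono) auto
    have "fst y - z' - v' * (snd y - t0) = (fst y - z - v * (snd y - t0)) + (z - z') + (v - v') * (snd y - t0)"
      by (simp add: algebra_simps)
    then have "\<bar>fst y - z' - v' * (snd y - t0)\<bar> \<le> R * core" using 1 2 d by linarith
    then show "y \<in> slab t0 z' v' (R * core) core" using 1 by (simp add: slab_def)
  qed
  obtain y i where i: "i \<in> I - (transversal v R \<union> transversal v' R)"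
  proof (rule untouched_strip[OF refl])
    show "?S \<subseteq> cball 0 2"
      by (rule slab_in_ball) (use t0 z R chain_small[OF Suc.prems(1)] in auto)
    show "0 \<le> core * R / 4" "0 \<le> core / 4" using R by auto
    show "transversal v R \<union> transversal v' R \<subseteq> I" by (auto simp: transversal_def)
    have fb: "finite (transversal v R)" "finite (transversal v' R)" using fin by (auto simp: transversal_def)
    have "(\<Sum>i\<in>transversal v R \<union> transversal v' R. measure lborel (P i \<inter> ?S)) \<le> (\<Sum>i\<in>transversal v R. measure lborel (P i \<inter> ?S)) + (\<Sum>i\<in>transversal v' R. measure lborel (P i \<inter> ?S))"
      using fb by (intro sum_Un_le) auto
    also have "\<dots> \<le> (\<Sum>i\<in>transversal v R. measure lborel (P i \<inter> slab t0 z v (R * core) core)) + (\<Sum>i\<in>transversal v' R. measure lborel (P i \<inter> slab t0 z' v' (R * core) core))"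
      by (intro add_mono sum_mono measure_P_mono S1 S2) auto
    also have "\<dots> \<le> tol * R + tol * R"
      using chain_aligned[OF Suc.prems(1)] chain_aligned[OF Suc.prems(2)] unfolding aligned_def R_def[symmetric] by (rule add_mono)
    finally have 1: "(\<Sum>i\<in>transversal v R \<union> transversal v' R. measure lborel (P i \<inter> ?S)) \<le> R * (2 * tol)" by simp
    have "8 * (core * R / 4) * \<rho> \<le> 8 * (core * R / 4) * tol" using R \<rho> by (intro mult_left_mono) auto
    then have "8 * (core * R / 4) * \<rho> \<le> R * (2 * core * tol)" by simp
    moreover have "R * (2 * tol) + R * (2 * core * tol) < R * (core * core / 4)"
      using R by (simp add: distrib_left[symmetric])
    ultimately show "(\<Sum>i\<in>transversal v R \<union> transversal v' R. measure lborel (P i \<inter> ?S)) + 8 * (core * R / 4) * \<rho> < 4 * (core * R / 4) * (core / 4)"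
      using 1 by linarith
  qed (use t0 that in auto)
  have g: "p i \<noteq> 0" "\<bar>p i * v + q i\<bar> \<le> 4 * tol * \<bar>p i\<bar> * R" "\<bar>p i * v' + q i\<bar> \<le> 4 * tol * \<bar>p i\<bar> * R"
    using aligned_strip_slope[of i v R] aligned_strip_slope[of i v' R] i R by auto
  have "\<bar>p i\<bar> * \<bar>v - v'\<bar> = \<bar>(p i * v + q i) - (p i * v' + q i)\<bar>" by (simp add: abs_mult[symmetric] algebra_simps)
  also have "\<dots> \<le> \<bar>p i\<bar> * (8 * tol * R)" using g(2,3) by linarith
  finally show ?case using g(1) by (simp add: R_def)
qed

text \<open>Otherwise there are slopes at all widths \<open>R = rad n\<close>.  A strip which is not transversal and
meets the slab of width \<open>R\<close> about \<open>(z, t0)\<close> then contains a point within distance \<open>R\<close> of \<open>(z, t0)\<close>, but the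
strips form a closed set, which \<open>(z, t0)\<close> avoids.\<close>

lemma chain_stops:
  assumes t0: "\<bar>t0\<bar> \<le> \<rho>" and z: "(z, t0) \<in> Z"
  shows "\<exists>n v. chain t0 z n v \<and> emeasure excess (tube t0 z v (rad (Suc n))) > ennreal (\<delta> * rad (Suc n) / 2)"
proof (rule ccontr)
  assume neg: "\<not> ?thesis"
  have z\<rho>: "\<bar>z\<bar> \<le> \<rho>" using Z_snd(2)[OF z] by simp
  have all: "\<exists>v. chain t0 z n v" for n
  proof (induction n)
    case 0
    show ?case using aligned_base[OF t0 z\<rho>] by (intro exI[of _ 0] chain.zero) simp
  next
    case (Suc n)
    then obtain v where v: "chain t0 z n v" by blast
    have "\<exists>v'. aligned t0 z (rad (Suc n)) v' \<and> \<bar>v' - v\<bar> \<le> 20 * tol * rad (Suc n)"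
    proof (rule aligned_step[OF t0 z\<rho> chain_small[OF v]])
      show "aligned t0 z (2 * rad (Suc n)) v" using chain_aligned[OF v] by simp
      show "emeasure excess (tube t0 z v (rad (Suc n))) \<le> ennreal (\<delta> * rad (Suc n) / 2)" using neg v by (meson not_le)
      show "rad (Suc n) \<le> 1/2" using power_le_one[of "1/2::real" n] by simp
    qed simp
    then show ?case using chain.Suc[OF v] by fastforce
  qed
  have "open (- (\<Union>i\<in>I. P i))" using fin by (intro open_Compl closed_UN) (auto simp: P_def strip_closed)
  moreover have "(z, t0) \<in> - (\<Union>i\<in>I. P i)" using z by (auto simp: Z_def)
  ultimately obtain \<epsilon> where \<epsilon>: "\<epsilon> > 0" "ball (z, t0) \<epsilon> \<subseteq> - (\<Union>i\<in>I. P i)" by (meson open_contains_ball)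
  obtain n where n: "rad n < \<epsilon>" using real_arch_pow_inv[of \<epsilon> "1/2"] \<epsilon> by auto
  define R where "R = rad n"
  have R: "R > 0" "R \<le> 1" using power_le_one[of "1/2::real" n] by (simp_all add: R_def)
  obtain v where v: "chain t0 z n v" using all by blast
  let ?S = "slab t0 z v (core * R / 2) core"
  obtain y i where yi: "y \<in> ?S" "i \<in> I - transversal v R" "y \<in> P i"
  proof (rule untouched_strip[OF refl])
    show "?S \<subseteq> cball 0 2"
      by (rule slab_in_ball) (use t0 z\<rho> R chain_small[OF v] in auto)
    show "0 \<le> core * R / 2" "0 \<le> core" using R by auto
    show "transversal v R \<subseteq> I" by (auto simp: transversal_def)
    have "(\<Sum>i\<in>transversal v R. measure lborel (P i \<inter> ?S)) \<le> (\<Sum>i\<in>transversal v R. measure lborel (P i \<inter> slab t0 z v (R * core) core))"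
      by (intro sum_mono measure_P_mono slab_mono slab_borel slab_bounded) (use R in simp_all)
    also have "\<dots> \<le> R * tol" using chain_aligned[OF v] by (simp add: aligned_def R_def mult.commute)
    finally have 1: "(\<Sum>i\<in>transversal v R. measure lborel (P i \<inter> ?S)) \<le> R * tol" .
    have "8 * (core * R / 2) * \<rho> \<le> 8 * (core * R / 2) * tol" using R \<rho> by (intro mult_left_mono) auto
    then have "8 * (core * R / 2) * \<rho> \<le> R * (4 * core * tol)" by simp
    moreover have "R * tol + R * (4 * core * tol) < R * (2 * core * core)"
      using R by (simp add: distrib_left[symmetric])
    ultimately show "(\<Sum>i\<in>transversal v R. measure lborel (P i \<inter> ?S)) + 8 * (core * R / 2) * \<rho> < 4 * (core * R / 2) * core"
      using 1 by linarith
  qed (use t0 that in auto)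
  have g: "p i \<noteq> 0" "\<bar>p i * v + q i\<bar> \<le> 4 * tol * \<bar>p i\<bar> * R"
    using aligned_strip_slope[of i v R] yi R by auto
  \<comment> \<open>Slide \<open>y\<close> along strip \<open>i\<close> to the height \<open>t0\<close>.\<close>
  define x where "x = fst y + q i / p i * (snd y - t0)"
  have "p i * x + q i * t0 = p i * fst y + q i * snd y" using g by (simp add: x_def field_simps)
  then have xP: "(x, t0) \<in> P i" using yi by (simp add: P_def strip_def)
  have y: "\<bar>fst y - z - v * (snd y - t0)\<bar> \<le> core * R / 2" "\<bar>snd y - t0\<bar> \<le> core" using yi by (simp_all add: slab_def)
  have "\<bar>v + q i / p i\<bar> \<le> 4 * tol * R"
  proof -
    have "\<bar>p i\<bar> * \<bar>v + q i / p i\<bar> = \<bar>p i * v + q i\<bar>" using g by (simp add: abs_mult[symmetric] distrib_left)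
    also have "\<dots> \<le> \<bar>p i\<bar> * (4 * tol * R)" using g(2) by (simp add: mult_ac)
    finally show ?thesis using g(1) by simp
  qed
  then have "\<bar>(v + q i / p i) * (snd y - t0)\<bar> \<le> (4 * tol * R) * core" unfolding abs_mult using y R by (intro mult_mono) auto
  moreover have "x - z = (fst y - z - v * (snd y - t0)) + (v + q i / p i) * (snd y - t0)" by (simp add: x_def algebra_simps)
  ultimately have "\<bar>x - z\<bar> \<le> core * R / 2 + (4 * tol * R) * core"
    by (simp only:) (rule order_trans[OF abs_triangle_ineq add_mono[OF y(1)]])
  also have "\<dots> < R" using R by simp
  also have "\<dots> < \<epsilon>" using n by (simp add: R_def)
  finally have "(x, t0) \<in> ball (z, t0) \<epsilon>" by (simp add: dist_Pair_Pair dist_real_def abs_minus_commute)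
  with \<epsilon> xP yi show False by blast
qed

text \<open>Since the tubes have height about 1, they can only be disjoint if \<open>|v - v'|\<close> is at most a fixed
fraction of \<open>|z - z'|\<close>.  At the finest common width for which the points count as near, which is comparable with
\<open>|z - z'|\<close>, the directions agree by \<open>chain_agree\<close>; the later changes of direction form a geometric
series.\<close>

lemma tubes_disjoint:
  assumes t0: "\<bar>t0\<bar> \<le> \<rho>" and z: "\<bar>z\<bar> \<le> \<rho>" "\<bar>z'\<bar> \<le> \<rho>"
    and c: "chain t0 z n v" "chain t0 z' n' v'" and le: "n \<le> n'"
    and far: "\<bar>z - z'\<bar> > 4 * rad (Suc n) + 4 * rad (Suc n')"
  shows "tube t0 z v (rad (Suc n)) \<inter> tube t0 z' v' (rad (Suc n')) = {}"
proof -
  have close: "\<bar>v - v'\<bar> \<le> \<bar>z - z'\<bar> / 4"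
  proof -
    have \<rho>': "2 * \<rho> \<le> core * rad 0 / 2" using \<rho> by simp
    have ex0: "\<bar>z - z'\<bar> \<le> core * rad 0 / 2" using z \<rho>' by linarith
    \<comment> \<open>The finest width at which \<open>chain_agree\<close> still applies to the two points.\<close>
    define k where "k = (GREATEST k. k \<le> n \<and> \<bar>z - z'\<bar> \<le> core * rad k / 2)"
    have kp: "k \<le> n \<and> \<bar>z - z'\<bar> \<le> core * rad k / 2"
      unfolding k_def by (rule GreatestI_nat[where k=0 and b=n]) (use ex0 in auto)
    have kmax: "j \<le> k" if "j \<le> n" "\<bar>z - z'\<bar> \<le> core * rad j / 2" for j
      unfolding k_def by (rule Greatest_le_nat[where b=n]) (use that in auto)
    obtain u where u: "chain t0 z k u" "\<bar>v - u\<bar> \<le> 20 * tol * (rad k - rad n)" using chain_drift[OF c(1)] kp by blast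
    obtain u' where u': "chain t0 z' k u'" "\<bar>v' - u'\<bar> \<le> 20 * tol * (rad k - rad n')" using chain_drift[OF c(2), of k] kp le by auto
    have "\<bar>u - u'\<bar> \<le> 8 * tol * rad k" by (rule chain_agree[OF t0 z u(1) u'(1)]) (use kp in simp)
    moreover have "20 * tol * (rad k - rad n) \<le> 20 * tol * rad k" "20 * tol * (rad k - rad n') \<le> 20 * tol * rad k"
      by (intro mult_left_mono; simp)+
    ultimately have vk: "\<bar>v - v'\<bar> \<le> 48 * tol * rad k" using u(2) u'(2) by linarith
    have "core * rad k / 4 \<le> \<bar>z - z'\<bar>"
    proof (cases "k = n")
      case True
      have "rad (Suc n') > 0" "rad (Suc n) = rad k / 2" using True by simp_all
      then have "2 * rad k \<le> \<bar>z - z'\<bar>" using far by linarith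
      moreover have "core * rad k / 4 \<le> 2 * rad k" by simp
      ultimately show ?thesis by linarith
    next
      case False
      then have "\<not> \<bar>z - z'\<bar> \<le> core * rad (Suc k) / 2" using kmax[of "Suc k"] kp by auto
      then show ?thesis by simp
    qed
    moreover have "48 * tol * rad k \<le> (core * rad k / 4) / 4" by simp
    ultimately show ?thesis using vk by (meson divide_right_mono order_trans zero_le_numeral)
  qed
  show ?thesis
  proof (rule ccontr)
    assume "\<not> ?thesis"
    then obtain y where y: "y \<in> tube t0 z v (rad (Suc n))" "y \<in> tube t0 z' v' (rad (Suc n'))" by blast
    have 1: "\<bar>fst y - z - v * (snd y - t0)\<bar> \<le> rad (Suc n)" "\<bar>snd y - t0\<bar> \<le> 1"
      using tube_subset_slab[of "rad (Suc n)" t0 z v] y(1) by (auto simp: slab_def)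
    have 2: "\<bar>fst y - z' - v' * (snd y - t0)\<bar> \<le> rad (Suc n')"
      using tube_subset_slab[of "rad (Suc n')" t0 z' v'] y(2) by (auto simp: slab_def)
    have 3: "\<bar>(v - v') * (snd y - t0)\<bar> \<le> \<bar>z - z'\<bar> / 4 * 1" unfolding abs_mult using close 1 by (intro mult_mono) auto
    have "z - z' = (fst y - z' - v' * (snd y - t0)) - (fst y - z - v * (snd y - t0)) - (v - v') * (snd y - t0)"
      by (simp add: algebra_simps)
    then have "\<bar>z - z'\<bar> \<le> rad (Suc n) + rad (Suc n') + \<bar>z - z'\<bar> / 4" using 1 2 3 by linarith
    with far have "\<bar>z - z'\<bar> < \<bar>z - z'\<bar> / 4 + \<bar>z - z'\<bar> / 4" by linarith
    then show False by simp
  qed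
qed

end

section \<open>Slices of the hole are paid for by overlap\<close>

lemma cball_real_disjoint_far:
  assumes "cball (x::real) r \<inter> cball y s = {}" "r > 0" "s > 0"
  shows "\<bar>x - y\<bar> > r + s"
proof (rule ccontr)
  assume n: "\<not> \<bar>x - y\<bar> > r + s"
  define u where "u = x + r / (r + s) * (y - x)"
  have rs: "r + s > 0" using assms by simp
  have "\<bar>u - x\<bar> = r / (r + s) * \<bar>x - y\<bar>" using assms by (simp add: u_def abs_mult abs_minus_commute)
  also have "\<dots> \<le> r / (r + s) * (r + s)" using n assms by (intro mult_left_mono) auto
  also have "\<dots> = r" using rs by simp
  finally have 1: "\<bar>u - x\<bar> \<le> r" .
  have "u - y = s / (r + s) * (x - y)" using rs by (simp add: u_def field_simps)
  then have "\<bar>u - y\<bar> = s / (r + s) * \<bar>x - y\<bar>" using assms by (simp add: abs_mult)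
  also have "\<dots> \<le> s / (r + s) * (r + s)" using n assms by (intro mult_left_mono) auto
  also have "\<dots> = s" using rs by simp
  finally have 2: "\<bar>u - y\<bar> \<le> s" .
  have "u \<in> cball x r \<inter> cball y s" using 1 2 by (simp add: dist_real_def abs_minus_commute)
  with assms show False by blast
qed

context holed begin

text \<open>Vitali applied to intervals of length proportional to the widths of the tubes given by \<open>chain_stops\<close>.
The factor 4 in the radius of the intervals is the separation asked for in \<open>tubes_disjoint\<close>.\<close>

lemma slice_bound:
  assumes t0: "\<bar>t0\<bar> \<le> \<rho>"
  shows "emeasure lborel {x. (x, t0) \<in> Z} \<le> ennreal (80 / \<delta>) * emeasure excess (cball 0 2)"
proof -
  define G where "G = {x. (x, t0) \<in> Z}"
  have "\<forall>z\<in>G. \<exists>nv. chain t0 z (fst nv) (snd nv) \<and> emeasure excess (tube t0 z (snd nv) (rad (Suc (fst nv)))) > ennreal (\<delta> * rad (Suc (fst nv)) / 2)"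
    using chain_stops[OF t0] by (force simp: G_def)
  from bchoice[OF this] obtain f where f: "\<forall>z\<in>G. chain t0 z (fst (f z)) (snd (f z)) \<and>
      emeasure excess (tube t0 z (snd (f z)) (rad (Suc (fst (f z))))) > ennreal (\<delta> * rad (Suc (fst (f z))) / 2)" by blast
  define R where "R z = rad (Suc (fst (f z)))" for z
  have R: "R z > 0" "R z \<le> 1/2" for z using power_le_one[of "1/2::real" "fst (f z)"] by (auto simp: R_def)
  have ch: "chain t0 z (fst (f z)) (snd (f z))" and big: "emeasure excess (tube t0 z (snd (f z)) (R z)) \<ge> ennreal (\<delta> * R z / 2)" if "z \<in> G" for z
    using f that by (auto simp: R_def less_imp_le)
  have G\<rho>: "\<bar>z\<bar> \<le> \<rho>" if "z \<in> G" for z using Z_snd(2)[of "(z, t0)"] that by (simp add: G_def)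
  have cov: "G \<subseteq> (\<Union>z\<in>G. cball z (4 * R z))" using R(1) by (auto simp: less_imp_le)
  obtain C where C: "countable C" "C \<subseteq> G"
     "pairwise (\<lambda>i j. disjnt (cball i (4 * R i)) (cball j (4 * R j))) C"
     "G \<subseteq> (\<Union>i\<in>C. cball i (5 * (4 * R i)))"
  proof (rule Vitali_covering_lemma_cballs[OF cov, where B=2])
    show "0 < 4 * R i \<and> 4 * R i \<le> 2" if "i \<in> G" for i using R(1,2)[of i] by simp
  qed (rule that)
  have "emeasure lborel G \<le> ennreal (80 / \<delta>) * emeasure excess (cball 0 2)"
  proof (rule emeasure_le_by_disjoint[OF C(1), where E="\<lambda>z. cball z (5 * (4 * R z))" and T="\<lambda>z. tube t0 z (snd (f z)) (R z)"])
    show "G \<subseteq> (\<Union>i\<in>C. cball i (5 * (4 * R i)))" by (rule C(4))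
    show "disjoint_family_on (\<lambda>z. tube t0 z (snd (f z)) (R z)) C"
      unfolding disjoint_family_on_def
    proof (intro ballI impI)
      fix z z' assume zz: "z \<in> C" "z' \<in> C" "z \<noteq> z'"
      then have zG: "z \<in> G" "z' \<in> G" using C(2) by auto
      have "cball z (4 * R z) \<inter> cball z' (4 * R z') = {}" using C(3) zz by (auto simp: pairwise_def disjnt_def)
      then have far: "\<bar>z - z'\<bar> > 4 * R z + 4 * R z'" by (rule cball_real_disjoint_far) (use R in auto)
      show "tube t0 z (snd (f z)) (R z) \<inter> tube t0 z' (snd (f z')) (R z') = {}"
      proof (cases "fst (f z) \<le> fst (f z')")
        case True
        show ?thesis unfolding R_def
          by (rule tubes_disjoint[OF t0 G\<rho>[OF zG(1)] G\<rho>[OF zG(2)] ch[OF zG(1)] ch[OF zG(2)] True])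
             (use far in \<open>simp only: R_def\<close>)
      next
        case False
        have "tube t0 z' (snd (f z')) (R z') \<inter> tube t0 z (snd (f z)) (R z) = {}" unfolding R_def
          by (rule tubes_disjoint[OF t0 G\<rho>[OF zG(2)] G\<rho>[OF zG(1)] ch[OF zG(2)] ch[OF zG(1)]])
             (use far False in \<open>simp_all only: R_def abs_minus_commute[of z] add.commute nat_le_linear not_le less_imp_le\<close>)
        then show ?thesis by blast
      qed
    qed
  next
    fix z assume "z \<in> C"
    then have z: "z \<in> G" using C by auto
    have "tube t0 z (snd (f z)) (R z) \<subseteq> slab t0 z (snd (f z)) (R z) 1" by (rule tube_subset_slab) (rule R)
    also have "\<dots> \<subseteq> cball 0 2" by (rule slab_in_ball) (use t0 G\<rho>[OF z] R chain_small[OF ch[OF z]] in auto)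
    finally show "tube t0 z (snd (f z)) (R z) \<subseteq> cball 0 2" .
    have "emeasure lborel (cball z (5 * (4 * R z))) = ennreal (40 * R z)"
      using R(1)[of z] by (simp add: cball_eq_atLeastAtMost)
    also have "40 * R z = (80 / \<delta>) * (\<delta> * R z / 2)" using \<delta> by simp
    also have "ennreal \<dots> = ennreal (80 / \<delta>) * ennreal (\<delta> * R z / 2)" using \<delta> R(1)[of z] by (intro ennreal_mult) auto
    also have "\<dots> \<le> ennreal (80 / \<delta>) * emeasure excess (tube t0 z (snd (f z)) (R z))" by (intro mult_left_mono big z) simp
    finally show "emeasure lborel (cball z (5 * (4 * R z))) \<le> ennreal (80 / \<delta>) * emeasure excess (tube t0 z (snd (f z)) (R z))" .
  qed simp_all
  then show ?thesis by (simp add: G_def)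
qed

lemma hole_bound: "emeasure lborel Z \<le> ennreal (160 * \<rho> / \<delta>) * emeasure excess (cball 0 2)"
proof -
  have "emeasure lborel Z = (\<integral>\<^sup>+y. indicator Z y \<partial>lborel)" by simp
  also have "\<dots> = (\<integral>\<^sup>+t. (\<integral>\<^sup>+x. indicator Z (x, t) \<partial>lborel) \<partial>lborel)"
    by (rule nn_integral_lborel_plane(2)) simp
  also have "\<dots> \<le> (\<integral>\<^sup>+t. (ennreal (80 / \<delta>) * emeasure excess (cball 0 2)) * indicator {-\<rho>..\<rho>} t \<partial>lborel)"
  proof (rule nn_integral_mono)
    fix t :: real
    show "(\<integral>\<^sup>+x. indicator Z (x, t) \<partial>lborel) \<le> (ennreal (80 / \<delta>) * emeasure excess (cball 0 2)) * indicator {-\<rho>..\<rho>} t"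
    proof (cases "t \<in> {-\<rho>..\<rho>}")
      case True
      have [measurable]: "{x. (x, t) \<in> Z} \<in> sets borel" by measurable
      have "(\<integral>\<^sup>+x. indicator Z (x, t) \<partial>lborel) = (\<integral>\<^sup>+x. indicator {x. (x, t) \<in> Z} x \<partial>lborel)"
        by (intro nn_integral_cong) (simp split: split_indicator)
      also have "\<dots> = emeasure lborel {x. (x, t) \<in> Z}" by (rule nn_integral_indicator) simp
      also have "\<dots> \<le> ennreal (80 / \<delta>) * emeasure excess (cball 0 2)" by (rule slice_bound) (use True in auto)
      finally show ?thesis using True by simp
    next
      case False
      then have "indicator Z (x, t) = (0::ennreal)" for x using Z_snd(1)[of "(x, t)"] by (auto split: split_indicator)
      then show ?thesis by simp
    qed
  qed
  also have "\<dots> = (ennreal (80 / \<delta>) * emeasure excess (cball 0 2)) * ennreal (2 * \<rho>)"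
    using \<rho> by (subst nn_integral_cmult_indicator) auto
  also have "\<dots> = (ennreal (80 / \<delta>) * ennreal (2 * \<rho>)) * emeasure excess (cball 0 2)" by (simp only: mult_ac)
  also have "ennreal (80 / \<delta>) * ennreal (2 * \<rho>) = ennreal (160 * \<rho> / \<delta>)"
    using \<rho> \<delta> by (subst ennreal_mult[symmetric]) auto
  finally show ?thesis .
qed

end

text \<open>If the excess is at least \<open>\<delta> / 2\<close>, the trivial bound \<open>|Z| \<le> 4 * \<rho>\<^sup>2\<close> suffices.  Otherwise the family nearly tiles the unit disc, and the
common direction is rotated to the vertical.\<close>

theorem overlap_dominates_hole:
  obtains c \<rho>0 :: real where "c > 0" "\<rho>0 > 0" "\<rho>0 \<le> 1"
    "\<And>I p q a b \<rho>. strips I p q \<Longrightarrow> 0 < \<rho> \<Longrightarrow> \<rho> \<le> \<rho>0 \<Longrightarrow> strips.Z I p q a b \<subseteq> cball 0 \<rho> \<Longrightarrow>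
       ennreal c * emeasure lborel (strips.Z I p q a b) \<le> ennreal \<rho> * emeasure (strips.excess I p q a b) (cball 0 2)"
proof -
  obtain \<delta> where \<delta>: "\<delta> > 0" and rig:
    "\<And>I p q a b. strips I p q \<Longrightarrow> emeasure (strips.deviation I p q a b) (cball 0 1) \<le> ennreal \<delta> \<Longrightarrow>
      \<exists>\<alpha> \<beta>. \<alpha>\<^sup>2 + \<beta>\<^sup>2 = 1 \<and>
       (\<Sum>i\<in>{i\<in>I. \<bar>p i * \<alpha> + q i * \<beta>\<bar> \<ge> tol}. measure lborel (strips.P p q a b i \<inter> cball 0 (1/800))) \<le> tol"
    using rigidity_constant[of tol] by auto
  define \<rho>0 where "\<rho>0 = min tol (\<delta> / 16)"
  have \<rho>0: "\<rho>0 > 0" "\<rho>0 \<le> 1" "\<rho>0 \<le> tol" "\<rho>0 \<le> \<delta> / 16" using \<delta> by (auto simp: \<rho>0_def)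
  show thesis
  proof (rule that[of "\<delta> / 160" \<rho>0])
    fix I p q a b \<rho>
    assume st: "strips I p q" and \<rho>: "0 < \<rho>" "\<rho> \<le> \<rho>0" and Zsub: "strips.Z I p q a b \<subseteq> cball 0 \<rho>"
    interpret strips I p q a b by (rule st)
    have \<rho>': "\<rho> \<le> 1" "\<rho> \<le> tol" "\<rho> \<le> \<delta> / 16" using \<rho> \<rho>0 by auto
    have Zle: "emeasure lborel Z \<le> ennreal (4 * \<rho>\<^sup>2)"
    proof -
      have "emeasure lborel Z \<le> emeasure lborel (cball (0::real\<times>real) \<rho>)" using Zsub by (intro emeasure_mono) auto
      also have "\<dots> \<le> ennreal (4 * \<rho>\<^sup>2)"
        using \<rho> pi_less_4 by (auto simp: emeasure_cball_plane intro!: ennreal_leI mult_right_mono)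
      finally show ?thesis .
    qed
    show "ennreal (\<delta> / 160) * emeasure lborel Z \<le> ennreal \<rho> * emeasure excess (cball 0 2)"
    proof (cases "emeasure excess (cball 0 2) \<ge> ennreal (\<delta> / 2)")
      case True
      have "ennreal (\<delta> / 160) * emeasure lborel Z \<le> ennreal (\<delta> / 160) * ennreal (4 * \<rho>\<^sup>2)"
        using Zle by (rule mult_left_mono) simp
      also have "\<dots> = ennreal (\<delta> / 160 * (4 * \<rho>\<^sup>2))" using \<delta> by (intro ennreal_mult[symmetric]) auto
      also have "\<dots> \<le> ennreal (\<rho> * (\<delta> / 2))"
      proof (rule ennreal_leI)
        have "\<rho> * \<rho> \<le> \<rho> * 1" using \<rho> \<rho>' by (intro mult_left_mono) auto
        then have "\<delta> * (\<rho> * \<rho>) \<le> \<delta> * \<rho>" using \<delta> by simp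
        moreover have "\<delta> * \<rho> \<ge> 0" using \<delta> \<rho> by simp
        moreover have "\<delta> / 160 * (4 * \<rho>\<^sup>2) = \<delta> * (\<rho> * \<rho>) / 40" "\<rho> * (\<delta> / 2) = \<delta> * \<rho> / 2"
          by (simp_all add: power2_eq_square)
        ultimately show "\<delta> / 160 * (4 * \<rho>\<^sup>2) \<le> \<rho> * (\<delta> / 2)" by linarith
      qed
      also have "\<dots> = ennreal \<rho> * ennreal (\<delta> / 2)" using \<delta> \<rho> by (intro ennreal_mult) auto
      also have "\<dots> \<le> ennreal \<rho> * emeasure excess (cball 0 2)" using True by (rule mult_left_mono) simp
      finally show ?thesis .
    next
      case False
      have dev: "emeasure deviation (cball 0 1) \<le> ennreal \<delta>"
      proof -
        have "emeasure deviation (cball 0 1) \<le> emeasure excess (cball 0 1) + emeasure lborel (Z \<inter> cball 0 1)"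
          by (rule deviation_le_excess) auto
        also have "\<dots> \<le> emeasure excess (cball 0 2) + emeasure lborel Z" by (intro add_mono emeasure_mono) auto
        also have "\<dots> \<le> ennreal (\<delta> / 2) + ennreal (4 * \<rho>\<^sup>2)" using False Zle by (intro add_mono) auto
        also have "\<dots> = ennreal (\<delta> / 2 + 4 * \<rho>\<^sup>2)" using \<delta> by (subst ennreal_plus) auto
        also have "\<dots> \<le> ennreal \<delta>"
        proof (rule ennreal_leI)
          have "\<rho> * \<rho> \<le> \<rho> * 1" using \<rho> \<rho>' by (intro mult_left_mono) auto
          then show "\<delta> / 2 + 4 * \<rho>\<^sup>2 \<le> \<delta>" using \<rho>' \<delta> unfolding power2_eq_square by linarith
        qed
        finally show ?thesis .
      qed
      obtain \<alpha> \<beta> where ab: "\<alpha>\<^sup>2 + \<beta>\<^sup>2 = 1" and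
        sm: "(\<Sum>i\<in>{i\<in>I. \<bar>p i * \<alpha> + q i * \<beta>\<bar> \<ge> tol}. measure lborel (P i \<inter> cball 0 (1/800))) \<le> tol"
        using rig[OF st dev] by blast
      obtain p' q' a' b' where rt: "strips I p' q'"
        "\<And>j. j \<in> I \<Longrightarrow> q' j = p j * \<alpha> + q j * \<beta>"
        "\<And>j. j \<in> I \<Longrightarrow> strips.P p' q' a' b' j = rot \<alpha> \<beta> -` P j"
        "\<And>y. strips.m I p' q' a' b' y = m (rot \<alpha> \<beta> y)"
        using rotate[OF ab] by metis
      interpret S': strips I p' q' a' b' by (rule rt(1))
      note vb = rot_vimage_cball[OF ab] and meas = emeasure_rot_vimage[OF ab]
      have Z': "S'.Z = rot \<alpha> \<beta> -` Z"
        unfolding S'.Z_def Z_def vimage_Diff vimage_UN vb using rt(3) by simp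
      have excess': "emeasure S'.excess (cball 0 2) = emeasure excess (cball 0 2)"
      proof -
        have "emeasure excess (cball 0 2) = ennreal \<bar>\<beta> * \<beta> - (- \<alpha>) * \<alpha>\<bar> *
            (\<integral>\<^sup>+y. ennreal (max 0 (m (rot \<alpha> \<beta> y) - 1)) * indicator (cball 0 2) (rot \<alpha> \<beta> y) \<partial>lborel)"
          unfolding emeasure_excess[OF borel_closed[OF closed_cball]]
        proof (rule nn_integral_aff)
          show "\<beta> * \<beta> - (- \<alpha>) * \<alpha> \<noteq> 0" using rot_det[OF ab] by simp
          have [measurable]: "cball (0::real\<times>real) 2 \<in> sets borel" by simp
          show "(\<lambda>y. ennreal (max 0 (m y - 1)) * indicator (cball 0 2) y) \<in> borel_measurable borel" by measurable
        qed
        also have "(\<integral>\<^sup>+y. ennreal (max 0 (m (rot \<alpha> \<beta> y) - 1)) * indicator (cball 0 2) (rot \<alpha> \<beta> y) \<partial>lborel) = emeasure S'.excess (cball 0 2)"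
          unfolding S'.emeasure_excess[OF borel_closed[OF closed_cball]] rt(4)
        proof (intro nn_integral_cong)
          fix y
          have "rot \<alpha> \<beta> y \<in> cball 0 2 \<longleftrightarrow> y \<in> cball 0 2" using vb[of 2] by blast
          then show "ennreal (max 0 (m (rot \<alpha> \<beta> y) - 1)) * indicator (cball 0 2) (rot \<alpha> \<beta> y) = ennreal (max 0 (m (rot \<alpha> \<beta> y) - 1)) * indicator (cball 0 2) y"
            by (simp split: split_indicator)
        qed
        finally show ?thesis unfolding rot_det[OF ab] by simp
      qed
      interpret H: holed I p' q' a' b' \<delta> \<rho>
      proof
        show "\<delta> > 0" by (rule \<delta>)
        show "0 < \<rho>" "\<rho> \<le> tol" "\<rho> \<le> \<delta> / 16" using \<rho> \<rho>' by auto
        show "cball 0 2 - (\<Union>i\<in>I. S'.P i) \<subseteq> cball 0 \<rho>"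
          using vimage_mono[OF Zsub, of "rot \<alpha> \<beta>"] unfolding S'.Z_def[symmetric] Z' vb .
        have "(\<Sum>i\<in>{i\<in>I. \<bar>q' i\<bar> \<ge> tol}. measure lborel (S'.P i \<inter> cball 0 (1/800))) = 
           (\<Sum>i\<in>{i\<in>I. \<bar>p i * \<alpha> + q i * \<beta>\<bar> \<ge> tol}. measure lborel (P i \<inter> cball 0 (1/800)))"
        proof (rule sum.cong)
          show "{i\<in>I. \<bar>q' i\<bar> \<ge> tol} = {i\<in>I. \<bar>p i * \<alpha> + q i * \<beta>\<bar> \<ge> tol}" using rt(2) by auto
          fix i assume "i \<in> {i\<in>I. \<bar>p i * \<alpha> + q i * \<beta>\<bar> \<ge> tol}"
          then have "S'.P i \<inter> cball 0 (1/800) = rot \<alpha> \<beta> -` (P i \<inter> cball 0 (1/800))" using rt(3)[of i] unfolding vimage_Int vb by simp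
          moreover have "P i \<inter> cball 0 (1/800) \<in> sets borel" by (intro sets.Int) auto
          ultimately show "measure lborel (S'.P i \<inter> cball 0 (1/800)) = measure lborel (P i \<inter> cball 0 (1/800))"
            unfolding measure_def using meas by metis
        qed
        with sm show "(\<Sum>i\<in>{i\<in>I. \<bar>q' i\<bar> \<ge> tol}. measure lborel (S'.P i \<inter> cball 0 (1/800))) \<le> tol" by simp
      qed (use rig in blast)
      have "emeasure lborel Z = emeasure lborel S'.Z" unfolding Z' by (rule meas[symmetric]) simp
      also have "\<dots> \<le> ennreal (160 * \<rho> / \<delta>) * emeasure excess (cball 0 2)" using H.hole_bound excess' by simp
      finally have "ennreal (\<delta> / 160) * emeasure lborel Z \<le> ennreal (\<delta> / 160) * (ennreal (160 * \<rho> / \<delta>) * emeasure excess (cball 0 2))"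
        by (rule mult_left_mono) simp
      also have "\<dots> = (ennreal (\<delta> / 160) * ennreal (160 * \<rho> / \<delta>)) * emeasure excess (cball 0 2)" by (simp only: mult.assoc)
      also have "ennreal (\<delta> / 160) * ennreal (160 * \<rho> / \<delta>) = ennreal \<rho>"
        using \<delta> \<rho> by (subst ennreal_mult[symmetric]) auto
      finally show ?thesis .
    qed
  qed (use \<delta> \<rho>0 in auto)
qed

section \<open>Normalising a symmetric convex body\<close>

definition det2 :: "real ^ 2 \<Rightarrow> real ^ 2 \<Rightarrow> real" where "det2 u v = u $ 1 * v $ 2 - u $ 2 * v $ 1"

lemma det2_add: "det2 (u + u') v = det2 u v + det2 u' v" "det2 u (v + v') = det2 u v + det2 u v'"
  and det2_scale: "det2 (c *\<^sub>R u) v = c * det2 u v" "det2 u (c *\<^sub>R v) = c * det2 u v"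
  and det2_minus: "det2 (- u) v = - det2 u v" "det2 u (- v) = - det2 u v"
  by (simp_all add: det2_def algebra_simps)

lemma det2_cramer: "det2 u v *\<^sub>R x = det2 x v *\<^sub>R u + det2 u x *\<^sub>R v"
  by (simp add: vec_eq_iff forall_2 det2_def algebra_simps)

lemma symmetric_minus: "origin_symmetric K \<Longrightarrow> x \<in> K \<Longrightarrow> - x \<in> K"
  unfolding origin_symmetric_def by auto

lemma symmetric_zero:
  assumes "convex_body K" "origin_symmetric K" shows "0 \<in> K"
proof -
  obtain x where x: "x \<in> K" using assms(1) interior_subset unfolding convex_body_def by blast
  have "- x \<in> K" using symmetric_minus[OF assms(2) x] .
  then have "(1/2) *\<^sub>R x + (1/2) *\<^sub>R (- x) \<in> K"
    using x assms(1) unfolding convex_body_def by (intro convexD) auto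
  then show ?thesis by simp
qed

text \<open>By Cramer's rule the coordinates with respect to \<open>e\<close> and \<open>f\<close> of all points of \<open>K\<close> are at most 1 in absolute
value.  So \<open>K\<close> lies in the parallelogram spanned by \<open>e\<close> and \<open>f\<close> with both signs, and it contains the convex hull
of \<open>e\<close>, \<open>f\<close>, \<open>- e\<close> and \<open>- f\<close>.\<close>

lemma maximal_basis:
  assumes K: "convex_body K" "origin_symmetric K"
  obtains e f where "e \<in> K" "f \<in> K" "det2 e f > 0" "\<And>x y. x \<in> K \<Longrightarrow> y \<in> K \<Longrightarrow> \<bar>det2 x y\<bar> \<le> det2 e f"
proof -
  have cK: "compact K" using K by (simp add: convex_body_def)
  have z: "0 \<in> K" by (rule symmetric_zero[OF K])
  have "compact (K \<times> K)" "K \<times> K \<noteq> {}" using cK z by (auto intro: compact_Times)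
  moreover have "continuous_on (K \<times> K) (\<lambda>w. det2 (fst w) (snd w))"
    unfolding det2_def by (intro continuous_intros)
  ultimately obtain w where w: "w \<in> K \<times> K" "\<And>w'. w' \<in> K \<times> K \<Longrightarrow> det2 (fst w') (snd w') \<le> det2 (fst w) (snd w)"
    by (meson continuous_attains_sup)
  define e where "e = fst w"
  define f where "f = snd w"
  have ef: "e \<in> K" "f \<in> K" using w by (auto simp: e_def f_def)
  have le: "det2 x y \<le> det2 e f" if "x \<in> K" "y \<in> K" for x y using w(2)[of "(x, y)"] that by (simp add: e_def f_def)
  have abs: "\<bar>det2 x y\<bar> \<le> det2 e f" if "x \<in> K" "y \<in> K" for x y
    using le[OF that] le[OF symmetric_minus[OF K(2) that(1)] that(2)] by (simp add: det2_minus abs_le_iff)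
  have "det2 e f > 0"
  proof (rule ccontr)
    assume "\<not> det2 e f > 0"
    then have z: "det2 x y = 0" if "x \<in> K" "y \<in> K" for x y using abs[OF that] by linarith
    obtain c \<epsilon> where c: "\<epsilon> > 0" "cball c \<epsilon> \<subseteq> K"
      using K(1) unfolding convex_body_def by (metis ex_in_conv mem_interior_cball)
    have in1: "c + \<epsilon> *\<^sub>R axis i 1 \<in> K" for i :: 2
      using c by (intro subsetD[OF c(2)]) (simp add: dist_norm norm_axis_1)
    have cK: "c \<in> K" using c by auto
    have "det2 (c + \<epsilon> *\<^sub>R axis 1 1) (c + \<epsilon> *\<^sub>R axis 2 1) = \<epsilon>\<^sup>2 + (det2 c (c + \<epsilon> *\<^sub>R axis 2 1) + det2 (c + \<epsilon> *\<^sub>R axis 1 1) c - det2 c c)"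
      by (simp add: det2_def axis_def power2_eq_square algebra_simps)
    then have "\<epsilon>\<^sup>2 = 0" using z[OF in1 in1] z[OF cK in1] z[OF in1 cK] z[OF cK cK] by simp
    then show False using c by simp
  qed
  from that[OF ef this abs] show thesis .
qed

lemma vec2_measurable [measurable]: "(\<lambda>y :: real \<times> real. vector [fst y, snd y] :: real ^ 2) \<in> borel_measurable borel"
proof -
  have "(\<lambda>y :: real \<times> real. vector [fst y, snd y] :: real ^ 2) = (\<lambda>y. fst y *\<^sub>R axis 1 1 + snd y *\<^sub>R axis 2 1)"
    by (simp add: fun_eq_iff vec_eq_iff forall_2 axis_def)
  then show ?thesis
    by (simp only:) (intro borel_measurable_continuous_onI continuous_intros)
qed

lemma lborel_vec2: "(lborel :: (real ^ 2) measure) = distr lborel borel (\<lambda>y. vector [fst y, snd y])"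
proof (rule lborel_eqI)
  show "sets (distr lborel borel (\<lambda>y :: real \<times> real. vector [fst y, snd y] :: real ^ 2)) = sets borel" by simp
  fix l u :: "real ^ 2" assume le: "\<And>b. b \<in> Basis \<Longrightarrow> l \<bullet> b \<le> u \<bullet> b"
  have le': "l $ i \<le> u $ i" for i using le[of "axis i 1"] by (simp add: inner_axis axis_in_Basis_iff)
  have "emeasure (distr lborel borel (\<lambda>y :: real \<times> real. vector [fst y, snd y] :: real ^ 2)) (box l u)
     = emeasure lborel ((\<lambda>y :: real \<times> real. vector [fst y, snd y] :: real ^ 2) -` box l u)"
    by (subst emeasure_distr) auto
  also have "(\<lambda>y :: real \<times> real. vector [fst y, snd y] :: real ^ 2) -` box l u = {l $ 1<..<u $ 1} \<times> {l $ 2<..<u $ 2}"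
    by (auto simp: mem_box_cart forall_2)
  also have "emeasure lborel \<dots> = emeasure lborel {l $ 1<..<u $ 1} * emeasure lborel {l $ 2<..<u $ 2}"
    by (simp add: lborel_prod[symmetric] lborel.emeasure_pair_measure_Times)
  also have "\<dots> = ennreal ((u $ 1 - l $ 1) * (u $ 2 - l $ 2))" using le' by (simp add: ennreal_mult)
  also have "(u $ 1 - l $ 1) * (u $ 2 - l $ 2) = (\<Prod>b\<in>Basis. (u - l) \<bullet> b)"
  proof -
    have "(\<Prod>b\<in>Basis. (u - l) \<bullet> b) = (\<Prod>i\<in>UNIV. (u - l) \<bullet> axis i (1::real))"
      unfolding Basis_vec_def by (subst prod.reindex_bij_betw[symmetric, of "\<lambda>i. axis i 1" UNIV])
        (auto simp: bij_betw_def inj_on_def axis_eq_axis)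
    then show ?thesis by (simp add: inner_axis UNIV_2)
  qed
  finally show "emeasure (distr lborel borel (\<lambda>y :: real \<times> real. vector [fst y, snd y] :: real ^ 2)) (box l u) = (\<Prod>b\<in>Basis. (u - l) \<bullet> b)" .
qed

lemma emeasure_basis_change:
  fixes e f :: "real ^ 2"
  assumes B: "B \<in> sets borel" and d: "det2 e f > 0"
  shows "emeasure lborel B = ennreal (det2 e f) * emeasure lborel ((\<lambda>y. fst y *\<^sub>R e + snd y *\<^sub>R f) -` B)"
    and "(\<lambda>y. fst y *\<^sub>R e + snd y *\<^sub>R f) -` B \<in> sets borel"
proof -
  let ?J = "\<lambda>y :: real \<times> real. vector [fst y, snd y] :: real ^ 2"
  have JB: "?J -` B \<in> sets borel" using measurable_sets[OF vec2_measurable B] by simp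
  have det: "e $ 1 * f $ 2 - e $ 2 * f $ 1 \<noteq> 0" using d by (simp add: det2_def)
  have eq: "(\<lambda>y. fst y *\<^sub>R e + snd y *\<^sub>R f) = ?J \<circ> aff 0 (e $ 1) (f $ 1) (e $ 2) (f $ 2)"
    by (auto simp: fun_eq_iff vec_eq_iff forall_2 aff_def)
  have "emeasure lborel B = emeasure lborel (?J -` B)"
    using B by (subst lborel_vec2) (simp add: emeasure_distr)
  also have "\<dots> = ennreal \<bar>e $ 1 * f $ 2 - e $ 2 * f $ 1\<bar> * emeasure lborel (aff 0 (e $ 1) (f $ 1) (e $ 2) (f $ 2) -` (?J -` B))"
    by (rule emeasure_aff[OF JB det])
  finally show "emeasure lborel B = ennreal (det2 e f) * emeasure lborel ((\<lambda>y. fst y *\<^sub>R e + snd y *\<^sub>R f) -` B)"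
    using d by (simp add: eq vimage_comp det2_def)
  show "(\<lambda>y. fst y *\<^sub>R e + snd y *\<^sub>R f) -` B \<in> sets borel"
    using aff_vimage_borel[OF JB] by (simp add: eq vimage_comp)
qed

context strips begin

text \<open>Both sides integrate \<open>max 1 m\<close> over \<open>W\<close>.\<close>

lemma mass_identity:
  assumes W: "bounded W" "W \<in> sets borel"
  shows "ennreal (\<Sum>i\<in>I. measure lborel (P i \<inter> W)) + emeasure lborel (W - (\<Union>i\<in>I. P i)) = emeasure lborel W + emeasure excess W"
proof -
  have Hb: "W - (\<Union>i\<in>I. P i) \<in> sets borel" using W fin by auto
  have "ennreal (\<Sum>i\<in>I. measure lborel (P i \<inter> W)) = (\<integral>\<^sup>+y. ennreal (m y) * indicator W y \<partial>lborel)"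
    using W nn_integral_m by (simp add: emeasure_P_Int sum_ennreal)
  then have "ennreal (\<Sum>i\<in>I. measure lborel (P i \<inter> W)) + emeasure lborel (W - (\<Union>i\<in>I. P i)) =
     (\<integral>\<^sup>+y. ennreal (m y) * indicator W y + indicator (W - (\<Union>i\<in>I. P i)) y \<partial>lborel)"
    using W Hb by (subst nn_integral_add) auto
  also have "\<dots> = (\<integral>\<^sup>+y. indicator W y + ennreal (max 0 (m y - 1)) * indicator W y \<partial>lborel)"
  proof (intro nn_integral_cong)
    fix y
    show "ennreal (m y) * indicator W y + indicator (W - (\<Union>i\<in>I. P i)) y = indicator W y + ennreal (max 0 (m y - 1)) * indicator W y"
    proof (cases "y \<in> (\<Union>i\<in>I. P i)")
      case True
      then have "m y \<ge> 1" by (rule m_ge_1)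
      then have "ennreal (m y) = 1 + ennreal (m y - 1)" by (subst ennreal_1[symmetric], subst ennreal_plus[symmetric]) auto
      then show ?thesis using True \<open>m y \<ge> 1\<close> by (auto split: split_indicator)
    next
      case False
      then have "m y = 0" unfolding m_def by (intro sum.neutral) auto
      then show ?thesis using False by (auto split: split_indicator)
    qed
  qed
  also have "\<dots> = emeasure lborel W + emeasure excess W"
    using W by (subst nn_integral_add) (auto simp: emeasure_excess)
  finally show ?thesis .
qed

end

lemma plank_pullback:
  fixes e f :: "real ^ 2"
  assumes "plank S" and d: "det2 e f \<noteq> 0"
  shows "\<exists>p q a b. p\<^sup>2 + q\<^sup>2 = 1 \<and> (\<lambda>y. fst y *\<^sub>R e + snd y *\<^sub>R f) -` S = strip p q a b"
proof -
  obtain u a b where u: "u \<noteq> 0" and S: "S = {x. a \<le> u \<bullet> x \<and> u \<bullet> x \<le> b}"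
    using assms(1) unfolding plank_def by blast
  define n where "n = sqrt ((u \<bullet> e)\<^sup>2 + (u \<bullet> f)\<^sup>2)"
  have "(u \<bullet> e)\<^sup>2 + (u \<bullet> f)\<^sup>2 \<noteq> 0"
  proof
    assume "(u \<bullet> e)\<^sup>2 + (u \<bullet> f)\<^sup>2 = 0"
    then have "u \<bullet> e = 0" "u \<bullet> f = 0" by (simp_all add: sum_power2_eq_zero_iff)
    then have "u \<bullet> (det2 e f *\<^sub>R u) = 0" unfolding det2_cramer[of e f u] by (simp add: inner_add_right)
    then show False using d u by simp
  qed
  then have n: "n > 0" by (simp add: n_def add_nonneg_nonneg less_le)
  have sq: "n\<^sup>2 = (u \<bullet> e)\<^sup>2 + (u \<bullet> f)\<^sup>2" by (simp add: n_def)
  have "(u \<bullet> e / n)\<^sup>2 + (u \<bullet> f / n)\<^sup>2 = 1"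
    using n by (simp add: power_divide add_divide_distrib[symmetric] flip: sq)
  moreover have "(\<lambda>y. fst y *\<^sub>R e + snd y *\<^sub>R f) -` S = strip (u \<bullet> e / n) (u \<bullet> f / n) (a / n) (b / n)"
  proof (rule set_eqI)
    fix y :: "real \<times> real"
    have "u \<bullet> (fst y *\<^sub>R e + snd y *\<^sub>R f) = n * (u \<bullet> e / n * fst y + u \<bullet> f / n * snd y)"
      using n by (simp add: inner_add_right field_simps)
    then show "y \<in> (\<lambda>y. fst y *\<^sub>R e + snd y *\<^sub>R f) -` S \<longleftrightarrow> y \<in> strip (u \<bullet> e / n) (u \<bullet> f / n) (a / n) (b / n)"
      using n by (simp add: S strip_def pos_divide_le_eq pos_le_divide_eq mult.commute)
  qed
  ultimately show ?thesis by blast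
qed

lemma plank_closed: "plank S \<Longrightarrow> closed S"
  unfolding plank_def by (auto intro!: closed_Collect_conj closed_Collect_le continuous_intros)

theorem mainTheorem3:
  shows "\<exists>c\<^sub>0 r\<^sub>0 :: real. c\<^sub>0 > 0 \<and> r\<^sub>0 > 0 \<and>
    (\<forall>(K :: (real ^ 2) set) (I :: nat set) (P :: nat \<Rightarrow> (real ^ 2) set) (H :: (real ^ 2) set) (r :: real).
      convex_body K \<longrightarrow> origin_symmetric K \<longrightarrow>
      finite I \<longrightarrow> (\<forall>i\<in>I. plank (P i)) \<longrightarrow>
      H = K - (\<Union>i\<in>I. P i) \<longrightarrow>
      0 < r \<longrightarrow> r < r\<^sub>0 \<longrightarrow> H \<subseteq> (\<lambda>x. r *\<^sub>R x) ` K \<longrightarrow>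
      (\<Sum>i\<in>I. area (P i \<inter> K)) \<ge> area K + c\<^sub>0 / r * area H)"
proof -
  obtain c \<rho>0 :: real where c: "c > 0" and \<rho>0: "\<rho>0 > 0" "\<rho>0 \<le> 1" and bound:
    "\<And>I p q a b \<rho>. strips I p q \<Longrightarrow> 0 < \<rho> \<Longrightarrow> \<rho> \<le> \<rho>0 \<Longrightarrow> strips.Z I p q a b \<subseteq> cball 0 \<rho> \<Longrightarrow>
       ennreal c * emeasure lborel (strips.Z I p q a b) \<le> ennreal \<rho> * emeasure (strips.excess I p q a b) (cball 0 2)"
    using overlap_dominates_hole by metis
  \<comment> \<open>The second bound makes \<open>c / (6 * r) - 1\<close> at least \<open>c / (12 * r)\<close>, which absorbs the term \<open>- |H|\<close>
    of the mass identity.\<close>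
  define r0 where "r0 = min (\<rho>0 / 6) (c / 12)"
  have r0: "r0 > 0" using c \<rho>0 by (simp add: r0_def)
  show ?thesis
  proof (rule exI[of _ "c / 12"], rule exI[of _ r0], intro conjI allI impI)
    show "c / 12 > 0" "r0 > 0" using c r0 by auto
    fix K :: "(real ^ 2) set" and I :: "nat set" and T :: "nat \<Rightarrow> (real ^ 2) set" and H :: "(real ^ 2) set" and r :: real
    assume K: "convex_body K" "origin_symmetric K" and I: "finite I" and T: "\<forall>i\<in>I. plank (T i)"
      and H: "H = K - (\<Union>i\<in>I. T i)" and r: "0 < r" "r < r0" and sub: "H \<subseteq> (\<lambda>x. r *\<^sub>R x) ` K"
    obtain e f where ef: "e \<in> K" "f \<in> K" "det2 e f > 0" "\<And>x y. x \<in> K \<Longrightarrow> y \<in> K \<Longrightarrow> \<bar>det2 x y\<bar> \<le> det2 e f"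
      using maximal_basis[OF K] by blast
    \<comment> \<open>With the factor \<open>1/4\<close> the preimage of \<open>K\<close> contains the disc of radius 2, for which
      \<open>overlap_dominates_hole\<close> is stated; it lies in the disc of radius 6 because \<open>4 * sqrt 2 < 6\<close>.\<close>
    define e' where "e' = (1/4) *\<^sub>R e"
    define f' where "f' = (1/4) *\<^sub>R f"
    let ?\<psi> = "\<lambda>y :: real \<times> real. fst y *\<^sub>R e' + snd y *\<^sub>R f'"
    define d where "d = det2 e' f'"
    have d: "d > 0" using ef(3) by (simp add: d_def e'_def f'_def det2_scale)
    have cK: "compact K" "convex K" using K by (auto simp: convex_body_def)
    have Kb: "K \<in> sets borel" using cK by (intro borel_closed compact_imp_closed)
    have Tb: "T i \<in> sets borel" if "i \<in> I" for i using T that by (intro borel_closed plank_closed) auto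
    have Hb: "H \<in> sets borel" unfolding H using Kb Tb I by (intro sets.Diff sets.finite_UN) auto
    have meas: "emeasure lborel B = ennreal d * emeasure lborel (?\<psi> -` B)" "?\<psi> -` B \<in> sets borel" if "B \<in> sets borel" for B
      using emeasure_basis_change[OF that, of e' f'] d unfolding d_def by auto
    have coord: "\<exists>y. x = ?\<psi> y \<and> \<bar>fst y\<bar> \<le> 4 \<and> \<bar>snd y\<bar> \<le> 4" if x: "x \<in> K" for x
    proof -
      let ?D = "det2 e f"
      have "x = (1 / ?D) *\<^sub>R (?D *\<^sub>R x)" using ef(3) by simp
      also have "\<dots> = ?\<psi> (4 * det2 x f / ?D, 4 * det2 e x / ?D)"
        unfolding det2_cramer[of e f x] by (simp add: e'_def f'_def scaleR_add_right)
      finally have "x = ?\<psi> (4 * det2 x f / ?D, 4 * det2 e x / ?D)" .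
      moreover have "\<bar>4 * det2 x f / ?D\<bar> \<le> 4" "\<bar>4 * det2 e x / ?D\<bar> \<le> 4"
        using ef(3) ef(4)[OF x ef(2)] ef(4)[OF ef(1) x] by (simp_all add: abs_mult pos_divide_le_eq)
      ultimately show ?thesis by (metis fst_conv snd_conv)
    qed
    have inj: "y = y'" if "?\<psi> y = ?\<psi> y'" for y y'
    proof -
      have "det2 (?\<psi> y) f' = det2 (?\<psi> y') f'" "det2 e' (?\<psi> y) = det2 e' (?\<psi> y')" using that by simp_all
      then have "fst y * d = fst y' * d" "snd y * d = snd y' * d"
        by (simp_all add: det2_add det2_scale d_def) (simp_all add: det2_def)
      then show ?thesis using d by (simp add: prod_eq_iff)
    qed
    have nrm6: "norm y \<le> 6" if "\<bar>fst y\<bar> \<le> 4" "\<bar>snd y\<bar> \<le> 4" for y :: "real \<times> real"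
    proof -
      have "\<bar>fst y\<bar>\<^sup>2 + \<bar>snd y\<bar>\<^sup>2 \<le> 4\<^sup>2 + 4\<^sup>2" using that by (intro add_mono power_mono) auto
      then have "sqrt ((fst y)\<^sup>2 + (snd y)\<^sup>2) \<le> 6" by (intro real_le_lsqrt) auto
      then show ?thesis by (cases y) (simp add: norm_Pair)
    qed
    define W where "W = ?\<psi> -` K"
    have W6: "W \<subseteq> cball 0 6"
    proof
      fix y assume "y \<in> W"
      then have "?\<psi> y \<in> K" by (simp add: W_def)
      then obtain y' where "?\<psi> y = ?\<psi> y'" "\<bar>fst y'\<bar> \<le> 4" "\<bar>snd y'\<bar> \<le> 4" using coord by blast
      then show "y \<in> cball 0 6" using inj[of y y'] nrm6[of y'] by simp
    qed
    have W2: "cball 0 2 \<subseteq> W"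
    proof
      fix y :: "real \<times> real" assume "y \<in> cball 0 2"
      then have n: "\<bar>fst y\<bar> \<le> 2" "\<bar>snd y\<bar> \<le> 2"
        using norm_fst_le[of "fst y" "snd y"] norm_snd_le[of "snd y" "fst y"] by simp_all
      have seg: "s *\<^sub>R x \<in> K" if "x \<in> K" "\<bar>s\<bar> \<le> 1" for s x
      proof (cases "s \<ge> 0")
        case True
        have "s *\<^sub>R x + (1 - s) *\<^sub>R 0 \<in> K"
          using cK(2) that symmetric_zero[OF K] True by (intro convexD) auto
        then show ?thesis by simp
      next
        case False
        have "(- s) *\<^sub>R (- x) + (1 - (- s)) *\<^sub>R 0 \<in> K"
          using cK(2) that symmetric_zero[OF K] symmetric_minus[OF K(2) that(1)] False by (intro convexD) auto
        then show ?thesis by simp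
      qed
      have "(fst y / 2) *\<^sub>R e \<in> K" "(snd y / 2) *\<^sub>R f \<in> K" using n by (intro seg ef; simp)+
      then have "(1/2) *\<^sub>R ((fst y / 2) *\<^sub>R e) + (1/2) *\<^sub>R ((snd y / 2) *\<^sub>R f) \<in> K"
        using cK(2) by (intro convexD) auto
      then show "y \<in> W" by (simp add: W_def e'_def f'_def)
    qed
    have Wb: "W \<in> sets borel" "bounded W" using meas(2)[OF Kb] W6 bounded_subset[OF bounded_cball W6] by (auto simp: W_def)
    have "\<forall>i\<in>I. \<exists>w. (fst (fst w))\<^sup>2 + (snd (fst w))\<^sup>2 = 1 \<and> ?\<psi> -` T i = strip (fst (fst w)) (snd (fst w)) (fst (snd w)) (snd (snd w))"
    proof
      fix i assume "i \<in> I"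
      then have "plank (T i)" using T by simp
      from plank_pullback[OF this, of e' f'] d obtain p q a b where "p\<^sup>2 + q\<^sup>2 = 1" "?\<psi> -` T i = strip p q a b"
        unfolding d_def by auto
      then show "\<exists>w. (fst (fst w))\<^sup>2 + (snd (fst w))\<^sup>2 = 1 \<and> ?\<psi> -` T i = strip (fst (fst w)) (snd (fst w)) (fst (snd w)) (snd (snd w))"
        by (intro exI[of _ "((p, q), (a, b))"]) simp
    qed
    from bchoice[OF this] obtain g where g: "\<forall>i\<in>I. (fst (fst (g i)))\<^sup>2 + (snd (fst (g i)))\<^sup>2 = 1 \<and>
       ?\<psi> -` T i = strip (fst (fst (g i))) (snd (fst (g i))) (fst (snd (g i))) (snd (snd (g i)))" by blast
    define p where "p i = fst (fst (g i))" for i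
    define q where "q i = snd (fst (g i))" for i
    define a where "a i = fst (snd (g i))" for i
    define b where "b i = snd (snd (g i))" for i
    have st: "strips I p q" using I g by unfold_locales (auto simp: p_def q_def)
    interpret strips I p q a b by (rule st)
    have PT: "P i = ?\<psi> -` T i" if "i \<in> I" for i using g that by (simp add: P_def p_def q_def a_def b_def)
    have HW: "?\<psi> -` H = W - (\<Union>i\<in>I. P i)" unfolding H W_def using PT by auto
    have H6: "W - (\<Union>i\<in>I. P i) \<subseteq> cball 0 (6 * r)"
    proof
      fix y assume "y \<in> W - (\<Union>i\<in>I. P i)"
      then have "?\<psi> y \<in> H" using HW by blast
      then obtain x where x: "x \<in> K" "?\<psi> y = r *\<^sub>R x" using sub by auto
      obtain y' where y': "x = ?\<psi> y'" "\<bar>fst y'\<bar> \<le> 4" "\<bar>snd y'\<bar> \<le> 4" using coord[OF x(1)] by blast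
      have "?\<psi> y = ?\<psi> (r *\<^sub>R y')" using x y' by (simp add: scaleR_add_right)
      then have "y = r *\<^sub>R y'" by (rule inj)
      then show "y \<in> cball 0 (6 * r)" using nrm6[OF y'(2,3)] r by (simp add: mult.commute)
    qed
    have r6: "6 * r \<le> \<rho>0" "12 * r \<le> c" using r by (auto simp: r0_def)
    have ZH: "Z = W - (\<Union>i\<in>I. P i)"
      unfolding Z_def using W2 subset_cball[of "6 * r" 2 0] H6 r6 \<rho>0 by auto
    have "ennreal c * emeasure lborel Z \<le> ennreal (6 * r) * emeasure excess (cball 0 2)"
      by (rule bound[OF st]) (use r r6 H6 ZH in auto)
    also have "\<dots> \<le> ennreal (6 * r) * emeasure excess W" using W2 Wb by (intro mult_left_mono emeasure_mono) auto
    finally have main_le: "ennreal c * emeasure lborel Z \<le> ennreal (6 * r) * emeasure excess W" .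
    have fZ: "emeasure lborel Z = ennreal (measure lborel Z)"
      using bounded_subset[OF bounded_cball, of Z 0 2]
      by (intro emeasure_eq_ennreal_measure) (auto simp: Z_def dest: emeasure_bounded_finite)
    have fW: "emeasure lborel W = ennreal (measure lborel W)"
      using emeasure_bounded_finite[OF Wb(2)] by (intro emeasure_eq_ennreal_measure) auto
    let ?S = "\<Sum>i\<in>I. measure lborel (P i \<inter> W)"
    have S0: "?S \<ge> 0" by (rule sum_nonneg) simp
    have id: "ennreal ?S + emeasure lborel Z = emeasure lborel W + emeasure excess W"
      using mass_identity[OF Wb(2,1)] ZH by simp
    have key: "?S + measure lborel Z \<ge> measure lborel W + c / (6 * r) * measure lborel Z"
    proof -
      have "ennreal (c / (6 * r) * measure lborel Z) \<le> emeasure excess W"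
      proof -
        have "ennreal (6 * r) * ennreal (c / (6 * r) * measure lborel Z) = ennreal (c * measure lborel Z)"
          using r c by (subst ennreal_mult[symmetric]) auto
        also have "\<dots> = ennreal c * emeasure lborel Z" using c by (simp add: fZ ennreal_mult)
        also note main_le
        finally show ?thesis using r by (simp add: ennreal_mult_le_mult_iff)
      qed
      then have "ennreal (measure lborel W) + ennreal (c / (6 * r) * measure lborel Z) \<le> ennreal ?S + ennreal (measure lborel Z)"
        using id unfolding fZ[symmetric] fW[symmetric] by (simp add: add_left_mono)
      then have "ennreal (measure lborel W + c / (6 * r) * measure lborel Z) \<le> ennreal (?S + measure lborel Z)"
        using c r S0 by simp
      then show ?thesis using S0 by (subst (asm) ennreal_le_iff) auto
    qed
    have "c / 12 / r * measure lborel Z \<le> (c / (6 * r) - 1) * measure lborel Z"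
    proof (rule mult_right_mono)
      have "1 \<le> c / 12 / r" using r6 r by (simp add: pos_le_divide_eq)
      moreover have "c / (6 * r) = 2 * (c / 12 / r)" by simp
      ultimately show "c / 12 / r \<le> c / (6 * r) - 1" by linarith
    qed simp
    with key have fin_le: "?S \<ge> measure lborel W + c / 12 / r * measure lborel Z" by (simp add: left_diff_distrib)
    have ar: "area B = d * measure lborel (?\<psi> -` B)" if "B \<in> sets borel" for B
      using meas(1)[OF that] that d by (simp add: measure_completion measure_def enn2real_mult)
    have "area K + c / 12 / r * area H = d * (measure lborel W + c / 12 / r * measure lborel Z)"
      using ar[OF Kb] ar[OF Hb] by (simp add: W_def[symmetric] HW ZH distrib_left)
    also have "\<dots> \<le> d * ?S" using fin_le d by simp
    also have "\<dots> = (\<Sum>i\<in>I. area (T i \<inter> K))"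
      unfolding sum_distrib_left
    proof (rule sum.cong)
      fix i assume i: "i \<in> I"
      have "P i \<inter> W = ?\<psi> -` (T i \<inter> K)" using PT[OF i] by (auto simp: W_def)
      then show "d * measure lborel (P i \<inter> W) = area (T i \<inter> K)" using ar[of "T i \<inter> K"] Tb[OF i] Kb by simp
    qed simp
    finally show "area K + c / 12 / r * area H \<le> (\<Sum>i\<in>I. area (T i \<inter> K))" .
  qed
qed

end
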